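(* Let $p$ be a prime, let $k$ be a field with $\operatorname{char}(k)=p$, and let $H$ be a finite-dimensional connected Hopf algebra over $k$ which is commutative. Let $L\subsetneq H$ be an essential extension, and assume that $L=(kG)^*$ for some $p$-group $G$. Then there exists an element $z\in H$ satisfying the following conditions: (1) $L$ and $z$ generate $H$ as an algebra. (2) $\Delta(z)=z\otimes 1+1\otimes z+u$, where $u\in L\otimes L$ is a $2$-cocycle in the complex $(L^{\otimes\bullet},d^\bullet)$. (3) $z^{p^n}\notin L$ for all $n\ge 0$. (4) $z$ satisfies some relation $$z^{p^l}+\lambda_{l-1}z^{p^{l-1}}+\cdots+\lambda_1 z^{p}+\lambda_0 z+a=0$$ in $H$, where $l\ge 1$, $\lambda_i\in k$ for all $0\le i\le l-1$ with $\lambda_0\neq 0$, and $a\in L$. Moreover, $H$ is semisimple.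
   Context: The coradical $H_0$ of a Hopf algebra $H$ over $k$ is the sum of all simple subcoalgebras of $H$; $H$ is connected if $H_0$ is one-dimensional. Let $K$ be the Hopf subalgebra of $H$ generated by all primitive elements of $H$ (elements $x$ with $\Delta(x)=x\otimes 1+1\otimes x$). For a proper Hopf subalgebra $L$ of $H$, the extension $L\subsetneq H$ is called essential if $K\subseteq L$ and there is no Hopf subalgebra $M$ of $H$ with $L\subsetneq M\subsetneq H$. For a finite group $G$, $(kG)^*$ is the dual Hopf algebra of the group algebra $kG$; the equality $L=(kG)^*$ means isomorphism of Hopf algebras. For a Hopf algebra $L$, the complex $(L^{\otimes\bullet},d^\bullet)$ has $d^0=0$ and, for $n\ge1$ and $x\in L^{\otimes n}$, $d^n(x)=1\otimes x-(\Delta\otimes \mathrm{Id}_{n-1})(x)+\cdots+(-1)^n(\mathrm{Id}_{n-1}\otimes\Delta)(x)+(-1)^{n+1}x\otimes 1$; a $2$-cocycle is an element of $\ker d^2\subseteq L\otimes L$. A Hopf algebra is semisimple if it is semisimple as an algebra. *)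

theory Defs
  imports
    "HOL-Library.Function_Algebras"
    "HOL-Library.Poly_Mapping"
    "HOL-Computational_Algebra.Computational_Algebra"
begin

section \<open>Tensor powers of a vector space\<close>

text \<open>
  A vector space is a type with a scalar multiplication \<open>scale\<close> satisfying \<^locale>\<open>vector_space\<close>.
  All its tensor powers live in one type of functionals on multilinear forms: the pure tensor
  of the list \<open>[x1, ..., xn]\<close> is evaluation at that list, and the \<open>n\<close>-th tensor power is the span of
  these evaluations.  Since multilinear forms with values in the field separate the elements of the
  algebraic tensor product, this span is a model of the tensor product, in any dimension;
  its universal property is proved in the lemmas of this section.
\<close>

type_synonym ('k, 'a) tensor = "('a list \<Rightarrow> 'k) \<Rightarrow> 'k"

definition tensor_scale :: "'k::field \<Rightarrow> ('k, 'a) tensor \<Rightarrow> ('k, 'a) tensor"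
  where "tensor_scale c t = (\<lambda>B. c * t B)"

lemma vector_space_tensor_scale: "vector_space tensor_scale"
  by unfold_locales (auto simp: tensor_scale_def fun_eq_iff algebra_simps)

interpretation tensor: vector_space tensor_scale
  by (rule vector_space_tensor_scale)

text \<open>
  A family of \<open>n\<close>-linear maps, one for each length \<open>n\<close>.  An \<open>n\<close>-linear map for a single \<open>n\<close> is
  treated as such a family by making it zero on lists of every other length.
\<close>

definition multilinear ::
  "('k::field \<Rightarrow> 'a::ab_group_add \<Rightarrow> 'a) \<Rightarrow> ('k \<Rightarrow> 'b::ab_group_add \<Rightarrow> 'b) \<Rightarrow> ('a list \<Rightarrow> 'b) \<Rightarrow> bool"
  where "multilinear scale scale' F \<longleftrightarrow>
    (\<forall>xs ys. Vector_Spaces.linear scale scale' (\<lambda>a. F (xs @ a # ys)))"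

definition pure_tensor ::
  "('k::field \<Rightarrow> 'a::ab_group_add \<Rightarrow> 'a) \<Rightarrow> 'a list \<Rightarrow> ('k, 'a) tensor"
  where "pure_tensor scale xs = (\<lambda>B. if multilinear scale (*) B then B xs else 0)"

text \<open>For a subspace \<open>V\<close>, the \<open>n\<close>-th tensor power of \<open>V\<close> as a subspace of that of the whole space.\<close>

definition tensor_power ::
  "('k::field \<Rightarrow> 'a::ab_group_add \<Rightarrow> 'a) \<Rightarrow> nat \<Rightarrow> 'a set \<Rightarrow> ('k, 'a) tensor set"
  where "tensor_power scale n V =
    tensor.span {pure_tensor scale xs | xs. length xs = n \<and> set xs \<subseteq> V}"

text \<open>
  The linear map on tensors sending the pure tensor of \<open>xs\<close> to \<open>F xs\<close>, for multilinear \<open>F\<close>.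
\<close>

definition tensor_lift :: "('a list \<Rightarrow> ('k, 'b) tensor) \<Rightarrow> ('k, 'a) tensor \<Rightarrow> ('k, 'b) tensor"
  where "tensor_lift F t = (\<lambda>B. t (\<lambda>xs. F xs B))"

lemma tensor_lift_pure:
  assumes "multilinear scale tensor_scale F"
  shows "tensor_lift F (pure_tensor scale xs) = F xs"
proof
  fix B
  have "Vector_Spaces.linear scale (*) (\<lambda>a. F (us @ a # vs) B)" for us vs
    using assms
    unfolding multilinear_def Vector_Spaces.linear_iff tensor_scale_def
    by (auto simp: field_simps intro!: vector_space.intro)
  then show "tensor_lift F (pure_tensor scale xs) B = F xs B"
    by (simp add: tensor_lift_def pure_tensor_def multilinear_def)
qed

lemma tensor_lift_add: "tensor_lift F (s + t) = tensor_lift F s + tensor_lift F t"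
  by (simp add: tensor_lift_def fun_eq_iff)

lemma tensor_lift_scale: "tensor_lift F (tensor_scale c t) = tensor_scale c (tensor_lift F t)"
  by (simp add: tensor_lift_def tensor_scale_def fun_eq_iff)

lemma multilinear_pure_tensor:
  assumes "vector_space scale"
  shows "multilinear scale tensor_scale (pure_tensor scale)"
  using assms vector_space_tensor_scale
  by (auto simp: multilinear_def Vector_Spaces.linear_iff pure_tensor_def tensor_scale_def fun_eq_iff)

text \<open>Existence in the universal property: every multilinear map respects all relations between pure tensors.\<close>

lemma pure_tensor_universal:
  assumes F: "multilinear scale scale' F" and fin: "finite I"
    and rel: "(\<Sum>i\<in>I. tensor_scale (c i) (pure_tensor scale (xs i))) = 0"
  shows "(\<Sum>i\<in>I. scale' (c i) (F (xs i))) = 0" (is "?w = 0")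
proof (rule ccontr)
  assume w: "?w \<noteq> 0"
  have lin: "Vector_Spaces.linear scale scale' (\<lambda>a. F (us @ a # vs))" for us vs
    using F by (simp add: multilinear_def)
  interpret V': vector_space scale'
    using lin[of "[]" "[]"] by (simp add: Vector_Spaces.linear_iff)
  interpret K: vector_space "(*) :: 'a \<Rightarrow> 'a \<Rightarrow> 'a"
    by unfold_locales (auto simp: algebra_simps)
  interpret P: vector_space_pair scale' "(*) :: 'a \<Rightarrow> 'a \<Rightarrow> 'a" ..
  obtain f where f: "Vector_Spaces.linear scale' (*) f" and fw: "f ?w = 1"
    using P.linear_independent_extend[of "{?w}" "\<lambda>_. 1"] w by auto
  have B: "multilinear scale (*) (\<lambda>ys. f (F ys))"
    unfolding multilinear_def
    using Vector_Spaces.linear_compose[OF lin f] by (simp add: o_def)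
  have "f ?w = (\<Sum>i\<in>I. c i * f (F (xs i)))"
    using f by (simp add: P.linear_sum P.linear_scale)
  also have "\<dots> = (\<Sum>i\<in>I. tensor_scale (c i) (pure_tensor scale (xs i))) (\<lambda>ys. f (F ys))"
    using fin by (induction I rule: finite_induct) (auto simp: tensor_scale_def pure_tensor_def B)
  also have "\<dots> = 0"
    by (simp add: rel)
  finally show False
    using fw by simp
qed

text \<open>The tensor product of an \<open>m\<close>-tensor and an \<open>n\<close>-tensor, as an \<open>(m + n)\<close>-tensor.\<close>

definition tensor_append ::
  "('k::field \<Rightarrow> 'a::ab_group_add \<Rightarrow> 'a) \<Rightarrow> ('k, 'a) tensor \<Rightarrow> ('k, 'a) tensor \<Rightarrow> ('k, 'a) tensor"
  where "tensor_append scale s t =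
    tensor_lift (\<lambda>xs. tensor_lift (\<lambda>ys. pure_tensor scale (xs @ ys)) t) s"

text \<open>The map \<open>\<phi> \<otimes> ... \<otimes> \<phi>\<close> for a linear map \<open>\<phi>\<close> into the space with scalar multiplication \<open>scale'\<close>.\<close>

definition tensor_map ::
  "('k::field \<Rightarrow> 'b::ab_group_add \<Rightarrow> 'b) \<Rightarrow> ('a \<Rightarrow> 'b) \<Rightarrow> ('k, 'a) tensor \<Rightarrow> ('k, 'b) tensor"
  where "tensor_map scale' \<phi> = tensor_lift (\<lambda>xs. pure_tensor scale' (map \<phi> xs))"

text \<open>
  The linear map induced on 2-tensors by a bilinear map \<open>f\<close>, with values in 1-tensors, that is, in the
  vector space itself.
\<close>

definition tensor_contract ::
  "('k::field \<Rightarrow> 'b::ab_group_add \<Rightarrow> 'b) \<Rightarrow> ('a \<Rightarrow> 'a \<Rightarrow> 'b) \<Rightarrow> ('k, 'a) tensor \<Rightarrow> ('k, 'b) tensor"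
  where "tensor_contract scale' f =
    tensor_lift (\<lambda>xs. case xs of [x, y] \<Rightarrow> pure_tensor scale' [f x y] | _ \<Rightarrow> 0)"

text \<open>The map \<open>f \<otimes> g\<close> into the field.\<close>

definition tensor_eval :: "('a \<Rightarrow> 'k::field) \<Rightarrow> ('a \<Rightarrow> 'k) \<Rightarrow> ('k, 'a) tensor \<Rightarrow> 'k"
  where "tensor_eval f g t = t (\<lambda>xs. case xs of [x, y] \<Rightarrow> f x * g y | _ \<Rightarrow> 0)"

text \<open>The map \<open>Id\<^sub>i \<otimes> \<delta> \<otimes> Id\<close>, applying \<open>\<delta>\<close> to the factor with index \<open>i\<close>, counted from 0.\<close>

definition tensor_apply_at ::
  "('k::field \<Rightarrow> 'a::ab_group_add \<Rightarrow> 'a) \<Rightarrow> ('a \<Rightarrow> ('k, 'a) tensor) \<Rightarrow> nat \<Rightarrow> ('k, 'a) tensor \<Rightarrow> ('k, 'a) tensor"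
  where "tensor_apply_at scale \<delta> i =
    tensor_lift (\<lambda>xs. if i < length xs
      then tensor_append scale (pure_tensor scale (take i xs))
             (tensor_append scale (\<delta> (xs ! i)) (pure_tensor scale (drop (Suc i) xs)))
      else 0)"

text \<open>The factorwise product on the tensor powers of an algebra.\<close>

definition tensor_mult ::
  "('k::field \<Rightarrow> 'a::ring_1 \<Rightarrow> 'a) \<Rightarrow> ('k, 'a) tensor \<Rightarrow> ('k, 'a) tensor \<Rightarrow> ('k, 'a) tensor"
  where "tensor_mult scale s t =
    tensor_lift (\<lambda>xs. tensor_lift (\<lambda>ys.
      if length xs = length ys then pure_tensor scale (map2 (*) xs ys) else 0) t) s"

text \<open>On pure tensors the operations above are given by the expected formulas.\<close>

lemma vector_space_field: "vector_space ((*) :: 'k::field \<Rightarrow> 'k \<Rightarrow> 'k)"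
  by unfold_locales (auto simp: algebra_simps)

lemma linear_zero_fun:
  "vector_space scale \<Longrightarrow> Vector_Spaces.linear scale ((*) :: 'k::field \<Rightarrow> 'k \<Rightarrow> 'k) (\<lambda>_. 0)"
  by (simp add: Vector_Spaces.linear_iff vector_space_field)

lemma multilinear_pair:
  assumes "Vector_Spaces.linear scale (*) f" "Vector_Spaces.linear scale (*) f'"
  shows "multilinear scale (*) (\<lambda>xs. case xs of [x, y] \<Rightarrow> f x * f' y | _ \<Rightarrow> 0)"
  unfolding multilinear_def
proof (intro allI)
  fix us vs :: "'b list"
  have vs: "vector_space scale" using assms(1) by (simp add: Vector_Spaces.linear_iff)
  let ?P = "\<lambda>xs. case xs of [x, y] \<Rightarrow> f x * f' y | _ \<Rightarrow> 0"
  have P0: "?P xs = 0" if "length xs \<noteq> 2" for xs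
    using that by (auto split: list.split)
  consider v where "us = []" "vs = [v]" | u where "us = [u]" "vs = []" | "length us + length vs \<noteq> 1"
    by (cases us; cases vs) auto
  then show "Vector_Spaces.linear scale (*) (\<lambda>a. ?P (us @ a # vs))"
  proof cases
    case 3
    then have "(\<lambda>a. ?P (us @ a # vs)) = (\<lambda>_. 0)"
      by (intro ext P0) simp
    then show ?thesis using linear_zero_fun[OF vs] by simp
  qed (use assms in \<open>auto simp: Vector_Spaces.linear_iff algebra_simps\<close>)
qed

lemma sum_fun_apply: "(\<Sum>i\<in>I. f i) x = (\<Sum>i\<in>I. f i x)" for f :: "'i \<Rightarrow> 'b \<Rightarrow> 'c::comm_monoid_add"
  by (induction I rule: infinite_finite_induct) auto

lemma multilinearD: "multilinear scale scale' F \<Longrightarrow> Vector_Spaces.linear scale scale' (\<lambda>a. F (xs @ a # ys))"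
  by (simp add: multilinear_def)

lemma multilinear_append_left: "vector_space scale \<Longrightarrow> multilinear scale tensor_scale (\<lambda>ys. pure_tensor scale (xs @ ys))"
  unfolding multilinear_def
  by (auto simp: append_assoc[symmetric] simp del: append_assoc intro!: multilinearD multilinear_pure_tensor)

lemma multilinear_append_right: "vector_space scale \<Longrightarrow> multilinear scale tensor_scale (\<lambda>xs. pure_tensor scale (xs @ ys))"
  using multilinear_pure_tensor[of scale] unfolding multilinear_def by simp

lemma tensor_append_pure:
  "vector_space scale \<Longrightarrow> tensor_append scale (pure_tensor scale xs) (pure_tensor scale ys) = pure_tensor scale (xs @ ys)"
  by (simp add: tensor_append_def tensor_lift_pure multilinear_append_left multilinear_append_right)

lemma tensor_map_pure:
  assumes "Vector_Spaces.linear scale scale' \<phi>"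
  shows "tensor_map scale' \<phi> (pure_tensor scale xs) = pure_tensor scale' (map \<phi> xs)"
proof -
  have vs: "vector_space scale'" using assms by (simp add: Vector_Spaces.linear_iff)
  have "multilinear scale tensor_scale (\<lambda>xs. pure_tensor scale' (map \<phi> xs))"
    unfolding multilinear_def
    using Vector_Spaces.linear_compose[OF assms multilinearD[OF multilinear_pure_tensor[OF vs]]]
    by (simp add: o_def)
  then show ?thesis by (simp add: tensor_map_def tensor_lift_pure)
qed

lemma tensor_contract_pure:
  assumes "\<And>x. Vector_Spaces.linear scale scale' (f x)" "\<And>y. Vector_Spaces.linear scale scale' (\<lambda>x. f x y)"
  shows "tensor_contract scale' f (pure_tensor scale [x, y]) = pure_tensor scale' [f x y]"
proof -
  have vs: "vector_space scale'" "vector_space scale" using assms(1) by (auto simp add: Vector_Spaces.linear_iff)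
  have lin1: "Vector_Spaces.linear scale' tensor_scale (\<lambda>a. pure_tensor scale' [a])"
    using multilinearD[OF multilinear_pure_tensor[OF vs(1)], of "[]" "[]"] by simp
  have lin0: "Vector_Spaces.linear scale tensor_scale (\<lambda>_. 0)"
    using vs vector_space_tensor_scale by (auto simp: Vector_Spaces.linear_iff tensor_scale_def)
  let ?P = "\<lambda>xs. case xs of [x, y] \<Rightarrow> pure_tensor scale' [f x y] | _ \<Rightarrow> 0"
  have P0: "?P xs = 0" if "length xs \<noteq> 2" for xs
    using that by (auto split: list.split)
  have "multilinear scale tensor_scale ?P"
    unfolding multilinear_def
  proof (intro allI)
    fix us vs :: "'a list"
    consider v where "us = []" "vs = [v]" | u where "us = [u]" "vs = []" | "length us + length vs \<noteq> 1"
      by (cases us; cases vs) auto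
    then show "Vector_Spaces.linear scale tensor_scale (\<lambda>a. ?P (us @ a # vs))"
    proof cases
      case 3
      then have "(\<lambda>a. ?P (us @ a # vs)) = (\<lambda>_. 0)"
        by (intro ext P0) simp
      then show ?thesis using lin0 by simp
    next
      case 1 then show ?thesis
        using Vector_Spaces.linear_compose[OF assms(2) lin1] by (simp add: o_def)
    next
      case 2 then show ?thesis
        using Vector_Spaces.linear_compose[OF assms(1) lin1] by (simp add: o_def)
    qed
  qed
  then show ?thesis by (simp add: tensor_contract_def tensor_lift_pure)
qed

lemma tensor_power_form_linear:
  assumes "t \<in> tensor_power scale n UNIV" "multilinear scale (*) F" "multilinear scale (*) G"
  shows "t (\<lambda>xs. F xs + G xs) = t F + t G" "t (\<lambda>xs. c * F xs) = c * t F"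
proof -
  have FG: "multilinear scale (*) (\<lambda>xs. F xs + G xs)" "multilinear scale (*) (\<lambda>xs. c * F xs)"
    using assms(2,3) by (auto simp: multilinear_def Vector_Spaces.linear_iff algebra_simps)
  let ?S = "{t. t (\<lambda>xs. F xs + G xs) = t F + t G \<and> t (\<lambda>xs. c * F xs) = c * t F}"
  have "tensor.subspace ?S"
    by (auto simp: tensor.subspace_def tensor_scale_def algebra_simps)
  moreover have "{pure_tensor scale xs | xs. length xs = n \<and> set xs \<subseteq> UNIV} \<subseteq> ?S"
    using assms FG by (auto simp: pure_tensor_def)
  ultimately have "tensor_power scale n UNIV \<subseteq> ?S"
    unfolding tensor_power_def by (rule tensor.span_minimal[rotated])
  then show "t (\<lambda>xs. F xs + G xs) = t F + t G" "t (\<lambda>xs. c * F xs) = c * t F" using assms by blast+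
qed


lemma tensor_append_pure_right:
  assumes "vector_space scale"
  shows "tensor_append scale t (pure_tensor scale d) = tensor_lift (\<lambda>xs. pure_tensor scale (xs @ d)) t"
  by (simp add: tensor_append_def tensor_lift_pure multilinear_append_left assms)

lemma multilinear_pure_form: assumes "vector_space scale" shows "multilinear scale (*) (\<lambda>xs. pure_tensor scale (c @ xs @ d) B)"
proof (cases "multilinear scale (*) B")
  case True
  have "multilinear scale (*) (\<lambda>xs. B (c @ xs @ d))"
    unfolding multilinear_def using multilinearD[OF True, of "c @ _" "_ @ d"] by simp
  with True show ?thesis by (simp add: pure_tensor_def)
next
  case False
  have "multilinear scale (*) (\<lambda>xs. 0)" by (simp add: multilinear_def linear_zero_fun assms)
  with False show ?thesis by (simp add: pure_tensor_def)
qed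

lemma tensor_append_three:
  assumes vs: "vector_space scale" and t: "t \<in> tensor_power scale n UNIV"
  shows "tensor_append scale (pure_tensor scale c) (tensor_append scale t (pure_tensor scale d)) =
    (\<lambda>B. t (\<lambda>xs. pure_tensor scale (c @ xs @ d) B))"
proof -
  have "multilinear scale tensor_scale (\<lambda>xs. tensor_lift (\<lambda>ys. pure_tensor scale (xs @ ys)) (tensor_lift (\<lambda>xs. pure_tensor scale (xs @ d)) t))"
    (is "multilinear _ _ ?F")
    unfolding multilinear_def
  proof (intro allI)
    fix us vs
    have E: "?F xs = (\<lambda>B. t (\<lambda>zs. pure_tensor scale (xs @ zs @ d) B))" for xs
    proof
      fix B
      have "multilinear scale (*) (\<lambda>ys. pure_tensor scale (xs @ ys) B)" using multilinear_pure_form[OF vs, of xs "[]" B] by simp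
      then show "?F xs B = t (\<lambda>zs. pure_tensor scale (xs @ zs @ d) B)"
        by (simp add: tensor_lift_def) (simp add: pure_tensor_def)
    qed
    have 1: "pure_tensor scale (us @ (a + b) # r) = pure_tensor scale (us @ a # r) + pure_tensor scale (us @ b # r)"
         "pure_tensor scale (us @ scale k a # r) = tensor_scale k (pure_tensor scale (us @ a # r))" for a b k r
      using multilinearD[OF multilinear_pure_tensor[OF vs], of us r] by (auto simp: Vector_Spaces.linear_iff)
    have ml: "multilinear scale (*) (\<lambda>xs. pure_tensor scale (us @ a # vs @ xs @ d) B)" for a B
      using multilinear_pure_form[OF vs, of "us @ a # vs" d B] by simp
    show "Vector_Spaces.linear scale tensor_scale (\<lambda>a. ?F (us @ a # vs))"
      unfolding E using vs vector_space_tensor_scale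
      by (auto simp: Vector_Spaces.linear_iff 1 fun_eq_iff tensor_scale_def tensor_power_form_linear[OF t ml ml])
  qed
  then show ?thesis
    unfolding tensor_append_pure_right[OF vs]
    unfolding tensor_append_def
    apply (simp add: tensor_lift_pure)
    apply (rule ext)
    subgoal for B
      using multilinear_pure_form[OF vs, of c "[]" B]
      by (simp add: tensor_lift_def) (simp add: pure_tensor_def)
    done
qed

lemma tensor_apply_at_pure:
  fixes xs :: "'a::ab_group_add list"
  assumes vs: "vector_space scale" and t: "\<And>x. \<delta> x \<in> tensor_power scale n UNIV"
    and lin: "Vector_Spaces.linear scale tensor_scale \<delta>" and i: "i < length xs"
  shows "tensor_apply_at scale \<delta> i (pure_tensor scale xs) =
     tensor_append scale (pure_tensor scale (take i xs))
             (tensor_append scale (\<delta> (xs ! i)) (pure_tensor scale (drop (Suc i) xs)))"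
proof -
  let ?F = "\<lambda>xs. if i < length xs
      then (\<lambda>B. \<delta> (xs ! i) (\<lambda>zs. pure_tensor scale (take i xs @ zs @ drop (Suc i) xs) B)) else 0"
  have lin0: "Vector_Spaces.linear scale tensor_scale (\<lambda>_. 0)"
    using vs vector_space_tensor_scale by (auto simp: Vector_Spaces.linear_iff tensor_scale_def)
  have add1: "pure_tensor scale (us @ (a + b) # r) = pure_tensor scale (us @ a # r) + pure_tensor scale (us @ b # r)"
         "pure_tensor scale (us @ scale k a # r) = tensor_scale k (pure_tensor scale (us @ a # r))" for a b k us r
      using multilinearD[OF multilinear_pure_tensor[OF vs], of us r] by (auto simp: Vector_Spaces.linear_iff)
  have "multilinear scale tensor_scale ?F"
    unfolding multilinear_def
  proof (intro allI)
    fix us vs :: "'a list"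
    consider "i < length us" | "i = length us" | "i > length us" "i < length us + Suc (length vs)" | "i \<ge> length us + Suc (length vs)" by linarith
    then show "Vector_Spaces.linear scale tensor_scale (\<lambda>a. ?F (us @ a # vs))"
    proof cases
      case 4 then have "(\<lambda>a. ?F (us @ a # vs)) = (\<lambda>_. 0)" by auto
      then show ?thesis using lin0 by simp
    next
      case 2 then show ?thesis using lin
        by (auto simp: Vector_Spaces.linear_iff fun_eq_iff tensor_scale_def)
    next
      case 1
      then have E: "?F (us @ a # vs) = (\<lambda>B. \<delta> (us ! i) (\<lambda>zs. pure_tensor scale ((take i us @ zs @ drop (Suc i) us) @ a # vs) B))" for a
        by (auto simp: nth_append)
      have ml: "multilinear scale (*) (\<lambda>zs. pure_tensor scale ((take i us @ zs @ drop (Suc i) us) @ a # vs) B)" for a B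
        using multilinear_pure_form[OF vs, of "take i us" "drop (Suc i) us @ a # vs" B] by simp
      show ?thesis unfolding E using vs vector_space_tensor_scale
        by (auto simp: Vector_Spaces.linear_iff add1 fun_eq_iff tensor_scale_def tensor_power_form_linear[OF t ml ml] simp del: append_assoc)
    next
      case 3
      define j where "j = i - Suc (length us)"
      have i: "i = length us + Suc j" "j < length vs" using 3 by (auto simp: j_def)
      have E: "?F (us @ a # vs) = (\<lambda>B. \<delta> (vs ! j) (\<lambda>zs. pure_tensor scale (us @ a # (take j vs @ zs @ drop (Suc j) vs)) B))" for a
        using i by (auto simp: nth_append)
      have ml: "multilinear scale (*) (\<lambda>zs. pure_tensor scale (us @ a # (take j vs @ zs @ drop (Suc j) vs)) B)" for a B
        using multilinear_pure_form[OF vs, of "us @ a # take j vs" "drop (Suc j) vs" B] by simp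
      show ?thesis unfolding E using vs vector_space_tensor_scale
        by (auto simp: Vector_Spaces.linear_iff add1 fun_eq_iff tensor_scale_def tensor_power_form_linear[OF t ml ml])
    qed
  qed
  then show ?thesis unfolding tensor_apply_at_def tensor_append_three[OF vs t]
    using i by (simp add: tensor_lift_pure)
qed

lemma tensor_eval_add: "tensor_eval f g (s + t) = tensor_eval f g s + tensor_eval f g t"
  by (simp add: tensor_eval_def)

lemma tensor_eval_scale: "tensor_eval f g (tensor_scale c t) = c * tensor_eval f g t"
  by (simp add: tensor_eval_def tensor_scale_def)

lemma tensor_eval_sum: "tensor_eval f g (\<Sum>i\<in>I. t i) = (\<Sum>i\<in>I. tensor_eval f g (t i))"
  by (simp add: tensor_eval_def sum_fun_apply)

lemma tensor_eval_pure:
  assumes "Vector_Spaces.linear scale (*) f" "Vector_Spaces.linear scale (*) f'"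
  shows "tensor_eval f f' (pure_tensor scale [x, y]) = f x * f' y"
  unfolding tensor_eval_def pure_tensor_def by (subst if_P[OF multilinear_pair[OF assms]]) simp

lemma tensor_eval_zero: "tensor_eval f g 0 = 0"
  by (simp add: tensor_eval_def)


section \<open>Algebras, coalgebras and Hopf algebras over a field\<close>

locale field_algebra = vector_space scale
  for scale :: "'k::field \<Rightarrow> 'a::ring_1 \<Rightarrow> 'a" +
  assumes scale_mult_left: "scale c (x * y) = scale c x * y"
    and scale_mult_right: "scale c (x * y) = x * scale c y"
begin

definition finite_dimensional :: bool
  where "finite_dimensional \<longleftrightarrow> (\<exists>B. finite B \<and> span B = UNIV)"

definition subalgebra :: "'a set \<Rightarrow> bool"
  where "subalgebra A \<longleftrightarrow> subspace A \<and> 1 \<in> A \<and> (\<forall>x\<in>A. \<forall>y\<in>A. x * y \<in> A)"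

definition left_ideal :: "'a set \<Rightarrow> bool"
  where "left_ideal I \<longleftrightarrow> subspace I \<and> (\<forall>a. \<forall>x\<in>I. a * x \<in> I)"

definition minimal_left_ideal :: "'a set \<Rightarrow> bool"
  where "minimal_left_ideal I \<longleftrightarrow>
    left_ideal I \<and> I \<noteq> {0} \<and> (\<forall>J. left_ideal J \<and> J \<subseteq> I \<longrightarrow> J = {0} \<or> J = I)"

text \<open>The algebra is semisimple: its left regular module is the sum of its simple submodules.\<close>

definition semisimple :: bool
  where "semisimple \<longleftrightarrow> span (\<Union>{I. minimal_left_ideal I}) = UNIV"

end

lemma tensor_mult_pure:
  assumes "field_algebra scale" "length xs = length ys"
  shows "tensor_mult scale (pure_tensor scale xs) (pure_tensor scale ys) = pure_tensor scale (map2 (*) xs ys)"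
proof -
  interpret field_algebra scale by fact
  have vs: "vector_space scale" ..
  have lin0: "Vector_Spaces.linear scale tensor_scale (\<lambda>_. 0)"
    using vs vector_space_tensor_scale by (auto simp: Vector_Spaces.linear_iff tensor_scale_def)
  have l: "Vector_Spaces.linear scale scale (\<lambda>a. b * a)" "Vector_Spaces.linear scale scale (\<lambda>a. a * b)" for b
    by (auto simp: Vector_Spaces.linear_iff vs distrib_left distrib_right scale_mult_right[symmetric] scale_mult_left)
  have A: "Vector_Spaces.linear scale tensor_scale (\<lambda>a. pure_tensor scale (us @ h a # vs))"
     if "Vector_Spaces.linear scale scale h" for us vs h
    using Vector_Spaces.linear_compose[OF that, of tensor_scale "\<lambda>a. pure_tensor scale (us @ a # vs)"] multilinear_pure_tensor[OF vs]
    by (auto simp: multilinear_def o_def)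
  have 1: "multilinear scale tensor_scale (\<lambda>ys. if length xs = length ys then pure_tensor scale (map2 (*) xs ys) else 0)" for xs
    unfolding multilinear_def
  proof (intro allI)
    fix us vs
    show "Vector_Spaces.linear scale tensor_scale (\<lambda>a. if length xs = length (us @ a # vs) then pure_tensor scale (map2 (*) xs (us @ a # vs)) else 0)"
    proof (cases "length xs = length us + Suc (length vs)")
      case False then show ?thesis using lin0 by simp
    next
      case True
      then obtain xs1 b xs2 where "xs = xs1 @ b # xs2" "length xs1 = length us"
        by (metis id_take_nth_drop length_take less_add_Suc1 add_Suc_right min.absorb4)
      then show ?thesis using True A[OF l(1)] by simp
    qed
  qed
  have 2: "multilinear scale tensor_scale (\<lambda>xs. if length xs = length ys then pure_tensor scale (map2 (*) xs ys) else 0)"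
    unfolding multilinear_def
  proof (intro allI)
    fix us vs
    show "Vector_Spaces.linear scale tensor_scale (\<lambda>a. if length (us @ a # vs) = length ys then pure_tensor scale (map2 (*) (us @ a # vs) ys) else 0)"
    proof (cases "length ys = length us + Suc (length vs)")
      case False then show ?thesis using lin0 by simp
    next
      case True
      then obtain xs1 b xs2 where "ys = xs1 @ b # xs2" "length xs1 = length us"
        by (metis id_take_nth_drop length_take less_add_Suc1 add_Suc_right min.absorb4)
      then show ?thesis using True A[OF l(2)] by simp
    qed
  qed
  show ?thesis
    unfolding tensor_mult_def tensor_lift_pure[OF 1]
    using tensor_lift_pure[OF 2, of xs] assms(2) by simp
qed

locale coalgebra = vector_space scale
  for scale :: "'k::field \<Rightarrow> 'a::ab_group_add \<Rightarrow> 'a" +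
  fixes \<Delta> :: "'a \<Rightarrow> ('k, 'a) tensor"
    and \<epsilon> :: "'a \<Rightarrow> 'k"
  assumes comult_in: "\<Delta> x \<in> tensor_power scale 2 UNIV"
    and comult_linear: "Vector_Spaces.linear scale tensor_scale \<Delta>"
    and counit_linear: "Vector_Spaces.linear scale (*) \<epsilon>"
    and coassoc: "tensor_apply_at scale \<Delta> 0 (\<Delta> x) = tensor_apply_at scale \<Delta> 1 (\<Delta> x)"
    and counit_left: "tensor_contract scale (\<lambda>a b. scale (\<epsilon> a) b) (\<Delta> x) = pure_tensor scale [x]"
    and counit_right: "tensor_contract scale (\<lambda>a b. scale (\<epsilon> b) a) (\<Delta> x) = pure_tensor scale [x]"
begin

definition subcoalgebra :: "'a set \<Rightarrow> bool"
  where "subcoalgebra C \<longleftrightarrow> subspace C \<and> \<Delta> ` C \<subseteq> tensor_power scale 2 C"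

definition simple_subcoalgebra :: "'a set \<Rightarrow> bool"
  where "simple_subcoalgebra C \<longleftrightarrow>
    subcoalgebra C \<and> C \<noteq> {0} \<and> (\<forall>D. subcoalgebra D \<and> D \<subseteq> C \<longrightarrow> D = {0} \<or> D = C)"

definition coradical :: "'a set"
  where "coradical = span (\<Union>{C. simple_subcoalgebra C})"

definition connected :: bool
  where "connected \<longleftrightarrow> dim coradical = 1"

end

locale hopf_algebra = field_algebra scale + coalgebra scale \<Delta> \<epsilon>
  for scale :: "'k::field \<Rightarrow> 'a::ring_1 \<Rightarrow> 'a"
    and \<Delta> :: "'a \<Rightarrow> ('k, 'a) tensor"
    and \<epsilon> :: "'a \<Rightarrow> 'k" +
  fixes S :: "'a \<Rightarrow> 'a"
  assumes comult_mult: "\<Delta> (x * y) = tensor_mult scale (\<Delta> x) (\<Delta> y)"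
    and comult_one: "\<Delta> 1 = pure_tensor scale [1, 1]"
    and counit_mult: "\<epsilon> (x * y) = \<epsilon> x * \<epsilon> y"
    and counit_one: "\<epsilon> 1 = 1"
    and antipode_linear: "Vector_Spaces.linear scale scale S"
    and antipode_left: "tensor_contract scale (\<lambda>a b. S a * b) (\<Delta> x) = pure_tensor scale [scale (\<epsilon> x) 1]"
    and antipode_right: "tensor_contract scale (\<lambda>a b. a * S b) (\<Delta> x) = pure_tensor scale [scale (\<epsilon> x) 1]"
begin

definition hopf_subalgebra :: "'a set \<Rightarrow> bool"
  where "hopf_subalgebra L \<longleftrightarrow> subalgebra L \<and> subcoalgebra L \<and> S ` L \<subseteq> L"

definition primitive :: "'a \<Rightarrow> bool"
  where "primitive x \<longleftrightarrow> \<Delta> x = pure_tensor scale [x, 1] + pure_tensor scale [1, x]"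

definition primitively_generated :: "'a set"
  where "primitively_generated = hopf_subalgebra hull {x. primitive x}"

definition essential_extension :: "'a set \<Rightarrow> bool"
  where "essential_extension L \<longleftrightarrow>
    hopf_subalgebra L \<and> L \<noteq> UNIV \<and> primitively_generated \<subseteq> L \<and>
    \<not> (\<exists>M. hopf_subalgebra M \<and> L \<subset> M \<and> M \<subset> UNIV)"

text \<open>
  The differential \<open>d\<^sup>n\<close> on \<open>n\<close>-tensors.  For a Hopf subalgebra \<open>L\<close> it maps the tensor powers of
  \<open>L\<close> to tensor powers of \<open>L\<close>, and its restriction is the differential of \<open>L\<close>.
\<close>

definition cobar_d :: "nat \<Rightarrow> ('k, 'a) tensor \<Rightarrow> ('k, 'a) tensor"
  where "cobar_d n x = (if n = 0 then 0 else
    tensor_append scale (pure_tensor scale [1]) x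
    + (\<Sum>i=1..n. tensor_scale ((- 1) ^ i) (tensor_apply_at scale \<Delta> (i - 1) x))
    + tensor_scale ((- 1) ^ (n + 1)) (tensor_append scale x (pure_tensor scale [1])))"

definition cocycle :: "'a set \<Rightarrow> nat \<Rightarrow> ('k, 'a) tensor \<Rightarrow> bool"
  where "cocycle L n u \<longleftrightarrow> u \<in> tensor_power scale n L \<and> cobar_d n u = 0"

end

definition hopf_hom ::
  "('k::field \<Rightarrow> 'a::ring_1 \<Rightarrow> 'a) \<Rightarrow> ('a \<Rightarrow> ('k, 'a) tensor) \<Rightarrow> ('a \<Rightarrow> 'k) \<Rightarrow> ('a \<Rightarrow> 'a) \<Rightarrow>
   ('k \<Rightarrow> 'b::ring_1 \<Rightarrow> 'b) \<Rightarrow> ('b \<Rightarrow> ('k, 'b) tensor) \<Rightarrow> ('b \<Rightarrow> 'k) \<Rightarrow> ('b \<Rightarrow> 'b) \<Rightarrow>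
   ('a \<Rightarrow> 'b) \<Rightarrow> bool"
  where "hopf_hom scale \<Delta> \<epsilon> S scale' \<Delta>' \<epsilon>' S' \<phi> \<longleftrightarrow>
    Vector_Spaces.linear scale scale' \<phi> \<and>
    (\<forall>x y. \<phi> (x * y) = \<phi> x * \<phi> y) \<and> \<phi> 1 = 1 \<and>
    (\<forall>x. \<Delta>' (\<phi> x) = tensor_map scale' \<phi> (\<Delta> x)) \<and>
    (\<forall>x. \<epsilon>' (\<phi> x) = \<epsilon> x) \<and>
    (\<forall>x. S' (\<phi> x) = \<phi> (S x))"


section \<open>The group algebra of a finite group and its dual\<close>

text \<open>
  Groups are types of class \<^class>\<open>group_add\<close>, which is not assumed commutative; the group operation
  is written additively.  With this convention the ring \<open>'g \<Rightarrow>\<^sub>0 'k\<close> with its convolution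
  product is the group algebra, and \<open>Poly_Mapping.single g 1\<close> is the basis element of \<open>g\<close>.
\<close>

definition ga_scale :: "'k::field \<Rightarrow> ('g \<Rightarrow>\<^sub>0 'k) \<Rightarrow> ('g \<Rightarrow>\<^sub>0 'k)"
  where "ga_scale c = Poly_Mapping.map ((*) c)"

definition ga_comult :: "('g \<Rightarrow>\<^sub>0 'k::field) \<Rightarrow> ('k, 'g \<Rightarrow>\<^sub>0 'k) tensor"
  where "ga_comult x = (\<Sum>g\<in>Poly_Mapping.keys x. tensor_scale (Poly_Mapping.lookup x g)
    (pure_tensor ga_scale [Poly_Mapping.single g 1, Poly_Mapping.single g 1]))"

definition ga_counit :: "('g \<Rightarrow>\<^sub>0 'k::field) \<Rightarrow> 'k"
  where "ga_counit x = (\<Sum>g\<in>Poly_Mapping.keys x. Poly_Mapping.lookup x g)"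

definition ga_antipode :: "('g::group_add \<Rightarrow>\<^sub>0 'k::field) \<Rightarrow> ('g \<Rightarrow>\<^sub>0 'k)"
  where "ga_antipode x =
    (\<Sum>g\<in>Poly_Mapping.keys x. Poly_Mapping.single (- g) (Poly_Mapping.lookup x g))"

lemma lookup_ga_scale: "Poly_Mapping.lookup (ga_scale c x) g = c * Poly_Mapping.lookup x g"
  by (simp add: ga_scale_def Poly_Mapping.map.rep_eq when_def)

lemma vector_space_ga_scale: "vector_space (ga_scale :: 'k::field \<Rightarrow> ('g \<Rightarrow>\<^sub>0 'k) \<Rightarrow> _)"
  by unfold_locales (auto intro!: poly_mapping_eqI simp: lookup_ga_scale lookup_add algebra_simps)

interpretation ga: vector_space "ga_scale :: 'k::field \<Rightarrow> ('g \<Rightarrow>\<^sub>0 'k) \<Rightarrow> _"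
  by (rule vector_space_ga_scale)

lemma ga_expand: "x = (\<Sum>g\<in>Poly_Mapping.keys x. ga_scale (Poly_Mapping.lookup x g) (Poly_Mapping.single g 1))"
  for x :: "'g \<Rightarrow>\<^sub>0 'k::field"
proof (rule poly_mapping_eqI)
  fix h
  have "Poly_Mapping.lookup (\<Sum>g\<in>Poly_Mapping.keys x. ga_scale (Poly_Mapping.lookup x g) (Poly_Mapping.single g 1)) h
    = (\<Sum>g\<in>Poly_Mapping.keys x. if g = h then Poly_Mapping.lookup x g else 0)"
    unfolding lookup_sum by (intro sum.cong refl) (simp add: lookup_ga_scale lookup_single when_def)
  also have "\<dots> = Poly_Mapping.lookup x h"
    by (simp add: in_keys_iff)
  finally show "Poly_Mapping.lookup x h = Poly_Mapping.lookup
    (\<Sum>g\<in>Poly_Mapping.keys x. ga_scale (Poly_Mapping.lookup x g) (Poly_Mapping.single g 1)) h" ..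
qed

lemma ga_linear_eq:
  assumes "Vector_Spaces.linear ga_scale (*) f"
  shows "f x = (\<Sum>g\<in>Poly_Mapping.keys x. Poly_Mapping.lookup x g * f (Poly_Mapping.single g 1))"
proof -
  interpret Vector_Spaces.linear ga_scale "(*)" f by (fact assms)
  have "f x = f (\<Sum>g\<in>Poly_Mapping.keys x. ga_scale (Poly_Mapping.lookup x g) (Poly_Mapping.single g 1))"
    using ga_expand[of x] by simp
  also have "\<dots> = (\<Sum>g\<in>Poly_Mapping.keys x. Poly_Mapping.lookup x g * f (Poly_Mapping.single g 1))"
    by (simp add: sum scale)
  finally show ?thesis .
qed

lemma ga_linear_sum:
  "Vector_Spaces.linear ga_scale (*)
    (\<lambda>x :: 'g \<Rightarrow>\<^sub>0 'k::field. \<Sum>g\<in>Poly_Mapping.keys x. Poly_Mapping.lookup x g * c g)"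
proof -
  have *: "(\<Sum>g\<in>Poly_Mapping.keys x. Poly_Mapping.lookup x g * c g) = (\<Sum>g\<in>A. Poly_Mapping.lookup x g * c g)"
    if "finite A" "Poly_Mapping.keys x \<subseteq> A" for x :: "'g \<Rightarrow>\<^sub>0 'k" and A
    using that by (intro sum.mono_neutral_left) (auto simp: in_keys_iff)
  have "(\<Sum>g\<in>Poly_Mapping.keys (x + y). Poly_Mapping.lookup (x + y) g * c g) =
    (\<Sum>g\<in>Poly_Mapping.keys x. Poly_Mapping.lookup x g * c g) + (\<Sum>g\<in>Poly_Mapping.keys y. Poly_Mapping.lookup y g * c g)"
    for x y :: "'g \<Rightarrow>\<^sub>0 'k"
  proof -
    let ?A = "Poly_Mapping.keys x \<union> Poly_Mapping.keys y"
    show ?thesis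
      using *[of ?A "x + y"] *[of ?A x] *[of ?A y] Poly_Mapping.keys_add[of x y]
      by (simp only: lookup_add distrib_right sum.distrib) simp
  qed
  moreover have "(\<Sum>g\<in>Poly_Mapping.keys (ga_scale a x). Poly_Mapping.lookup (ga_scale a x) g * c g) =
    a * (\<Sum>g\<in>Poly_Mapping.keys x. Poly_Mapping.lookup x g * c g)" for a and x :: "'g \<Rightarrow>\<^sub>0 'k"
  proof -
    have "Poly_Mapping.keys (ga_scale a x) \<subseteq> Poly_Mapping.keys x"
      by (auto simp: in_keys_iff lookup_ga_scale)
    then show ?thesis
      by (subst *[of "Poly_Mapping.keys x"]) (auto simp: sum_distrib_left lookup_ga_scale mult.assoc)
  qed
  ultimately show ?thesis
    by (simp add: Vector_Spaces.linear_iff vector_space_ga_scale vector_space_field)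
qed

lemma ga_comult_eval:
  assumes "Vector_Spaces.linear ga_scale (*) f" "Vector_Spaces.linear ga_scale (*) f'"
  shows "tensor_eval f f' (ga_comult x) =
    (\<Sum>g\<in>Poly_Mapping.keys x. Poly_Mapping.lookup x g * (f (Poly_Mapping.single g 1) * f' (Poly_Mapping.single g 1)))"
  using multilinear_pair[OF assms]
  by (simp add: tensor_eval_def ga_comult_def sum_fun_apply tensor_scale_def pure_tensor_def)

typedef (overloaded) ('g, 'k) ga_dual = "{f :: ('g \<Rightarrow>\<^sub>0 'k::field) \<Rightarrow> 'k. Vector_Spaces.linear ga_scale (*) f}"
  morphisms ga_dual_apply Ga_dual
  using linear_zero_fun[OF vector_space_ga_scale] by blast

lemma linear_ga_dual_apply: "Vector_Spaces.linear ga_scale (*) (ga_dual_apply f)"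
  using ga_dual_apply by blast

setup_lifting type_definition_ga_dual

text \<open>The product of the dual is dual to the coproduct, and its unit is the counit.\<close>

instantiation ga_dual :: (type, field) ring_1
begin

lift_definition zero_ga_dual :: "('a, 'b) ga_dual" is "\<lambda>_. 0"
  by (rule linear_zero_fun[OF vector_space_ga_scale])

lift_definition plus_ga_dual :: "('a, 'b) ga_dual \<Rightarrow> ('a, 'b) ga_dual \<Rightarrow> ('a, 'b) ga_dual"
  is "\<lambda>f f' x. f x + f' x"
  by (simp add: Vector_Spaces.linear_iff algebra_simps)

lift_definition uminus_ga_dual :: "('a, 'b) ga_dual \<Rightarrow> ('a, 'b) ga_dual" is "\<lambda>f x. - f x"
  by (simp add: Vector_Spaces.linear_iff algebra_simps)

lift_definition minus_ga_dual :: "('a, 'b) ga_dual \<Rightarrow> ('a, 'b) ga_dual \<Rightarrow> ('a, 'b) ga_dual"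
  is "\<lambda>f f' x. f x - f' x"
  by (simp add: Vector_Spaces.linear_iff algebra_simps)

lift_definition one_ga_dual :: "('a, 'b) ga_dual" is ga_counit
  using ga_linear_sum[of "\<lambda>_. 1"] by (simp add: ga_counit_def[abs_def])

lift_definition times_ga_dual :: "('a, 'b) ga_dual \<Rightarrow> ('a, 'b) ga_dual \<Rightarrow> ('a, 'b) ga_dual"
  is "\<lambda>f f' x. tensor_eval f f' (ga_comult x)"
  by (simp add: ga_comult_eval ga_linear_sum)

lemma ga_dual_eqI:
  "(\<And>g. ga_dual_apply f (Poly_Mapping.single g 1) = ga_dual_apply f' (Poly_Mapping.single g 1)) \<Longrightarrow> f = f'"
proof (subst ga_dual_apply_inject[symmetric], rule ext)
  fix x
  assume *: "\<And>g. ga_dual_apply f (Poly_Mapping.single g 1) = ga_dual_apply f' (Poly_Mapping.single g 1)"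
  show "ga_dual_apply f x = ga_dual_apply f' x"
    unfolding ga_linear_eq[OF linear_ga_dual_apply[of f], of x] ga_linear_eq[OF linear_ga_dual_apply[of f'], of x]
    by (simp add: *)
qed

lemma ga_dual_times_single: "ga_dual_apply (f * f') (Poly_Mapping.single g 1) =
    ga_dual_apply f (Poly_Mapping.single g 1) * ga_dual_apply f' (Poly_Mapping.single g 1)"
  by (simp add: times_ga_dual.rep_eq ga_comult_eval[OF linear_ga_dual_apply linear_ga_dual_apply])

lemma ga_dual_one_single: "ga_dual_apply 1 (Poly_Mapping.single g 1) = 1"
  by (simp add: one_ga_dual.rep_eq ga_counit_def)

instance
proof
  fix a b c :: "('a, 'b) ga_dual"
  show "a + b + c = a + (b + c)" "a + b = b + a" "0 + a = a" "- a + a = 0" "a - b = a + - b"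
    by (transfer; simp add: algebra_simps)+
  show "a * b * c = a * (b * c)" "1 * a = a" "a * 1 = a"
    by (auto intro!: ga_dual_eqI simp: ga_dual_times_single ga_dual_one_single)
  show "(a + b) * c = a * c + b * c" "a * (b + c) = a * b + a * c"
    by (auto intro!: ga_dual_eqI simp: ga_dual_times_single plus_ga_dual.rep_eq algebra_simps)
  show "(0 :: ('a, 'b) ga_dual) \<noteq> 1"
  proof
    assume "(0 :: ('a, 'b) ga_dual) = 1"
    then have "ga_dual_apply (0 :: ('a, 'b) ga_dual) (Poly_Mapping.single undefined 1) = 1"
      by (simp only: ga_dual_one_single)
    then show False by (simp add: zero_ga_dual.rep_eq)
  qed
qed

end

lift_definition ga_dual_scale :: "'k::field \<Rightarrow> ('g, 'k) ga_dual \<Rightarrow> ('g, 'k) ga_dual"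
  is "\<lambda>c f x. c * f x"
  by (simp add: Vector_Spaces.linear_iff algebra_simps)

lemma fixed_subspace:
  assumes "\<And>s t. R (s + t) = R s + R t" "\<And>c t. R (tensor_scale c t) = tensor_scale c (R t)" "R 0 = 0"
  shows "tensor.subspace {t. t = R t}"
proof (rule tensor.subspaceI; unfold mem_Collect_eq)
  show "0 = R 0" by (rule assms(3)[symmetric])
  show "s + t = R (s + t)" if "s = R s" "t = R t" for s t
    unfolding assms(1) using that by (rule arg_cong2)
  show "tensor_scale c t = R (tensor_scale c t)" if "t = R t" for c t
    unfolding assms(2) using that by (rule arg_cong)
qed

lemma vector_space_ga_dual_scale: "vector_space (ga_dual_scale :: 'k::field \<Rightarrow> ('g, 'k) ga_dual \<Rightarrow> _)"
  by unfold_locales (transfer; simp add: fun_eq_iff algebra_simps)+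

lift_definition ga_delta :: "'g \<Rightarrow> ('g, 'k::field) ga_dual" is "\<lambda>g x. Poly_Mapping.lookup x g"
  by (simp add: Vector_Spaces.linear_iff vector_space_ga_scale vector_space_field lookup_add lookup_ga_scale)

lemma ga_dual_apply_sum: "ga_dual_apply (\<Sum>i\<in>I. f i) x = (\<Sum>i\<in>I. ga_dual_apply (f i) x)"
  by (induction I rule: infinite_finite_induct) (auto simp: zero_ga_dual.rep_eq plus_ga_dual.rep_eq)

lemma ga_dual_expand:
  "f = (\<Sum>g\<in>UNIV. ga_dual_scale (ga_dual_apply f (Poly_Mapping.single g 1)) (ga_delta g))"
  for f :: "('g::finite, 'k::field) ga_dual"
proof (rule ga_dual_eqI)
  fix h
  have "ga_dual_apply (\<Sum>g\<in>UNIV. ga_dual_scale (ga_dual_apply f (Poly_Mapping.single g 1)) (ga_delta g)) (Poly_Mapping.single h 1)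
    = (\<Sum>g\<in>UNIV. if g = h then ga_dual_apply f (Poly_Mapping.single g 1) else 0)"
    unfolding ga_dual_apply_sum
    by (intro sum.cong refl) (simp add: ga_dual_scale.rep_eq ga_delta.rep_eq lookup_single when_def)
  then show "ga_dual_apply f (Poly_Mapping.single h 1) = ga_dual_apply (\<Sum>g\<in>UNIV. ga_dual_scale (ga_dual_apply f (Poly_Mapping.single g 1)) (ga_delta g)) (Poly_Mapping.single h 1)"
    by simp
qed

lemma linear_ga_dual_eval: "Vector_Spaces.linear ga_dual_scale (*) (\<lambda>f. ga_dual_apply f a)"
  by (simp add: Vector_Spaces.linear_iff vector_space_ga_dual_scale vector_space_field
      plus_ga_dual.rep_eq ga_dual_scale.rep_eq)

lemma ga_dual_tensor_expand:
  fixes t :: "('k::field, ('g::finite, 'k) ga_dual) tensor"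
  assumes t: "t \<in> tensor_power ga_dual_scale 2 UNIV"
  shows "t = (\<Sum>g\<in>UNIV. \<Sum>h\<in>UNIV. tensor_scale
    (tensor_eval (\<lambda>f. ga_dual_apply f (Poly_Mapping.single g 1)) (\<lambda>f. ga_dual_apply f (Poly_Mapping.single h 1)) t)
    (pure_tensor ga_dual_scale [ga_delta g, ga_delta h]))" (is "t = ?R t")
proof -
  have "tensor.subspace {t. t = ?R t}"
  proof -
    have "?R (s + t) = ?R s + ?R t" "?R (tensor_scale c t) = tensor_scale c (?R t)" "?R 0 = 0" for s t c
      by (simp_all only: tensor_eval_add tensor_eval_scale tensor_eval_zero tensor.scale_left_distrib
          sum.distrib tensor.scale_sum_right tensor.scale_zero_left sum.neutral_const tensor.scale_scale)
    then show ?thesis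
      by (rule fixed_subspace)
  qed
  moreover have "pure_tensor ga_dual_scale xs = ?R (pure_tensor ga_dual_scale xs)" if "length xs = 2" for xs :: "('g, 'k) ga_dual list"
  proof -
    obtain a b where xs: "xs = [a, b]"
      using \<open>length xs = 2\<close> by (auto simp: numeral_2_eq_2 length_Suc_conv)
    have ev: "tensor_eval (\<lambda>f. ga_dual_apply f (Poly_Mapping.single g 1)) (\<lambda>f. ga_dual_apply f (Poly_Mapping.single h 1)) (pure_tensor ga_dual_scale xs)
      = ga_dual_apply a (Poly_Mapping.single g 1) * ga_dual_apply b (Poly_Mapping.single h 1)" for g h
      unfolding xs by (rule tensor_eval_pure[OF linear_ga_dual_eval linear_ga_dual_eval])
    note ml = multilinear_pure_tensor[OF vector_space_ga_dual_scale]
    interpret l1: Vector_Spaces.linear "ga_dual_scale" tensor_scale "\<lambda>x. pure_tensor ga_dual_scale [x, b]"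
      using multilinearD[OF ml, of "[]" "[b]"] by simp
    have 1: "pure_tensor ga_dual_scale [a, b] = (\<Sum>g\<in>UNIV. tensor_scale (ga_dual_apply a (Poly_Mapping.single g 1)) (pure_tensor ga_dual_scale [ga_delta g, b]))"
      by (subst ga_dual_expand[of a]) (simp only: l1.sum l1.scale)
    have 2: "pure_tensor ga_dual_scale [c, b] = (\<Sum>g\<in>UNIV. tensor_scale (ga_dual_apply b (Poly_Mapping.single g 1)) (pure_tensor ga_dual_scale [c, ga_delta g]))" for c
    proof -
      interpret l2: Vector_Spaces.linear "ga_dual_scale" tensor_scale "\<lambda>x. pure_tensor ga_dual_scale [c, x]"
        using multilinearD[OF ml, of "[c]" "[]"] by simp
      show ?thesis by (subst ga_dual_expand[of b]) (simp only: l2.sum l2.scale)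
    qed
    show ?thesis unfolding ev unfolding xs
      by (subst 1, subst 2) (simp add: tensor.scale_sum_right)
  qed
  ultimately have "tensor_power ga_dual_scale 2 UNIV \<subseteq> {t. t = ?R t}"
    unfolding tensor_power_def by (intro tensor.span_minimal) auto
  with t show ?thesis by blast
qed

text \<open>
  The coproduct of the dual is the transpose of the product of the group algebra, where the
  second tensor power of the dual is identified with the dual of the second tensor power; this
  identification requires the group to be finite.
\<close>

definition ga_dual_comult :: "('g::{group_add,finite}, 'k::field) ga_dual \<Rightarrow> ('k, ('g, 'k) ga_dual) tensor"
  where "ga_dual_comult f = (THE t. t \<in> tensor_power ga_dual_scale 2 UNIV \<and>
    (\<forall>a b. tensor_eval (\<lambda>f1. ga_dual_apply f1 a) (\<lambda>f2. ga_dual_apply f2 b) t = ga_dual_apply f (a * b)))"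

text \<open>The defining property determines a unique tensor, with the following expansion.\<close>

lemma ga_dual_comult_eq:
  "ga_dual_comult f = (\<Sum>g\<in>UNIV. \<Sum>h\<in>UNIV. tensor_scale (ga_dual_apply f (Poly_Mapping.single (g + h) 1))
    (pure_tensor ga_dual_scale [ga_delta g, ga_delta h]))" (is "_ = ?t")
  unfolding ga_dual_comult_def
proof (rule the_equality)
  have ev: "tensor_eval (\<lambda>f1. ga_dual_apply f1 a) (\<lambda>f2. ga_dual_apply f2 b)
      (pure_tensor ga_dual_scale [ga_delta g, ga_delta h]) = Poly_Mapping.lookup a g * Poly_Mapping.lookup b h" for a b g h
    by (simp only: tensor_eval_pure[OF linear_ga_dual_eval linear_ga_dual_eval] ga_delta.rep_eq)
  have "tensor_eval (\<lambda>f1. ga_dual_apply f1 a) (\<lambda>f2. ga_dual_apply f2 b) ?t = ga_dual_apply f (a * b)" for a b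
  proof -
    interpret Vector_Spaces.linear ga_scale "(*)" "ga_dual_apply f" by (rule linear_ga_dual_apply)
    have E: "x = (\<Sum>g\<in>UNIV. Poly_Mapping.single g (Poly_Mapping.lookup x g))" for x :: "'a \<Rightarrow>\<^sub>0 'b"
      by (rule poly_mapping_eqI) (simp add: lookup_sum lookup_single when_def)
    have s: "ga_dual_apply f (Poly_Mapping.single g c) = c * ga_dual_apply f (Poly_Mapping.single g 1)" for g c
      using scale[of c "Poly_Mapping.single g 1"] by (simp add: ga_scale_def Poly_Mapping.map_single)
    have "ga_dual_apply f (a * b) = (\<Sum>g\<in>UNIV. \<Sum>h\<in>UNIV. ga_dual_apply f (Poly_Mapping.single (g + h) (Poly_Mapping.lookup a g * Poly_Mapping.lookup b h)))"
      by (subst E[of a], subst E[of b]) (simp only: sum_product mult_single sum)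
    also have "\<dots> = (\<Sum>g\<in>UNIV. \<Sum>h\<in>UNIV. ga_dual_apply f (Poly_Mapping.single (g + h) 1) * (Poly_Mapping.lookup a g * Poly_Mapping.lookup b h))"
      by (intro sum.cong refl) (subst s, simp)
    also have "\<dots> = tensor_eval (\<lambda>f1. ga_dual_apply f1 a) (\<lambda>f2. ga_dual_apply f2 b) ?t"
      unfolding ev[symmetric] by (simp only: tensor_eval_sum tensor_eval_scale)
    finally show ?thesis ..
  qed
  moreover have "?t \<in> tensor_power ga_dual_scale 2 UNIV"
    unfolding tensor_power_def
    by (intro tensor.span_sum tensor.span_scale tensor.span_base) force
  ultimately show "?t \<in> tensor_power ga_dual_scale 2 UNIV \<and>
    (\<forall>a b. tensor_eval (\<lambda>f1. ga_dual_apply f1 a) (\<lambda>f2. ga_dual_apply f2 b) ?t = ga_dual_apply f (a * b))" by blast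
next
  fix t assume t: "t \<in> tensor_power ga_dual_scale 2 UNIV \<and>
    (\<forall>a b. tensor_eval (\<lambda>f1. ga_dual_apply f1 a) (\<lambda>f2. ga_dual_apply f2 b) t = ga_dual_apply f (a * b))"
  then show "t = ?t"
    using ga_dual_tensor_expand[of t] by (simp add: mult_single)
qed

definition ga_dual_counit :: "('g::group_add, 'k::field) ga_dual \<Rightarrow> 'k"
  where "ga_dual_counit f = ga_dual_apply f 1"

lift_definition ga_dual_antipode :: "('g::group_add, 'k::field) ga_dual \<Rightarrow> ('g, 'k) ga_dual"
  is "\<lambda>f x. f (ga_antipode x)"
proof -
  fix f :: "('g \<Rightarrow>\<^sub>0 'k) \<Rightarrow> 'k"
  assume f: "Vector_Spaces.linear ga_scale (*) f"
  interpret Vector_Spaces.linear ga_scale "(*)" f by (fact f)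
  have *: "f (Poly_Mapping.single g c) = c * f (Poly_Mapping.single g 1)" for g c
    using scale[of c "Poly_Mapping.single g 1"]
    by (simp add: ga_scale_def Poly_Mapping.map_single)
  have "f (ga_antipode x) =
      (\<Sum>g\<in>Poly_Mapping.keys x. Poly_Mapping.lookup x g * f (Poly_Mapping.single (- g) 1))" for x
    unfolding ga_antipode_def sum by (intro sum.cong refl *)
  then show "Vector_Spaces.linear ga_scale (*) (\<lambda>x. f (ga_antipode x))"
    by (simp add: ga_linear_sum)
qed

text \<open>
  The Hopf subalgebra \<open>L\<close> of a Hopf algebra is isomorphic to the dual of the group algebra of
  the group \<open>'g\<close>: the inverse of such an isomorphism is an injective homomorphism of Hopf algebras from the
  dual into the whole Hopf algebra, with image \<open>L\<close>.
\<close>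

definition (in hopf_algebra) iso_group_algebra_dual :: "'g::{group_add,finite} itself \<Rightarrow> 'a set \<Rightarrow> bool"
  where "iso_group_algebra_dual _ L \<longleftrightarrow> (\<exists>\<phi> :: ('g, 'k) ga_dual \<Rightarrow> 'a.
    hopf_hom ga_dual_scale ga_dual_comult ga_dual_counit ga_dual_antipode scale \<Delta> \<epsilon> S \<phi> \<and>
    inj \<phi> \<and> range \<phi> = L)"

end

theory Submission
  imports Defs
begin

text \<open>
  As \<open>H\<close> is connected, the bicomodule \<open>H / L\<close> contains a nonzero element coinvariant on both sides; a lift \<open>z\<close>
  of it satisfies \<open>\<Delta> z = z \<otimes> 1 + 1 \<otimes> z + u\<close> with \<open>u \<in> L \<otimes> L\<close>.  Then \<open>L[z]\<close> is a Hopf subalgebra, hence all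
  of \<open>H\<close>.

  Elements of \<open>L = (kG)\<^sup>*\<close> are functions on \<open>G\<close>, so \<open>u\<close> is a function on \<open>G \<times> G\<close>, and the cocycle of \<open>z\<close> to
  the power \<open>p\<^sup>i\<close> is \<open>u\<close> to the power \<open>p\<^sup>i\<close>, pointwise.  If a combination of these powers of \<open>z\<close> with
  coefficients \<open>\<lambda>\<^sub>i\<close>, \<open>i \<ge> r\<close>, lies in \<open>L\<close>, the corresponding combination of cocycles is the coboundary of a function
  on \<open>G\<close>.  Applying to its values a functional of \<open>k\<close> over the subfield of \<open>p\<^sup>r\<close>-th powers that maps \<open>\<lambda>\<^sub>r\<close>
  to 1 gives a coboundary with all exponents lowered by \<open>r\<close>; so the correspondingly lowered combination of
  powers of \<open>z\<close> is primitive modulo \<open>L\<close>, hence in \<open>L\<close>, and it contains \<open>z\<close> itself with coefficient 1.  Applied to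
  a single power this is (3), applied to a linear relation between the powers it is (4).

  By (4) the \<open>p\<close>-th powers span \<open>H\<close>, so the Frobenius map of \<open>H\<close> is injective and \<open>H\<close> is reduced.
\<close>

section \<open>Linear algebra\<close>

abbreviation (in vector_space) functional :: "('b \<Rightarrow> 'a) \<Rightarrow> bool"
  where "functional \<equiv> Vector_Spaces.linear scale (*)"

text \<open>Coefficients are attached to indices, not to vectors, since a sequence may repeat. A
  repetition is itself a relation; otherwise \<open>card T + 1\<close> distinct vectors in the span
  of \<open>T\<close> are dependent.\<close>

lemma (in vector_space) ex_sequence_relation:
  assumes "finite T" "\<And>n. v n \<in> span T"
  obtains c :: "nat \<Rightarrow> 'a" and N i where "i \<le> N" "c i \<noteq> 0" "(\<Sum>i\<le>N. scale (c i) (v i)) = 0"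
proof (cases "inj_on v {..card T}")
  case False
  then obtain m n where mn: "m \<le> card T" "n \<le> card T" "m \<noteq> n" "v m = v n"
    by (auto simp: inj_on_def)
  have "(\<Sum>i\<le>card T. scale ((if i = m then 1 else 0) - (if i = n then 1 else 0)) (v i)) =
      (\<Sum>i\<le>card T. (if i = m then v i else 0) - (if i = n then v i else 0))"
    by (intro sum.cong refl) (simp add: scale_left_diff_distrib)
  also have "\<dots> = 0"
    using mn by (simp add: sum_subtractf)
  finally show thesis
    using mn that[of m "card T" "\<lambda>i. (if i = m then 1 else 0) - (if i = n then 1 else 0)"] by simp
next
  case True
  have "dependent (v ` {..card T})"
    using independent_span_bound[OF assms(1), of "v ` {..card T}"] assms(2) True
    by (auto simp: card_image)
  then obtain u i where "i \<le> card T" "u (v i) \<noteq> 0" "(\<Sum>x\<in>v ` {..card T}. scale (u x) x) = 0"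
    by (subst (asm) dependent_finite) auto
  then show thesis
    using that[of i "card T" "u \<circ> v"] by (simp add: sum.reindex[OF True] o_def)
qed

lemma (in vector_space) ex_functional:
  assumes "subspace D" "x \<notin> D"
  obtains f where "functional f" "\<And>y. y \<in> D \<Longrightarrow> f y = 0" "f x = 1"
proof -
  interpret K: vector_space "(*) :: 'a \<Rightarrow> 'a \<Rightarrow> 'a"
    by (rule vector_space_field)
  interpret P: vector_space_pair scale "(*) :: 'a \<Rightarrow> 'a \<Rightarrow> 'a" ..
  obtain B where B: "B \<subseteq> D" "independent B" "D \<subseteq> span B"
    using maximal_independent_subset by blast
  have x: "x \<notin> span B"
    using B assms span_minimal by blast
  then have "independent (insert x B)"
    using B by (simp add: independent_insert)
  then obtain f where f: "functional f" "\<forall>y\<in>insert x B. f y = (if y = x then 1 else 0)"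
    using P.linear_independent_extend[of "insert x B" "\<lambda>y. if y = x then 1 else 0"] by blast
  have "f y = 0" if "y \<in> D" for y
  proof -
    have "\<forall>y\<in>B. f y = 0"
      using f(2) x span_base by fastforce
    then show ?thesis
      using P.linear_eq_0_on_span[OF f(1), of B] B(3) that by auto
  qed
  with f show thesis
    using that by auto
qed

lemma (in vector_space) functionals_separate:
  assumes "\<And>f. functional f \<Longrightarrow> f x = f y"
  shows "x = y"
proof (rule ccontr)
  assume "x \<noteq> y"
  then obtain f where "functional f" "f (x - y) = 1"
    using ex_functional[of "{0}" "x - y"] by auto
  then show False
    using assms[of f] by (simp add: module_hom.diff linear_iff_module_hom)
qed

text \<open>The field is made a vector space over itself with \<open>c\<close> acting as
  multiplication by \<open>c ^ (p ^ r)\<close>; distributivity in \<open>c\<close> is the freshman's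
  dream. A functional for this action takes \<open>p ^ r\<close>-th powers out as their roots, which
  is how exponents get lowered.\<close>

lemma ex_frobenius_functional:
  fixes a :: "'k::field"
  assumes "prime p" "CHAR('k) = p" "a \<noteq> 0"
  obtains \<rho> :: "'k \<Rightarrow> 'k" where "\<And>x y. \<rho> (x + y) = \<rho> x + \<rho> y" "\<And>c x. \<rho> (c ^ (p ^ r) * x) = c * \<rho> x" "\<rho> a = 1"
proof -
  have "vector_space (\<lambda>c x :: 'k. c ^ (p ^ r) * x)"
    using assms freshmans_dream'[where 'a = 'k, of "p ^ r" r]
    by unfold_locales (auto simp: algebra_simps power_mult_distrib)
  then interpret vector_space "\<lambda>c x :: 'k. c ^ (p ^ r) * x" .
  obtain \<rho> where "Vector_Spaces.linear (\<lambda>c x. c ^ (p ^ r) * x) (*) \<rho>" "\<rho> a = 1"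
    using ex_functional[of "{0}" a] assms by auto
  then show thesis
    using that by (auto simp: Vector_Spaces.linear_iff)
qed

text \<open>
  The argument of the density theorem: \<open>N / L\<close> is a simple module over the algebra \<open>A\<close> of operators, and the
  ideal \<open>Q\<close> does not annihilate it.
\<close>

lemma (in vector_space) ideal_acts_as_identity:
  assumes L: "subspace L" and N: "subspace N" and LN: "L \<subseteq> N"
    and lin: "\<And>a. a \<in> A \<Longrightarrow> Vector_Spaces.linear scale scale a" and QA: "Q \<subseteq> A"
    and AL: "\<And>a x. a \<in> A \<Longrightarrow> x \<in> L \<Longrightarrow> a x \<in> L" and AN: "\<And>a x. a \<in> A \<Longrightarrow> x \<in> N \<Longrightarrow> a x \<in> N"
    and simple: "\<And>W. subspace W \<Longrightarrow> L \<subseteq> W \<Longrightarrow> W \<subseteq> N \<Longrightarrow> (\<And>a x. a \<in> A \<Longrightarrow> x \<in> W \<Longrightarrow> a x \<in> W) \<Longrightarrow> W = L \<or> W = N"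
    and Q0: "(\<lambda>x. 0) \<in> Q" and Qadd: "\<And>q q'. q \<in> Q \<Longrightarrow> q' \<in> Q \<Longrightarrow> (\<lambda>x. q x + q' x) \<in> Q"
    and Qscale: "\<And>q c. q \<in> Q \<Longrightarrow> (\<lambda>x. scale c (q x)) \<in> Q"
    and Qleft: "\<And>a q. a \<in> A \<Longrightarrow> q \<in> Q \<Longrightarrow> (\<lambda>x. a (q x)) \<in> Q"
    and Qright: "\<And>a q. a \<in> A \<Longrightarrow> q \<in> Q \<Longrightarrow> (\<lambda>x. q (a x)) \<in> Q"
    and nz: "q0 \<in> Q" "x0 \<in> N" "q0 x0 \<notin> L"
    and X: "finite X" "X \<subseteq> N"
  shows "\<exists>q\<in>Q. \<forall>x\<in>X. q x - x \<in> L"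
  using X
proof (induction X rule: finite_induct)
  case empty
  then show ?case using Q0 by blast
next
  case (insert m X)
  then obtain q where q: "q \<in> Q" "\<forall>x\<in>X. q x - x \<in> L" by auto
  have add: "a (x + y) = a x + a y" and scl: "a (scale c x) = scale c (a x)"
    and sub: "a (x - y) = a x - a y" if "a \<in> A" for a x y c
    using lin[OF that] by (simp_all add: linear_iff_module_hom module_hom.add module_hom.scale module_hom.diff)
  define v where "v = q m - m"
  define Q' where "Q' = {q \<in> Q. \<forall>x\<in>X. q x \<in> L}"
  \<comment> \<open>Modulo \<open>L\<close> this is the orbit of \<open>m\<close> under those
    elements of \<open>Q\<close> that already annihilate \<open>X\<close>. It is a submodule of
    \<open>N / L\<close>, hence zero or everything.\<close>
  define W where "W = {q m + l | q l. q \<in> Q' \<and> l \<in> L}"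
  have mN: "m \<in> N" using insert.prems by simp
  have Q'Q: "Q' \<subseteq> Q" by (auto simp: Q'_def)
  have v: "v \<in> N"
    using q QA mN AN N by (auto simp: v_def intro!: subspace_diff)
  have WI: "q m + l \<in> W" if "q \<in> Q'" "l \<in> L" for q l
    using that by (auto simp: W_def)
  have "subspace W"
  proof (rule subspaceI)
    show "0 \<in> W"
      using Q0 L subspace_0[OF L] by (auto simp: W_def Q'_def intro!: exI[of _ "\<lambda>x. 0"])
    fix x y c assume "x \<in> W" "y \<in> W"
    then obtain q l q' l' where *: "x = q m + l" "y = q' m + l'" "q \<in> Q'" "q' \<in> Q'" "l \<in> L" "l' \<in> L"
      by (auto simp: W_def)
    have "(\<lambda>x. q x + q' x) \<in> Q'" "(\<lambda>x. scale c (q x)) \<in> Q'"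
      using * Qadd Qscale L by (auto simp: Q'_def intro: subspace_add subspace_scale)
    moreover have "(q m + q' m) + (l + l') = x + y" "scale c (q m) + scale c l = scale c x"
      using * by (simp_all add: scale_right_distrib)
    moreover have "l + l' \<in> L" "scale c l \<in> L"
      using * L by (auto intro: subspace_add subspace_scale)
    ultimately show "x + y \<in> W" "scale c x \<in> W"
      using WI[of "\<lambda>x. q x + q' x" "l + l'"] WI[of "\<lambda>x. scale c (q x)" "scale c l"] by simp_all
  qed
  moreover have "L \<subseteq> W"
  proof
    fix l assume "l \<in> L"
    then show "l \<in> W"
      using Q0 subspace_0[OF L] by (auto simp: W_def Q'_def intro!: exI[of _ "\<lambda>x. 0"])
  qed
  moreover have "W \<subseteq> N"
    using Q'Q QA mN AN N LN by (fastforce simp: W_def intro: subspace_add)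
  moreover have "a x \<in> W" if a: "a \<in> A" and "x \<in> W" for a x
  proof -
    obtain q l where *: "x = q m + l" "q \<in> Q'" "l \<in> L"
      using \<open>x \<in> W\<close> by (auto simp: W_def)
    then have "(\<lambda>x. a (q x)) \<in> Q'"
      using Qleft a AL by (auto simp: Q'_def)
    moreover have "a x = a (q m) + a l" "a l \<in> L"
      using * a AL by (auto simp: add)
    ultimately show ?thesis
      using WI[of "\<lambda>x. a (q x)" "a l"] by simp
  qed
  ultimately consider "W = L" | "W = N" using simple by blast
  then show ?case
  proof cases
    case 1
    \<comment> \<open>If the orbit is zero: for \<open>q'\<close> in \<open>Q\<close> the operator
      \<open>q' q - q'\<close> kills \<open>X\<close> modulo \<open>L\<close>, so it also kills
      \<open>m\<close>. Hence all of \<open>Q\<close> sends the defect \<open>v\<close> into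
      \<open>L\<close>.\<close>
    have 2: "q' v \<in> L" if q': "q' \<in> Q" for q'
    proof -
      have "(\<lambda>x. q' (q x) + scale (- 1) (q' x)) \<in> Q"
        using Qleft[of q' q] q' q QA Qadd Qscale by blast
      then have "(\<lambda>x. q' (q x) - q' x) \<in> Q"
        by simp
      moreover have "q' (q x) - q' x \<in> L" if "x \<in> X" for x
        using sub[of q' "q x" x] AL[of q' "q x - x"] q q' QA that by (metis subsetD)
      ultimately have "(\<lambda>x. q' (q x) - q' x) \<in> Q'"
        by (auto simp: Q'_def)
      from WI[OF this subspace_0[OF L]] have "(q' (q m) - q' m) + 0 \<in> W" .
      then show ?thesis
        using 1 sub[of q' "q m" m] q' QA by (auto simp: v_def)
    qed
    \<comment> \<open>The elements killed by \<open>Q\<close> modulo \<open>L\<close> form a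
      submodule. It is not \<open>N\<close>, because of \<open>q0\<close> and \<open>x0\<close>, so
      it is \<open>L\<close>, and it contains the defect \<open>v\<close>.\<close>
    define U where "U = {x \<in> N. \<forall>q\<in>Q. q x \<in> L}"
    have "subspace U"
    proof (rule subspaceI)
      have "q 0 \<in> L" if "q \<in> Q" for q
        using scl[of q 0 0] QA that subspace_0[OF L] by auto
      then show "0 \<in> U" using N by (auto simp: U_def subspace_0)
      show "x + y \<in> U" if "x \<in> U" "y \<in> U" for x y
      proof -
        have "q (x + y) \<in> L" if "q \<in> Q" for q
          using add[of q x y] QA that subspace_add[OF L] \<open>x \<in> U\<close> \<open>y \<in> U\<close> by (auto simp: U_def)
        then show ?thesis
          using that subspace_add[OF N] by (auto simp: U_def)
      qed
      show "scale c x \<in> U" if "x \<in> U" for x c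
      proof -
        have "q (scale c x) \<in> L" if "q \<in> Q" for q
          using scl[of q c x] QA that subspace_scale[OF L] \<open>x \<in> U\<close> by (auto simp: U_def)
        then show ?thesis
          using that subspace_scale[OF N] by (auto simp: U_def)
      qed
    qed
    moreover have "L \<subseteq> U" "U \<subseteq> N"
      using LN QA AL by (auto simp: U_def)
    moreover have "a x \<in> U" if "a \<in> A" "x \<in> U" for a x
      using that AN Qright by (auto simp: U_def)
    ultimately have "U = L \<or> U = N" by (rule simple)
    moreover have "U \<noteq> N" using nz by (auto simp: U_def)
    moreover have "v \<in> U" using v 2 by (simp add: U_def)
    ultimately have "v \<in> L" by simp
    then show ?thesis using q by (auto simp: v_def)
  next
    case 2
    \<comment> \<open>If the orbit is everything, some \<open>q'\<close> killing \<open>X\<close>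
      modulo \<open>L\<close> sends \<open>m\<close> to \<open>- v\<close> modulo \<open>L\<close>.
      Adding it to \<open>q\<close> repairs the value at \<open>m\<close> and changes nothing on
      \<open>X\<close> modulo \<open>L\<close>.\<close>
    have "- v \<in> W" using v N subspace_neg 2 by blast
    then obtain q' l where *: "- v = q' m + l" "q' \<in> Q'" "l \<in> L"
      by (auto simp: W_def)
    have "(\<lambda>x. q x + q' x) \<in> Q"
      using q * Q'Q Qadd by blast
    moreover have "q m + q' m - m \<in> L"
    proof -
      have "q m + q' m - m = v + q' m" by (simp add: v_def)
      also have "\<dots> = - l" using *(1) by (simp add: minus_equation_iff[of v] algebra_simps)
      finally show ?thesis using *(3) L subspace_neg by simp
    qed
    moreover have "q x + q' x - x \<in> L" if "x \<in> X" for x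
    proof -
      have "(q x - x) + q' x \<in> L"
        using that q(2) * L by (auto simp: Q'_def intro: subspace_add)
      then show ?thesis by (simp add: algebra_simps)
    qed
    ultimately show ?thesis by auto
  qed
qed

section \<open>The actions of the dual algebra\<close>

text \<open>
  The actions \<open>R f x = x\<^sub>1 f(x\<^sub>2)\<close> and \<open>L f x = f(x\<^sub>1) x\<^sub>2\<close> of functionals on a finite-dimensional
  coalgebra whose nonzero subcoalgebras all contain \<open>e\<close>.  The axioms are symmetric in
  \<open>R\<close> and \<open>L\<close>, so that every result holds for both actions.
\<close>

locale dual_actions = finite_dimensional_vector_space scale Basis
  for scale :: "'k::field \<Rightarrow> 'a::ab_group_add \<Rightarrow> 'a" and Basis +
  fixes \<epsilon> :: "'a \<Rightarrow> 'k" and R L :: "('a \<Rightarrow> 'k) \<Rightarrow> 'a \<Rightarrow> 'a" and e :: 'a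
  assumes counit: "functional \<epsilon>"
    and R_linear: "functional f \<Longrightarrow> Vector_Spaces.linear scale scale (R f)"
    and L_linear: "functional f \<Longrightarrow> Vector_Spaces.linear scale scale (L f)"
    and R_counit: "R \<epsilon> x = x" and L_counit: "L \<epsilon> x = x"
    and adjoint: "functional f \<Longrightarrow> functional g \<Longrightarrow> g (R f x) = f (L g x)"
    and R_R: "functional f \<Longrightarrow> functional g \<Longrightarrow> R g (R f x) = R (\<lambda>y. g (R f y)) x"
    and L_L: "functional f \<Longrightarrow> functional g \<Longrightarrow> L g (L f x) = L (\<lambda>y. g (L f y)) x"
    and R_L: "functional f \<Longrightarrow> functional g \<Longrightarrow> R f (L g x) = L g (R f x)"
    and R_e: "functional f \<Longrightarrow> R f e = scale (f e) e"
    and counit_e: "\<epsilon> e = 1"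
    and connected: "subspace C \<Longrightarrow> C \<noteq> {0} \<Longrightarrow>
      (\<And>f x. functional f \<Longrightarrow> x \<in> C \<Longrightarrow> R f x \<in> C) \<Longrightarrow>
      (\<And>f x. functional f \<Longrightarrow> x \<in> C \<Longrightarrow> L f x \<in> C) \<Longrightarrow> e \<in> C"
begin

lemma functional_comp_R: "functional f \<Longrightarrow> functional g \<Longrightarrow> functional (\<lambda>x. g (R f x))"
  using Vector_Spaces.linear_compose[OF R_linear, of f "(*)" g] by (simp add: o_def)

lemma R_add:
  assumes "functional f" "functional g"
  shows "R (\<lambda>y. f y + g y) x = R f x + R g x"
proof (rule functionals_separate)
  fix h assume h: "functional h"
  have "functional (\<lambda>y. f y + g y)"
    using assms by (auto simp: Vector_Spaces.linear_iff algebra_simps)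
  then show "h (R (\<lambda>y. f y + g y) x) = h (R f x + R g x)"
    using adjoint[OF _ h] assms h by (simp add: module_hom.add linear_iff_module_hom)
qed

lemma R_scale:
  assumes "functional f"
  shows "R (\<lambda>y. c * f y) x = scale c (R f x)"
proof (rule functionals_separate)
  fix h assume h: "functional h"
  have "functional (\<lambda>y. c * f y)"
    using assms by (auto simp: Vector_Spaces.linear_iff algebra_simps)
  then show "h (R (\<lambda>y. c * f y) x) = h (scale c (R f x))"
    using adjoint[OF _ h] assms h by (simp add: module_hom.scale linear_iff_module_hom)
qed

text \<open>The functionals carrying \<open>N\<close> into \<open>U\<close> form a two-sided ideal
  \<open>P\<close> of the dual algebra, so their common zero set \<open>C\<close> is stable under
  both actions. It is nonzero because \<open>N\<close> is larger than \<open>U\<close>, and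
  connectedness puts \<open>e\<close> into it.\<close>

lemma annihilator_contains_e:
  assumes U: "subspace U" and N: "subspace N" "U \<subset> N"
    and RU: "\<And>f x. functional f \<Longrightarrow> x \<in> U \<Longrightarrow> R f x \<in> U"
    and RN: "\<And>f x. functional f \<Longrightarrow> x \<in> N \<Longrightarrow> R f x \<in> N"
    and g: "functional g" "\<And>x. x \<in> N \<Longrightarrow> R g x \<in> U"
  shows "g e = 0"
proof -
  define P where "P = {g. functional g \<and> (\<forall>x\<in>N. R g x \<in> U)}"
  define C where "C = {x. \<forall>g\<in>P. g x = 0}"
  have P: "functional g" if "g \<in> P" for g using that by (simp add: P_def)
  have Pl: "g 0 = 0" "g (x + y) = g x + g y" "g (scale c x) = c * g x" if "g \<in> P" for g x y c
    using P[OF that] by (auto simp: linear_iff_module_hom module_hom.add module_hom.scale intro: module_hom.zero)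
  have "subspace C"
    by (auto simp: C_def subspace_def Pl)
  moreover have "C \<noteq> {0}"
  proof -
    obtain n where n: "n \<in> N" "n \<notin> U" using N(2) by blast
    obtain h where h: "functional h" "\<And>y. y \<in> U \<Longrightarrow> h y = 0" "h n = 1"
      using ex_functional[OF U n(2)] by blast
    \<comment> \<open>A matrix coefficient of \<open>n\<close>: by adjointness \<open>P\<close>
      vanishes on it, since \<open>h\<close> is zero on \<open>U\<close>, while the counit takes it
      to \<open>h n = 1\<close>.\<close>
    have "L h n \<in> C"
      using adjoint[OF P h(1), of _ n, symmetric] n h(2) by (auto simp: C_def P_def)
    moreover have "\<epsilon> (L h n) = 1"
      using adjoint[OF counit h(1), of n] h(3) by (simp add: R_counit)
    ultimately show ?thesis
      using counit module_hom.zero[of scale "(*)" \<epsilon>] by (auto simp: linear_iff_module_hom)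
  qed
  moreover have "R f x \<in> C" if f: "functional f" and x: "x \<in> C" for f x
  proof -
    have "g (R f x) = 0" if g: "g \<in> P" for g
    proof -
      have "(\<lambda>y. g (R f y)) \<in> P"
        using functional_comp_R[OF f P[OF g]] R_R[OF f P[OF g], symmetric] RN[OF f] g by (auto simp: P_def)
      then show ?thesis using x by (auto simp: C_def)
    qed
    then show ?thesis by (simp add: C_def)
  qed
  moreover have "L f x \<in> C" if f: "functional f" and x: "x \<in> C" for f x
  proof -
    have "g (L f x) = 0" if g: "g \<in> P" for g
    proof -
      have "(\<lambda>y. f (R g y)) \<in> P"
        using functional_comp_R[OF P[OF g] f] R_R[OF P[OF g] f, symmetric] RU[OF f] g by (auto simp: P_def)
      then show ?thesis using x adjoint[OF P[OF g] f] by (auto simp: C_def)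
    qed
    then show ?thesis by (simp add: C_def)
  qed
  ultimately have "e \<in> C" by (rule connected)
  then show ?thesis using g by (auto simp: C_def P_def)
qed

text \<open>Least dimension among the submodules strictly above \<open>U\<close> makes
  \<open>N / U\<close> simple. If a functional vanishing at \<open>e\<close> acted nontrivially on
  it, another one would act as the identity; subtracted from the counit it gives an annihilator of
  \<open>N / U\<close> with value 1 at \<open>e\<close>, against
  \<open>annihilator_contains_e\<close>.\<close>

lemma ex_coinvariant:
  assumes U: "subspace U" and Y: "subspace Y" "U \<subset> Y"
    and RU: "\<And>f x. functional f \<Longrightarrow> x \<in> U \<Longrightarrow> R f x \<in> U"
    and RY: "\<And>f x. functional f \<Longrightarrow> x \<in> Y \<Longrightarrow> R f x \<in> Y"
  shows "\<exists>x\<in>Y - U. \<forall>f. functional f \<and> f e = 0 \<longrightarrow> R f x \<in> U"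
proof -
  define good where "good N \<longleftrightarrow> subspace N \<and> U \<subset> N \<and> N \<subseteq> Y \<and> (\<forall>f x. functional f \<longrightarrow> x \<in> N \<longrightarrow> R f x \<in> N)" for N
  have "good Y" using Y RY by (auto simp: good_def)
  then obtain N where N: "good N" and min: "\<And>W. good W \<Longrightarrow> dim N \<le> dim W"
    using ex_has_least_nat[of good Y dim] by blast
  have N': "subspace N" "U \<subset> N" "N \<subseteq> Y" "\<And>f x. functional f \<Longrightarrow> x \<in> N \<Longrightarrow> R f x \<in> N"
    using N by (auto simp: good_def)
  define A where "A = {R f | f. functional f}"
  define Q where "Q = {R f | f. functional f \<and> f e = 0}"
  have "q x \<in> U" if q: "q \<in> Q" and x: "x \<in> N" for q x
  proof (rule ccontr)
    assume nz: "q x \<notin> U"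
    obtain X where X: "X \<subseteq> N" "independent X" "N \<subseteq> span X"
      using maximal_independent_subset by blast
    have "\<exists>q\<in>Q. \<forall>x\<in>X. q x - x \<in> U"
    proof (rule ideal_acts_as_identity[OF U N'(1), of A Q q x])
      show "U \<subseteq> N" using N' by blast
      show "\<And>a. a \<in> A \<Longrightarrow> Vector_Spaces.linear scale scale a" using R_linear by (auto simp: A_def)
      show "Q \<subseteq> A" by (auto simp: A_def Q_def)
      show "\<And>a x. a \<in> A \<Longrightarrow> x \<in> U \<Longrightarrow> a x \<in> U" "\<And>a x. a \<in> A \<Longrightarrow> x \<in> N \<Longrightarrow> a x \<in> N"
        using RU N' by (auto simp: A_def)
      show "W = U \<or> W = N" if "subspace W" "U \<subseteq> W" "W \<subseteq> N" "\<And>a x. a \<in> A \<Longrightarrow> x \<in> W \<Longrightarrow> a x \<in> W" for W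
      proof (cases "W = U")
        case False
        moreover have "R f x \<in> W" if "functional f" "x \<in> W" for f x
          using \<open>\<And>a x. a \<in> A \<Longrightarrow> x \<in> W \<Longrightarrow> a x \<in> W\<close>[of "R f" x] that by (auto simp: A_def)
        ultimately have "good W" using that(1-3) N' by (auto simp: good_def)
        then show ?thesis using min subspace_dim_equal that(1,3) N'(1) by blast
      qed simp
      have f0: "functional (\<lambda>x. 0)"
        by (rule linear_zero_fun) unfold_locales
      show "(\<lambda>x. 0) \<in> Q"
      proof -
        have "R (\<lambda>x. 0) = (\<lambda>x. 0)"
          using R_scale[OF f0, of 0] by (simp add: fun_eq_iff)
        then show ?thesis using f0 unfolding Q_def by (metis (mono_tags, lifting) mem_Collect_eq)
      qed
      show "(\<lambda>x. q x + q' x) \<in> Q" if q: "q \<in> Q" "q' \<in> Q" for q q'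
      proof -
        from q obtain f f' where f: "q = R f" "q' = R f'" "functional f" "functional f'" "f e = 0" "f' e = 0"
          by (auto simp: Q_def)
        moreover have "functional (\<lambda>x. f x + f' x)"
          using f by (auto simp: Vector_Spaces.linear_iff algebra_simps)
        moreover have "(\<lambda>x. q x + q' x) = R (\<lambda>x. f x + f' x)"
          using f by (simp add: R_add fun_eq_iff)
        ultimately show ?thesis unfolding Q_def by fastforce
      qed
      show "(\<lambda>x. scale c (q x)) \<in> Q" if q: "q \<in> Q" for q c
      proof -
        from q obtain f where f: "q = R f" "functional f" "f e = 0"
          by (auto simp: Q_def)
        moreover have "functional (\<lambda>x. c * f x)"
          using f by (auto simp: Vector_Spaces.linear_iff algebra_simps)
        moreover have "(\<lambda>x. scale c (q x)) = R (\<lambda>x. c * f x)"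
          using f by (simp add: R_scale fun_eq_iff)
        ultimately show ?thesis unfolding Q_def by fastforce
      qed
      show "(\<lambda>x. a (q x)) \<in> Q" "(\<lambda>x. q (a x)) \<in> Q" if q: "a \<in> A" "q \<in> Q" for a q
      proof -
        from q obtain g f where f: "q = R f" "functional f" "f e = 0" "a = R g" "functional g"
          by (auto simp: Q_def A_def)
        have sc: "h (scale c y) = c * h y" "h 0 = 0" if "functional h" for h c y
          using that module_hom.zero[of scale "(*)" h]
          by (simp_all add: module_hom.scale linear_iff_module_hom)
        have "(\<lambda>x. a (q x)) = R (\<lambda>x. g (R f x))" "(\<lambda>x. q (a x)) = R (\<lambda>x. f (R g x))"
          using f R_R by (simp_all add: fun_eq_iff)
        \<comment> \<open>\<open>e\<close> is an eigenvector of each \<open>R f\<close> with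
          eigenvalue \<open>f e\<close>, so evaluation at \<open>e\<close> is multiplicative and
          \<open>Q\<close> is an ideal.\<close>
        moreover have "g (R f e) = 0" "f (R g e) = 0"
          using sc[OF f(2)] sc[OF f(5)] R_e[OF f(2)] R_e[OF f(5)] f(3) by simp_all
        ultimately show "(\<lambda>x. a (q x)) \<in> Q" "(\<lambda>x. q (a x)) \<in> Q"
          using f functional_comp_R unfolding Q_def by blast+
      qed
      show "q \<in> Q" "x \<in> N" "q x \<notin> U" by fact+
      show "finite X" "X \<subseteq> N" using X finiteI_independent by auto
    qed
    then obtain f where f: "functional f" "f e = 0" "\<And>x. x \<in> X \<Longrightarrow> R f x - x \<in> U"
      by (auto simp: Q_def)
    define g where "g y = \<epsilon> y + - 1 * f y" for y
    have g: "functional g"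
      using f counit by (auto simp: Vector_Spaces.linear_iff g_def algebra_simps)
    have neg: "functional (\<lambda>y. - 1 * f y)"
      using f by (auto simp: Vector_Spaces.linear_iff)
    have Rg: "R g x = x - R f x" for x
      using R_add[OF counit neg, of x] R_scale[OF f(1), of "- 1" x]
      by (simp add: g_def[abs_def] R_counit)
    have "subspace {x. R g x \<in> U}"
      using module_hom.subspace_linear_preimage[of scale scale "R g" U] R_linear[OF g] U
      by (simp add: linear_iff_module_hom)
    moreover have "X \<subseteq> {x. R g x \<in> U}"
      using f(3) U subspace_neg[of U] by (force simp: Rg)
    ultimately have "N \<subseteq> {x. R g x \<in> U}"
      using X(3) span_minimal by blast
    then have "g e = 0"
      using annihilator_contains_e[OF U N'(1,2) RU N'(4) g] by blast
    then show False
      using f(2) counit_e by (simp add: g_def)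
  qed
  then have "R f x \<in> U" if "functional f" "f e = 0" "x \<in> N" for f x
    using that by (auto simp: Q_def)
  then show ?thesis
    using N'(2,3) by blast
qed

end

section \<open>Tensors of degree two\<close>

text \<open>
  Tensors are functions; unfolding sums of tensors pointwise would destroy every equation between them.
\<close>

declare zero_fun_apply [simp del] plus_fun_apply [simp del]

lemma linearD:
  assumes "Vector_Spaces.linear s s' f"
  shows "f (x + y) = f x + f y" "f (s c x) = s' c (f x)" "f 0 = 0" "f (x - y) = f x - f y"
    "f (sum g A) = (\<Sum>a\<in>A. f (g a))"
proof -
  interpret Vector_Spaces.linear s s' f by fact
  show "f (x + y) = f x + f y" "f (s c x) = s' c (f x)" "f 0 = 0" "f (x - y) = f x - f y"
    "f (sum g A) = (\<Sum>a\<in>A. f (g a))"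
    by (simp_all add: add scale zero diff sum)
qed

context vector_space
begin

lemma pure_tensor_linear: "Vector_Spaces.linear scale tensor_scale (\<lambda>a. pure_tensor scale (us @ a # vs))"
  by (intro multilinearD multilinear_pure_tensor) unfold_locales

lemma pure_tensor_pair:
  "pure_tensor scale [a + a', b] = pure_tensor scale [a, b] + pure_tensor scale [a', b]"
  "pure_tensor scale [a, b + b'] = pure_tensor scale [a, b] + pure_tensor scale [a, b']"
  "pure_tensor scale [scale c a, b] = tensor_scale c (pure_tensor scale [a, b])"
  "pure_tensor scale [a, scale c b] = tensor_scale c (pure_tensor scale [a, b])"
  using pure_tensor_linear[of "[]" "[b]"] pure_tensor_linear[of "[a]" "[]"]
  by (auto simp: Vector_Spaces.linear_iff)

lemma pure_tensor_pair_sum: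
  "pure_tensor scale [\<Sum>i\<in>I. x i, b] = (\<Sum>i\<in>I. pure_tensor scale [x i, b])"
  "pure_tensor scale [a, \<Sum>i\<in>I. x i] = (\<Sum>i\<in>I. pure_tensor scale [a, x i])"
  using linearD(5)[OF pure_tensor_linear[of "[]" "[b]"]] linearD(5)[OF pure_tensor_linear[of "[a]" "[]"]]
  by simp_all

lemma pure_tensor_single:
  "pure_tensor scale [a + a'] = pure_tensor scale [a] + pure_tensor scale [a']"
  "pure_tensor scale [scale c a] = tensor_scale c (pure_tensor scale [a])"
  "pure_tensor scale [0] = 0"
  using linearD[OF pure_tensor_linear[of "[]" "[]"]] by simp_all

text \<open>Needed because the Hopf algebra axioms on contractions are equations between degree-one
  tensors. The separating forms are functionals extended by zero to lists of other lengths.\<close>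

lemma pure_tensor_single_inject:
  assumes "pure_tensor scale [a] = pure_tensor scale [b]"
  shows "a = b"
proof (rule functionals_separate)
  fix f assume f: "functional f"
  let ?B = "\<lambda>xs. case xs of [x] \<Rightarrow> f x | _ \<Rightarrow> 0"
  have "multilinear scale (*) ?B"
    unfolding multilinear_def
  proof (intro allI)
    fix us vs :: "'b list"
    show "functional (\<lambda>a. ?B (us @ a # vs))"
    proof (cases "us = [] \<and> vs = []")
      case False
      then have "(\<lambda>a. ?B (us @ a # vs)) = (\<lambda>_. 0)"
        by (auto split: list.split simp: fun_eq_iff append_eq_Cons_conv)
      then show ?thesis using linear_zero_fun vector_space_axioms by metis
    qed (use f in simp)
  qed
  then show "f a = f b"
    using fun_cong[OF assms, of ?B] by (simp add: pure_tensor_def)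
qed

lemma tensor_power_pure: "length xs = n \<Longrightarrow> set xs \<subseteq> V \<Longrightarrow> pure_tensor scale xs \<in> tensor_power scale n V"
  by (auto simp: tensor_power_def intro!: tensor.span_base)

lemma tensor_power_subspace: "tensor.subspace (tensor_power scale n V)"
  by (simp add: tensor_power_def)

lemmas tensor_power_add = tensor.subspace_add[OF tensor_power_subspace]
  and tensor_power_diff = tensor.subspace_diff[OF tensor_power_subspace]
  and tensor_power_scale = tensor.subspace_scale[OF tensor_power_subspace]
  and tensor_power_0 = tensor.subspace_0[OF tensor_power_subspace]
  and tensor_power_sum = tensor.subspace_sum[OF tensor_power_subspace]

lemma tensor_power_mono: "V \<subseteq> W \<Longrightarrow> tensor_power scale n V \<subseteq> tensor_power scale n W"
  unfolding tensor_power_def by (intro tensor.span_mono) blast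

lemma tensor_power_UNIV: "t \<in> tensor_power scale n V \<Longrightarrow> t \<in> tensor_power scale n UNIV"
  using tensor_power_mono by blast

text \<open>Scalars are absorbed into the first factor, which stays in the subspace
  \<open>V\<close>, so the induction runs over sums of pure tensors without coefficients.\<close>

lemma tensor_power_2_induct [consumes 2, case_names zero add]:
  assumes "t \<in> tensor_power scale 2 V" "subspace V"
    and "P 0" and "\<And>a b t. a \<in> V \<Longrightarrow> b \<in> V \<Longrightarrow> t \<in> tensor_power scale 2 V \<Longrightarrow> P t \<Longrightarrow> P (pure_tensor scale [a, b] + t)"
  shows "P t"
proof -
  have "t \<in> tensor_power scale 2 V \<and> P t"
    using assms(1) unfolding tensor_power_def
  proof (induction rule: tensor.span_induct_alt)
    case base
    then show ?case using assms(3) by (auto intro: tensor.span_zero)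
  next
    case (step c x y)
    then obtain a b where ab: "x = pure_tensor scale [a, b]" "a \<in> V" "b \<in> V"
      by (auto simp: numeral_2_eq_2 length_Suc_conv)
    then have "tensor_scale c x = pure_tensor scale [scale c a, b]" "scale c a \<in> V"
      using assms(2) by (auto simp: pure_tensor_pair intro: subspace_scale)
    then show ?case
      using assms(4)[of "scale c a" b y] step ab tensor_power_pure[of "[scale c a, b]" 2 V]
      by (auto simp: tensor_power_def intro: tensor.span_add)
  qed
  then show ?thesis ..
qed

text \<open>An element of the tensor type need not be linear in the form; only for genuine tensors
  \<open>t\<close> is the inner lift in \<open>tensor_append\<close> multilinear. Appending the
  empty pure tensor makes \<open>tensor_append_three\<close> applicable.\<close>

lemma tensor_append_pure_left:
  assumes "t \<in> tensor_power scale n UNIV"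
  shows "tensor_append scale (pure_tensor scale xs) t = tensor_lift (\<lambda>ys. pure_tensor scale (xs @ ys)) t"
proof -
  have vs: "vector_space scale" ..
  have "tensor_append scale t (pure_tensor scale []) = t"
    using assms unfolding tensor_power_def
  proof (induction rule: tensor.span_induct_alt)
    case base
    show ?case by (simp add: tensor_append_def tensor_lift_def fun_eq_iff zero_fun_apply)
  next
    case (step c x y)
    then show ?case
      by (auto simp: tensor_append_pure_right[OF vs] tensor_lift_add tensor_lift_scale
          tensor_append_pure[OF vs, of _ "[]", unfolded tensor_append_pure_right[OF vs], simplified])
  qed
  then show ?thesis
    using tensor_append_three[OF vs assms, of xs "[]"] by (simp add: tensor_lift_def)
qed

end

lemma tensor_lift_zero: "tensor_lift F 0 = 0"
  by (simp add: tensor_lift_def fun_eq_iff zero_fun_apply)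

lemma tensor_apply_at_zero: "tensor_apply_at scale \<delta> i 0 = 0"
  and tensor_apply_at_add: "tensor_apply_at scale \<delta> i (s + t) = tensor_apply_at scale \<delta> i s + tensor_apply_at scale \<delta> i t"
  by (simp_all add: tensor_apply_at_def tensor_lift_zero tensor_lift_add)

section \<open>Coordinates, contractions and slices of 2-tensors\<close>

context finite_dimensional_vector_space
begin

definition coord :: "'b \<Rightarrow> 'b \<Rightarrow> 'a"
  where "coord i x = representation Basis x i"

lemma coord_functional: "functional (coord i)"
  unfolding coord_def[abs_def] by (rule linear_representation[OF independent_Basis span_Basis])

lemma coord_sum: "(\<Sum>i\<in>Basis. scale (coord i x) i) = x"
  unfolding coord_def using independent_Basis by (rule sum_representation_eq) (auto simp: span_Basis finite_Basis)

lemma functional_coord: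
  assumes "functional f"
  shows "f x = (\<Sum>i\<in>Basis. coord i x * f i)"
proof -
  interpret Vector_Spaces.linear scale "(*)" f by fact
  show ?thesis by (subst coord_sum[symmetric]) (simp only: sum scale)
qed

definition bilinear :: "('b \<Rightarrow> 'b \<Rightarrow> 'b) \<Rightarrow> bool"
  where "bilinear \<beta> \<longleftrightarrow> (\<forall>x. Vector_Spaces.linear scale scale (\<beta> x)) \<and> (\<forall>y. Vector_Spaces.linear scale scale (\<lambda>x. \<beta> x y))"

text \<open>The contraction with values in the space itself instead of in degree-one tensors. The
  form in coordinates makes it linear on the whole tensor type and for every
  \<open>\<beta>\<close>.\<close>

definition contract :: "('b \<Rightarrow> 'b \<Rightarrow> 'b) \<Rightarrow> ('a, 'b) tensor \<Rightarrow> 'b"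
  where "contract \<beta> t = (\<Sum>i\<in>Basis. \<Sum>j\<in>Basis. scale (tensor_eval (coord i) (coord j) t) (\<beta> i j))"

lemma contract_add: "contract \<beta> (s + t) = contract \<beta> s + contract \<beta> t"
  by (simp add: contract_def tensor_eval_add scale_left_distrib sum.distrib)

lemma contract_scale: "contract \<beta> (tensor_scale c t) = scale c (contract \<beta> t)"
  by (simp add: contract_def tensor_eval_scale scale_sum_right)

lemma contract_diff: "contract \<beta> (s - t) = contract \<beta> s - contract \<beta> t"
  using contract_add[of \<beta> "s - t" t] by (simp add: algebra_simps)

lemma contract_zero: "contract \<beta> 0 = 0"
  by (simp add: contract_def tensor_eval_zero)

lemma contract_pure:
  assumes "bilinear \<beta>"
  shows "contract \<beta> (pure_tensor scale [a, b]) = \<beta> a b"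
proof -
  interpret l: Vector_Spaces.linear scale scale "\<beta> x" for x
    using assms by (simp add: bilinear_def)
  interpret r: Vector_Spaces.linear scale scale "\<lambda>x. \<beta> x y" for y
    using assms by (simp add: bilinear_def)
  have "\<beta> a b = \<beta> (\<Sum>i\<in>Basis. scale (coord i a) i) (\<Sum>j\<in>Basis. scale (coord j b) j)"
    by (simp add: coord_sum)
  also have "\<dots> = (\<Sum>i\<in>Basis. \<Sum>j\<in>Basis. scale (coord i a * coord j b) (\<beta> i j))"
    by (subst r.sum) (simp add: l.sum l.scale r.scale scale_sum_right mult.commute)
  finally show ?thesis
    by (simp add: contract_def tensor_eval_pure[OF coord_functional coord_functional])
qed

lemma tensor_contract_eq:
  assumes t: "t \<in> tensor_power scale 2 UNIV" and \<beta>: "bilinear \<beta>"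
  shows "tensor_contract scale \<beta> t = pure_tensor scale [contract \<beta> t]"
  using t subspace_UNIV
proof (induction rule: tensor_power_2_induct)
  case zero
  show ?case by (simp add: tensor_contract_def tensor_lift_zero contract_zero pure_tensor_single)
next
  case (add a b t)
  have "tensor_contract scale \<beta> (pure_tensor scale [a, b]) = pure_tensor scale [\<beta> a b]"
    using \<beta> by (intro tensor_contract_pure) (auto simp: bilinear_def)
  with add \<beta> show ?case
    by (simp add: tensor_contract_def tensor_lift_add contract_add contract_pure pure_tensor_single)
qed

lemma contract_in:
  assumes "t \<in> tensor_power scale 2 V" "subspace V" "bilinear \<beta>" "subspace W"
    and "\<And>a b. a \<in> V \<Longrightarrow> b \<in> V \<Longrightarrow> \<beta> a b \<in> W"
  shows "contract \<beta> t \<in> W"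
  using assms(1,2)
  by (induction rule: tensor_power_2_induct)
    (use assms in \<open>auto simp: contract_zero contract_add contract_pure intro: subspace_add subspace_0\<close>)

lemma tensor_power_2_expand:
  assumes "t \<in> tensor_power scale 2 UNIV"
  shows "t = (\<Sum>i\<in>Basis. \<Sum>j\<in>Basis. tensor_scale (tensor_eval (coord i) (coord j) t) (pure_tensor scale [i, j]))"
  using assms subspace_UNIV
proof (induction rule: tensor_power_2_induct)
  case zero
  show ?case by (simp add: tensor_eval_zero)
next
  case (add a b t)
  have "pure_tensor scale [a, b] = pure_tensor scale [\<Sum>i\<in>Basis. scale (coord i a) i, \<Sum>j\<in>Basis. scale (coord j b) j]"
    by (simp add: coord_sum)
  also have "\<dots> = (\<Sum>i\<in>Basis. \<Sum>j\<in>Basis. tensor_scale (coord i a * coord j b) (pure_tensor scale [i, j]))"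
    by (subst pure_tensor_pair_sum(1)) (simp add: pure_tensor_pair_sum(2) pure_tensor_pair tensor.scale_sum_right mult.commute)
  finally have *: "pure_tensor scale [a, b] = (\<Sum>i\<in>Basis. \<Sum>j\<in>Basis.
      tensor_scale (tensor_eval (coord i) (coord j) (pure_tensor scale [a, b])) (pure_tensor scale [i, j]))"
    unfolding tensor_eval_pure[OF coord_functional coord_functional] .
  show ?case
    by (simp only: tensor_eval_add tensor.scale_left_distrib sum.distrib *[symmetric] add.IH[symmetric])
qed

lemma tensor_power_2_eqI:
  assumes "s \<in> tensor_power scale 2 UNIV" "t \<in> tensor_power scale 2 UNIV"
    and "\<And>f g. functional f \<Longrightarrow> functional g \<Longrightarrow> tensor_eval f g s = tensor_eval f g t"
  shows "s = t"
  by (subst tensor_power_2_expand[OF assms(1)], subst tensor_power_2_expand[OF assms(2)])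
    (simp add: assms(3)[OF coord_functional coord_functional])

lemma bilinear_slice:
  assumes "functional f"
  shows "bilinear (\<lambda>a b. scale (f b) a)" "bilinear (\<lambda>a b. scale (f a) b)"
  using assms vector_space_axioms by (auto simp: bilinear_def Vector_Spaces.linear_iff algebra_simps)

lemma functional_slice:
  assumes "functional f" "functional g" "t \<in> tensor_power scale 2 UNIV"
  shows "g (contract (\<lambda>a b. scale (f b) a) t) = tensor_eval g f t"
    and "g (contract (\<lambda>a b. scale (f a) b) t) = tensor_eval f g t"
proof -
  interpret g: Vector_Spaces.linear scale "(*)" g by fact
  show "g (contract (\<lambda>a b. scale (f b) a) t) = tensor_eval g f t"
    using assms(3) subspace_UNIV
    by (induction rule: tensor_power_2_induct) (use assms bilinear_slice[OF assms(1)] in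
      \<open>auto simp: contract_zero tensor_eval_zero contract_add contract_pure tensor_eval_add g.add g.scale g.zero tensor_eval_pure[where scale=scale]\<close>)
  show "g (contract (\<lambda>a b. scale (f a) b) t) = tensor_eval f g t"
    using assms(3) subspace_UNIV
    by (induction rule: tensor_power_2_induct) (use assms bilinear_slice[OF assms(1)] in
      \<open>auto simp: contract_zero tensor_eval_zero contract_add contract_pure tensor_eval_add g.add g.scale g.zero tensor_eval_pure[where scale=scale]\<close>)
qed

text \<open>With \<open>\<pi>\<close> a projection onto \<open>D\<close>, the tensor equals its
  image \<open>s\<close> under \<open>\<pi> \<otimes> \<pi>\<close>. Tested on functionals
  \<open>f\<close> and \<open>g\<close>, the projection is removed one factor at a time: it fixes
  the slice by \<open>g \<circ> \<pi>\<close>, and then the slice by \<open>f\<close>.\<close>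

lemma tensor_power_2_subspaceI:
  assumes t: "t \<in> tensor_power scale 2 UNIV" and D: "subspace D"
    and R: "\<And>f. functional f \<Longrightarrow> contract (\<lambda>a b. scale (f b) a) t \<in> D"
    and L: "\<And>f. functional f \<Longrightarrow> contract (\<lambda>a b. scale (f a) b) t \<in> D"
  shows "t \<in> tensor_power scale 2 D"
proof -
  interpret P: vector_space_pair scale scale ..
  obtain \<pi> where \<pi>: "range \<pi> \<subseteq> D" "Vector_Spaces.linear scale scale \<pi>" "\<And>v. v \<in> D \<Longrightarrow> \<pi> v = v"
    using P.linear_exists_left_inverse_on[OF linear_ident D] by auto
  have comp: "functional (\<lambda>x. f (\<pi> x))" if "functional f" for f
    using Vector_Spaces.linear_compose[OF \<pi>(2) that] by (simp add: o_def)
  define s where "s = (\<Sum>i\<in>Basis. \<Sum>j\<in>Basis. tensor_scale (tensor_eval (coord i) (coord j) t) (pure_tensor scale [\<pi> i, \<pi> j]))"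
  have s: "s \<in> tensor_power scale 2 D"
    unfolding s_def using \<pi>(1) by (intro tensor_power_sum tensor_power_scale tensor_power_pure) auto
  have "t = s"
  proof (rule tensor_power_2_eqI[OF t tensor_power_UNIV[OF s]])
    fix f g assume f: "functional f" and g: "functional g"
    have "tensor_eval f g s = (\<Sum>i\<in>Basis. \<Sum>j\<in>Basis. tensor_eval (coord i) (coord j) t * (f (\<pi> i) * g (\<pi> j)))"
      unfolding s_def by (simp add: tensor_eval_sum tensor_eval_scale tensor_eval_pure[OF f g])
    also have "\<dots> = tensor_eval (\<lambda>x. f (\<pi> x)) (\<lambda>x. g (\<pi> x)) t"
      by (subst (2) tensor_power_2_expand[OF t])
        (simp add: tensor_eval_sum tensor_eval_scale tensor_eval_pure[OF comp[OF f] comp[OF g]])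
    also have "\<dots> = tensor_eval f (\<lambda>x. g (\<pi> x)) t"
      unfolding functional_slice(1)[OF comp[OF g] comp[OF f] t, symmetric]
        functional_slice(1)[OF comp[OF g] f t, symmetric]
      using R[OF comp[OF g]] by (simp add: \<pi>(3))
    also have "\<dots> = tensor_eval f g t"
      unfolding functional_slice(2)[OF f comp[OF g] t, symmetric]
        functional_slice(2)[OF f g t, symmetric]
      using L[OF f] by (simp add: \<pi>(3))
    finally show "tensor_eval f g t = tensor_eval f g s" ..
  qed
  with s show ?thesis by simp
qed

end

section \<open>Finite-dimensional coalgebras\<close>

locale fd_coalgebra = coalgebra scale \<Delta> \<epsilon> + finite_dimensional_vector_space scale Basis
  for scale :: "'k::field \<Rightarrow> 'a::ab_group_add \<Rightarrow> 'a"
    and \<Delta> :: "'a \<Rightarrow> ('k, 'a) tensor"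
    and \<epsilon> :: "'a \<Rightarrow> 'k" and Basis
begin

lemma comult_hom:
  "\<Delta> (x + y) = \<Delta> x + \<Delta> y" "\<Delta> (scale c x) = tensor_scale c (\<Delta> x)" "\<Delta> (x - y) = \<Delta> x - \<Delta> y" "\<Delta> 0 = 0"
  by (fact linearD[OF comult_linear])+

lemma comult_sum: "\<Delta> (\<Sum>i\<in>I. x i) = (\<Sum>i\<in>I. \<Delta> (x i))"
  by (fact linearD[OF comult_linear])

definition conv :: "('a \<Rightarrow> 'k) \<Rightarrow> ('a \<Rightarrow> 'k) \<Rightarrow> 'a \<Rightarrow> 'k"
  where "conv f g x = tensor_eval f g (\<Delta> x)"

lemma conv_functional: "functional (conv f g)"
  by (simp add: Vector_Spaces.linear_iff conv_def[abs_def] comult_hom tensor_eval_add tensor_eval_scale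
      vector_space_axioms vector_space_field)

text \<open>Coassociativity is evaluated at the form \<open>f \<otimes> g \<otimes> h\<close>,
  extended by zero to lists of length other than three; the two iterated coproducts give the two
  sides.\<close>

lemma conv_assoc:
  assumes f: "functional f" and g: "functional g" and h: "functional h"
  shows "conv (conv f g) h x = conv f (conv g h) x"
proof -
  have vs: "vector_space scale" ..
  let ?B = "\<lambda>xs. case xs of [a, b, c] \<Rightarrow> f a * g b * h c | _ \<Rightarrow> 0"
  have l3: "xs = [] \<or> (\<exists>a. xs = [a]) \<or> (\<exists>a b. xs = [a, b]) \<or> (\<exists>a b c. xs = [a, b, c]) \<or> (\<exists>a b c d ys. xs = a # b # c # d # ys)" for xs :: "'a list"
    by (metis list.exhaust)
  have fgh: "f (a + b) = f a + f b" "f (scale c a) = c * f a" "g (a + b) = g a + g b" "g (scale c a) = c * g a"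
    "h (a + b) = h a + h b" "h (scale c a) = c * h a" for a b c
    using assms by (auto simp: Vector_Spaces.linear_iff)
  have mB: "multilinear scale (*) ?B"
    unfolding multilinear_def
  proof (intro allI)
    fix us vs :: "'a list"
    have "?B (us @ (a + b) # vs) = ?B (us @ a # vs) + ?B (us @ b # vs)" for a b
      using l3[of us] l3[of vs] by (auto simp: fgh algebra_simps)
    moreover have "?B (us @ scale c a # vs) = c * ?B (us @ a # vs)" for a c
      using l3[of us] l3[of vs] by (auto simp: fgh algebra_simps)
    ultimately show "functional (\<lambda>a. ?B (us @ a # vs))"
      by (simp add: Vector_Spaces.linear_iff vector_space_axioms vector_space_field)
  qed
  have pB: "pure_tensor scale ys ?B = ?B ys" for ys
    by (simp add: pure_tensor_def mB)
  have 0: "tensor_apply_at scale \<Delta> 0 t ?B = tensor_eval (conv f g) h t" if "t \<in> tensor_power scale 2 UNIV" for t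
    using that subspace_UNIV
  proof (induction rule: tensor_power_2_induct)
    case zero
    show ?case unfolding tensor_apply_at_zero tensor_eval_zero by (rule zero_fun_apply)
  next
    case (add a b t)
    have "(\<lambda>xs. ?B (xs @ [b])) = (\<lambda>xs. h b * (case xs of [x, y] \<Rightarrow> f x * g y | _ \<Rightarrow> 0))"
    proof
      fix xs :: "'a list"
      show "?B (xs @ [b]) = h b * (case xs of [x, y] \<Rightarrow> f x * g y | _ \<Rightarrow> 0)"
        using l3[of xs] by (auto simp: algebra_simps)
    qed
    then have "\<Delta> a (\<lambda>xs. ?B (xs @ [b])) = conv f g a * h b"
      using tensor_power_form_linear(2)[OF comult_in multilinear_pair[OF f g] multilinear_pair[OF f g], of a "h b"]
      by (simp add: conv_def tensor_eval_def)
    then have "tensor_apply_at scale \<Delta> 0 (pure_tensor scale [a, b]) ?B = conv f g a * h b"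
      by (subst tensor_apply_at_pure[OF vs comult_in comult_linear])
        (simp_all add: tensor_append_three[OF vs comult_in, where c = "[]", simplified] pB)
    then show ?case
      unfolding tensor_apply_at_add tensor_eval_add tensor_eval_pure[OF conv_functional h] unfolding plus_fun_apply add.IH by simp
  qed
  have 1: "tensor_apply_at scale \<Delta> 1 t ?B = tensor_eval f (conv g h) t" if "t \<in> tensor_power scale 2 UNIV" for t
    using that subspace_UNIV
  proof (induction rule: tensor_power_2_induct)
    case zero
    show ?case unfolding tensor_apply_at_zero tensor_eval_zero by (rule zero_fun_apply)
  next
    case (add a b t)
    have "(\<lambda>xs. ?B (a # xs)) = (\<lambda>xs. f a * (case xs of [x, y] \<Rightarrow> g x * h y | _ \<Rightarrow> 0))"
    proof
      fix xs :: "'a list"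
      show "?B (a # xs) = f a * (case xs of [x, y] \<Rightarrow> g x * h y | _ \<Rightarrow> 0)"
        using l3[of xs] by (auto simp: algebra_simps)
    qed
    then have "\<Delta> b (\<lambda>xs. ?B (a # xs)) = f a * conv g h b"
      using tensor_power_form_linear(2)[OF comult_in multilinear_pair[OF g h] multilinear_pair[OF g h], of b "f a"]
      by (simp add: conv_def tensor_eval_def)
    then have "tensor_apply_at scale \<Delta> 1 (pure_tensor scale [a, b]) ?B = f a * conv g h b"
      by (subst tensor_apply_at_pure[OF vs comult_in comult_linear])
        (simp_all add: tensor_append_three[OF vs comult_in, where c = "[a]" and d = "[]", simplified] pB)
    then show ?case
      unfolding tensor_apply_at_add tensor_eval_add tensor_eval_pure[OF f conv_functional] unfolding plus_fun_apply add.IH by simp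
  qed
  show ?thesis
    using 0[OF comult_in, of x] 1[OF comult_in, of x] coassoc[of x] by (simp add: conv_def[of _ _ x])
qed

definition R :: "('a \<Rightarrow> 'k) \<Rightarrow> 'a \<Rightarrow> 'a"
  where "R f x = contract (\<lambda>a b. scale (f b) a) (\<Delta> x)"

definition L :: "('a \<Rightarrow> 'k) \<Rightarrow> 'a \<Rightarrow> 'a"
  where "L f x = contract (\<lambda>a b. scale (f a) b) (\<Delta> x)"

lemma functional_R: "functional f \<Longrightarrow> functional g \<Longrightarrow> g (R f x) = conv g f x"
  and functional_L: "functional f \<Longrightarrow> functional g \<Longrightarrow> g (L f x) = conv f g x"
  by (simp_all add: R_def L_def conv_def functional_slice comult_in)

lemma R_linear: "Vector_Spaces.linear scale scale (R f)"
  and L_linear: "Vector_Spaces.linear scale scale (L f)"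
  by (simp_all add: Vector_Spaces.linear_iff R_def L_def comult_hom contract_add contract_scale vector_space_axioms)

lemma R_counit: "R \<epsilon> x = x"
  using counit_right[of x] tensor_contract_eq[OF comult_in bilinear_slice(1)[OF counit_linear]]
  by (auto simp: R_def intro: pure_tensor_single_inject)

lemma L_counit: "L \<epsilon> x = x"
  using counit_left[of x] tensor_contract_eq[OF comult_in bilinear_slice(2)[OF counit_linear]]
  by (auto simp: L_def intro: pure_tensor_single_inject)

lemma conv_comp:
  assumes "functional f" "functional g" "functional h"
  shows "conv f g (R h x) = conv (conv f g) h x" "conv f g (L h x) = conv h (conv f g) x"
  using functional_R[OF assms(3) conv_functional] functional_L[OF assms(3) conv_functional] by simp_all

text \<open>Paired with a further functional, composite actions become iterated convolutions, so
  this lemma and the next two are forms of \<open>conv_assoc\<close>.\<close>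

lemma R_R:
  assumes "functional f" "functional g"
  shows "R g (R f x) = R (\<lambda>y. g (R f y)) x"
proof (rule functionals_separate)
  fix h assume h: "functional h"
  have "(\<lambda>y. g (R f y)) = conv g f"
    using assms by (simp add: functional_R fun_eq_iff)
  then show "h (R g (R f x)) = h (R (\<lambda>y. g (R f y)) x)"
    using assms h by (simp add: functional_R conv_functional conv_comp conv_assoc)
qed

lemma L_L:
  assumes "functional f" "functional g"
  shows "L g (L f x) = L (\<lambda>y. g (L f y)) x"
proof (rule functionals_separate)
  fix h assume h: "functional h"
  have "(\<lambda>y. g (L f y)) = conv f g"
    using assms by (simp add: functional_L fun_eq_iff)
  then show "h (L g (L f x)) = h (L (\<lambda>y. g (L f y)) x)"
    using assms h by (simp add: functional_L conv_functional conv_comp conv_assoc)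
qed

lemma R_L:
  assumes "functional f" "functional g"
  shows "R f (L g x) = L g (R f x)"
proof (rule functionals_separate)
  fix h assume "functional h"
  then show "h (R f (L g x)) = h (L g (R f x))"
    using assms by (simp add: functional_R functional_L conv_functional conv_comp conv_assoc)
qed

text \<open>Subcoalgebras are the sub-bimodules for the dual algebra, which turns questions on
  coalgebras into questions on modules. From right to left, \<open>tensor_power_2_subspaceI\<close>
  is applied to the slices of the coproduct.\<close>

lemma subcoalgebra_iff:
  assumes D: "subspace D"
  shows "subcoalgebra D \<longleftrightarrow> (\<forall>f. functional f \<longrightarrow> R f ` D \<subseteq> D \<and> L f ` D \<subseteq> D)"
proof
  assume "subcoalgebra D"
  then have d: "\<Delta> x \<in> tensor_power scale 2 D" if "x \<in> D" for x
    using that by (auto simp: subcoalgebra_def)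
  have "R f x \<in> D" "L f x \<in> D" if "functional f" "x \<in> D" for f x
    unfolding R_def L_def using d[OF that(2)] D bilinear_slice[OF that(1)]
    by (auto intro!: contract_in[of _ D] subspace_scale)
  then show "\<forall>f. functional f \<longrightarrow> R f ` D \<subseteq> D \<and> L f ` D \<subseteq> D" by blast
next
  assume *: "\<forall>f. functional f \<longrightarrow> R f ` D \<subseteq> D \<and> L f ` D \<subseteq> D"
  have "\<Delta> x \<in> tensor_power scale 2 D" if "x \<in> D" for x
    using * that by (intro tensor_power_2_subspaceI[OF comult_in D]) (auto simp: R_def L_def)
  then show "subcoalgebra D" using D by (auto simp: subcoalgebra_def)
qed

lemma ex_simple_subcoalgebra:
  assumes "subcoalgebra C" "C \<noteq> {0}"
  obtains D where "simple_subcoalgebra D" "D \<subseteq> C"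
proof -
  define good where "good D \<longleftrightarrow> subcoalgebra D \<and> D \<noteq> {0} \<and> D \<subseteq> C" for D
  have "good C" using assms by (simp add: good_def)
  then obtain D where D: "good D" "\<And>E. good E \<Longrightarrow> dim D \<le> dim E"
    using ex_has_least_nat[of good C dim] by blast
  have "E = {0} \<or> E = D" if E: "subcoalgebra E" "E \<subseteq> D" for E
  proof (cases "E = {0}")
    case False
    then have "good E" using E D(1) by (auto simp: good_def)
    then show ?thesis
      using subspace_dim_equal[of E D] D E by (auto simp: good_def subcoalgebra_def)
  qed simp
  then show thesis
    using D(1) that[of D] by (auto simp: good_def simple_subcoalgebra_def)
qed

end

section \<open>Finite-dimensional Hopf algebras\<close>

locale fd_hopf = hopf_algebra scale \<Delta> \<epsilon> S + finite_dimensional_vector_space scale Basis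
  for scale :: "'k::field \<Rightarrow> 'a::ring_1 \<Rightarrow> 'a"
    and \<Delta> :: "'a \<Rightarrow> ('k, 'a) tensor"
    and \<epsilon> :: "'a \<Rightarrow> 'k" and S :: "'a \<Rightarrow> 'a" and Basis
begin

section \<open>Connected Hopf algebras and coinvariants modulo a subcoalgebra\<close>

sublocale fd_coalgebra scale \<Delta> \<epsilon> Basis ..

abbreviation endo :: "('a \<Rightarrow> 'a) \<Rightarrow> bool"
  where "endo \<equiv> Vector_Spaces.linear scale scale"

text \<open>The line through 1 is a simple subcoalgebra, hence by dimension the whole coradical. A
  nonzero subcoalgebra contains a simple one, which lies in that line and so contains 1.\<close>

lemma one_in_subcoalgebra:
  assumes conn: connected and C: "subcoalgebra C" "C \<noteq> {0}"
  shows "1 \<in> C"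
proof -
  have sub1: "1 \<in> D" if "subspace D" "D \<subseteq> span {1}" "D \<noteq> {0}" for D
  proof -
    have "\<exists>x\<in>D. x \<noteq> 0" using that(3) subspace_0[OF that(1)] by auto
    then obtain x where x: "x \<in> D" "x \<noteq> 0" by blast
    with \<open>D \<subseteq> span {1}\<close> obtain c where "x = scale c 1" by (auto simp: span_singleton)
    with x have "c \<noteq> 0" "1 = scale (inverse c) x" by auto
    then show ?thesis using x(1) that(1) subspace_scale by metis
  qed
  have "simple_subcoalgebra (span {1})"
    unfolding simple_subcoalgebra_def
  proof (intro conjI allI impI)
    have "\<Delta> x \<in> tensor_power scale 2 (span {1})" if "x \<in> span {1}" for x
    proof -
      obtain c where "x = scale c 1" using \<open>x \<in> span {1}\<close> by (auto simp: span_singleton)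
      then show ?thesis
        by (auto simp: comult_hom comult_one intro!: tensor_power_scale tensor_power_pure span_base)
    qed
    then show "subcoalgebra (span {1})" by (auto simp: subcoalgebra_def)
    have "1 \<in> span {1}" by (simp add: span_base)
    then show "span {1} \<noteq> {0}" by auto
    show "D = {0} \<or> D = span {1}" if "subcoalgebra D \<and> D \<subseteq> span {1}" for D
      using that sub1[of D] span_minimal[of "{1}" D] by (auto simp: subcoalgebra_def)
  qed
  then have "span {1} \<subseteq> coradical"
    unfolding coradical_def by (auto intro: span_base)
  moreover have "dim (span {1}) = 1"
    using dim_span dim_eq_card_independent[of "{1}"] by simp
  ultimately have eq: "span {1} = coradical"
    using conn unfolding connected_def by (intro subspace_dim_equal) (auto simp: coradical_def)
  obtain D where D: "simple_subcoalgebra D" "D \<subseteq> C"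
    using ex_simple_subcoalgebra[OF C] .
  then have "D \<subseteq> span {1}"
    unfolding eq coradical_def by (intro subset_trans[OF Union_upper span_superset]) simp
  then show ?thesis
    using sub1[of D] D by (auto simp: simple_subcoalgebra_def subcoalgebra_def)
qed

lemma R_one: "functional f \<Longrightarrow> R f 1 = scale (f 1) 1"
  and L_one: "functional f \<Longrightarrow> L f 1 = scale (f 1) 1"
  by (simp_all add: R_def L_def comult_one contract_pure bilinear_slice)

lemma dual_actions:
  assumes connected
  shows "dual_actions scale Basis \<epsilon> R L 1" "dual_actions scale Basis \<epsilon> L R 1"
proof -
  have conn: "1 \<in> C" if "subspace C" "C \<noteq> {0}"
    "\<And>f x. functional f \<Longrightarrow> x \<in> C \<Longrightarrow> R f x \<in> C" "\<And>f x. functional f \<Longrightarrow> x \<in> C \<Longrightarrow> L f x \<in> C" for C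
    using that(3,4) by (intro one_in_subcoalgebra assms that(2)) (auto simp: subcoalgebra_iff[OF that(1)])
  have adj: "g (R f x) = f (L g x)" if "functional f" "functional g" for f g x
    using that by (simp add: functional_R functional_L)
  have adj': "g (L f x) = f (R g x)" if "functional f" "functional g" for f g x
    using that by (simp add: functional_R functional_L)
  have conn': "1 \<in> C" if "subspace C" "C \<noteq> {0}"
    "\<And>f x. functional f \<Longrightarrow> x \<in> C \<Longrightarrow> L f x \<in> C" "\<And>f x. functional f \<Longrightarrow> x \<in> C \<Longrightarrow> R f x \<in> C" for C
    using that(1,2,4,3) by (rule conn)
  have comm: "L f (R g x) = R g (L f x)" if "functional f" "functional g" for f g x
    using that by (simp add: R_L)
  have Rl: "functional f \<Longrightarrow> endo (R f)" and Ll: "functional f \<Longrightarrow> endo (L f)" for f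
    by (simp_all add: R_linear L_linear)
  show "dual_actions scale Basis \<epsilon> R L 1"
    by (intro dual_actions.intro dual_actions_axioms.intro)
      (fact finite_dimensional_vector_space_axioms counit_linear Rl Ll R_counit L_counit adj R_R L_L R_L R_one counit_one conn)+
  show "dual_actions scale Basis \<epsilon> L R 1"
    by (intro dual_actions.intro dual_actions_axioms.intro)
      (fact finite_dimensional_vector_space_axioms counit_linear Rl Ll R_counit L_counit adj' R_R L_L comm L_one counit_one conn')+
qed

text \<open>Coinvariance modulo \<open>U\<close> is reached one side at a time. The elements
  \<open>Y\<close> coinvariant for \<open>R\<close> are stable under \<open>L\<close> because the
  actions commute; applying \<open>ex_coinvariant\<close> for \<open>L\<close> inside
  \<open>Y\<close> gives \<open>z\<close> coinvariant on both sides.\<close>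

lemma ex_almost_primitive:
  assumes conn: connected and U: "subcoalgebra U" "1 \<in> U" "U \<noteq> UNIV"
  obtains z where "z \<notin> U" "\<Delta> z - pure_tensor scale [z, 1] - pure_tensor scale [1, z] \<in> tensor_power scale 2 U"
proof -
  interpret r: dual_actions scale Basis \<epsilon> R L 1 using conn by (rule dual_actions)
  interpret l: dual_actions scale Basis \<epsilon> L R 1 using conn by (rule dual_actions)
  have sU: "subspace U" using U by (simp add: subcoalgebra_def)
  have RU: "R f x \<in> U" and LU: "L f x \<in> U" if "functional f" "x \<in> U" for f x
    using U(1) that by (auto simp: subcoalgebra_iff[OF sU])
  define Y where "Y = {x. \<forall>f. functional f \<and> f 1 = 0 \<longrightarrow> R f x \<in> U}"
  have "subspace Y"
    using sU R_linear by (auto simp: Y_def subspace_def linearD[OF R_linear])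
  moreover have "U \<subset> Y"
    using r.ex_coinvariant[OF sU subspace_UNIV _ RU] U(3) RU by (auto simp: Y_def)
  moreover have "L f x \<in> Y" if "functional f" "x \<in> Y" for f x
    using that LU by (auto simp: Y_def R_L)
  ultimately obtain z where z: "z \<in> Y" "z \<notin> U" "\<And>f. functional f \<Longrightarrow> f 1 = 0 \<Longrightarrow> L f z \<in> U"
    using l.ex_coinvariant[OF sU _ _ LU, of Y] by blast
  have zR: "R f z \<in> U" if "functional f" "f 1 = 0" for f
    using z(1) that by (auto simp: Y_def)
  let ?t = "\<Delta> z - pure_tensor scale [z, 1] - pure_tensor scale [1, z]"
  have "?t \<in> tensor_power scale 2 U"
  proof (rule tensor_power_2_subspaceI[OF _ sU])
    show "?t \<in> tensor_power scale 2 UNIV"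
      by (intro tensor_power_diff comult_in tensor_power_pure) auto
    fix f assume f: "functional f"
    \<comment> \<open>Subtracting a multiple of the counit makes the functional vanish at 1, so
      coinvariance applies; \<open>R g z\<close> and \<open>L g z\<close> are the slices of
      \<open>?t\<close> up to multiples of 1.\<close>
    define g where "g y = f y + (- f 1) * \<epsilon> y" for y
    have lin: "functional (\<lambda>y. (- f 1) * \<epsilon> y)"
      using counit_linear by (auto simp: Vector_Spaces.linear_iff algebra_simps)
    then have g: "functional g" "g 1 = 0"
      using f by (auto simp: g_def[abs_def] Vector_Spaces.linear_iff algebra_simps counit_one)
    have "R g z = R f z - scale (f 1) z"
      using r.R_add[OF f lin, of z] r.R_scale[OF counit_linear, of "- f 1" z]
      by (simp add: g_def[abs_def] R_counit)
    then have "R f z - scale (f 1) z - scale (f z) 1 \<in> U"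
      using zR[OF g] sU U(2) by (auto intro: subspace_diff subspace_scale)
    then show "contract (\<lambda>a b. scale (f b) a) ?t \<in> U"
      using f by (simp add: contract_diff contract_pure bilinear_slice R_def)
    have "L g z = L f z - scale (f 1) z"
      using l.R_add[OF f lin, of z] l.R_scale[OF counit_linear, of "- f 1" z]
      by (simp add: g_def[abs_def] L_counit)
    then have "L f z - scale (f 1) z - scale (f z) 1 \<in> U"
      using z(3)[OF g] sU U(2) by (auto intro: subspace_diff subspace_scale)
    then have "L f z - scale (f z) 1 - scale (f 1) z \<in> U"
      by (simp add: algebra_simps)
    then show "contract (\<lambda>a b. scale (f a) b) ?t \<in> U"
      using f by (simp add: contract_diff contract_pure bilinear_slice L_def)
  qed
  then show thesis using that z(2) by blast
qed

text \<open>Up to sign \<open>u\<close> is the coboundary of \<open>z\<close>, so the claim is that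
  the differential squares to zero at \<open>z\<close>. In the coassociativity identity the outer
  terms \<open>?l u\<close> and \<open>?r u\<close> come from the copies of
  \<open>\<Delta> z\<close> that survive the first expansion.\<close>

lemma almost_primitive_cocycle:
  assumes \<Delta>z: "\<Delta> z = pure_tensor scale [z, 1] + pure_tensor scale [1, z] + u" and u: "u \<in> tensor_power scale 2 V"
  shows "cocycle V 2 u"
proof -
  have vs: "vector_space scale" ..
  note u' = tensor_power_UNIV[OF u]
  let ?l = "tensor_append scale (pure_tensor scale [1])" and ?r = "\<lambda>t. tensor_append scale t (pure_tensor scale [1])"
  let ?d = "\<lambda>i. tensor_apply_at scale \<Delta> i"
  let ?p = "\<lambda>a b c. pure_tensor scale [a, b, c]"
  note pure = tensor_append_pure[OF vs]
  have T: "pure_tensor scale [a, b] \<in> tensor_power scale 2 UNIV" for a b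
    by (simp add: tensor_power_pure)
  have l_add: "?l (s + t) = ?l s + ?l t" if "s \<in> tensor_power scale 2 UNIV" "t \<in> tensor_power scale 2 UNIV" for s t
    by (simp only: tensor_append_pure_left[OF that(1)] tensor_append_pure_left[OF that(2)]
        tensor_append_pure_left[OF tensor_power_add[OF that]] tensor_lift_add)
  have r_add: "?r (s + t) = ?r s + ?r t" for s t
    by (simp add: tensor_append_pure_right[OF vs] tensor_lift_add)
  have l: "?l (\<Delta> z) = ?p 1 z 1 + ?p 1 1 z + ?l u"
    unfolding \<Delta>z by (simp add: l_add T u' tensor_power_add pure)
  have r: "?r (\<Delta> z) = ?p z 1 1 + ?p 1 z 1 + ?r u"
    unfolding \<Delta>z by (simp add: r_add pure)
  have e: "tensor_append scale (pure_tensor scale []) (tensor_append scale (\<Delta> a) (pure_tensor scale [b])) =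
      tensor_append scale (\<Delta> a) (pure_tensor scale [b])" for a b
    by (rule trans[OF tensor_append_three[OF vs comult_in]]) (simp add: tensor_append_pure_right[OF vs] tensor_lift_def)
  have d0: "?d 0 (pure_tensor scale [a, b]) = tensor_append scale (\<Delta> a) (pure_tensor scale [b])" for a b
    by (subst tensor_apply_at_pure[OF vs comult_in comult_linear])
      (simp_all add: e)
  have d1: "?d 1 (pure_tensor scale [a, b]) = tensor_append scale (pure_tensor scale [a]) (\<Delta> b)" for a b
    by (subst tensor_apply_at_pure[OF vs comult_in comult_linear])
      (simp_all add: tensor_append_three[OF vs comult_in, where d = "[]"] tensor_append_pure_left[OF comult_in] tensor_lift_def)
  have 0: "?d 0 (\<Delta> z) = ?r (\<Delta> z) + ?p 1 1 z + ?d 0 u"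
    by (subst \<Delta>z) (simp only: tensor_apply_at_add d0 comult_one pure append.simps)
  have 1: "?d 1 (\<Delta> z) = ?p z 1 1 + ?l (\<Delta> z) + ?d 1 u"
    by (subst \<Delta>z) (simp only: tensor_apply_at_add d1 comult_one pure append.simps)
  have "cobar_d 2 u = ?l u - ?d 0 u + ?d 1 u - ?r u"
    by (simp add: cobar_d_def numeral_2_eq_2)
  also have "\<dots> = 0"
    using coassoc[of z] unfolding 0 1 unfolding l r by (simp add: algebra_simps)
  finally show ?thesis
    using u by (simp add: cocycle_def)
qed

section \<open>The convolution algebra of endomorphisms and the antipode\<close>

definition convolution :: "('a \<Rightarrow> 'a) \<Rightarrow> ('a \<Rightarrow> 'a) \<Rightarrow> 'a \<Rightarrow> 'a"
  where "convolution F G x = contract (\<lambda>a b. F a * G b) (\<Delta> x)"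

lemma bilinear_mult: "endo F \<Longrightarrow> endo G \<Longrightarrow> bilinear (\<lambda>a b. F a * G b)"
  by (auto simp: bilinear_def Vector_Spaces.linear_iff algebra_simps scale_mult_left[symmetric] scale_mult_right[symmetric])

lemma convolution_endo: "endo (convolution F G)"
  by (simp add: Vector_Spaces.linear_iff convolution_def[abs_def] comult_hom contract_add contract_scale
      vector_space_axioms)

lemma conv_expand_left: "functional f \<Longrightarrow> functional g \<Longrightarrow> conv f g x = (\<Sum>i\<in>Basis. conv (coord i) g x * f i)"
  using functional_coord[of f "R g x"] by (simp add: functional_R coord_functional)

lemma conv_expand_right: "functional f \<Longrightarrow> functional g \<Longrightarrow> conv f g x = (\<Sum>i\<in>Basis. conv f (coord i) x * g i)"
  using functional_coord[of g "L f x"] by (simp add: functional_L coord_functional)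

lemma convolution_expand:
  "convolution F G x = (\<Sum>i\<in>Basis. \<Sum>j\<in>Basis. scale (conv (coord i) (coord j) x) (F i * G j))"
  by (simp add: convolution_def contract_def conv_def)

text \<open>In coordinates both sides are sums over basis triples of multiples of
  \<open>F i * G j * K k\<close>. The extra index \<open>m\<close> comes from the inner convolution;
  summing over it first leaves iterated \<open>conv\<close> coefficients, which agree by
  \<open>conv_assoc\<close>.\<close>

lemma convolution_assoc: "convolution (convolution F G) K = convolution F (convolution G K)"
proof
  fix x
  let ?c = coord
  have "convolution (convolution F G) K x = (\<Sum>m\<in>Basis. \<Sum>k\<in>Basis. \<Sum>i\<in>Basis. \<Sum>j\<in>Basis.
      scale (conv (?c m) (?c k) x * conv (?c i) (?c j) m) (F i * G j * K k))"
    unfolding convolution_expand[of "convolution F G" K]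
    by (simp add: convolution_expand[of F G] scale_sum_right sum_distrib_right scale_mult_left[symmetric])
  also have "\<dots> = (\<Sum>k\<in>Basis. \<Sum>i\<in>Basis. \<Sum>j\<in>Basis. \<Sum>m\<in>Basis.
      scale (conv (?c m) (?c k) x * conv (?c i) (?c j) m) (F i * G j * K k))"
    by (subst sum.swap, rule sum.cong[OF refl], subst sum.swap, rule sum.cong[OF refl], rule sum.swap)
  also have "\<dots> = (\<Sum>k\<in>Basis. \<Sum>i\<in>Basis. \<Sum>j\<in>Basis. scale (conv (conv (?c i) (?c j)) (?c k) x) (F i * G j * K k))"
    by (simp only: scale_sum_left[symmetric] conv_expand_left[OF conv_functional coord_functional, symmetric])
  also have "\<dots> = (\<Sum>k\<in>Basis. \<Sum>i\<in>Basis. \<Sum>j\<in>Basis. scale (conv (?c i) (conv (?c j) (?c k)) x) (F i * G j * K k))"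
    by (simp only: conv_assoc[OF coord_functional coord_functional coord_functional])
  also have "\<dots> = (\<Sum>k\<in>Basis. \<Sum>i\<in>Basis. \<Sum>j\<in>Basis. \<Sum>m\<in>Basis.
      scale (conv (?c i) (?c m) x * conv (?c j) (?c k) m) (F i * (G j * K k)))"
    by (simp only: scale_sum_left[symmetric] conv_expand_right[OF coord_functional conv_functional, symmetric] mult.assoc)
  also have "\<dots> = (\<Sum>i\<in>Basis. \<Sum>m\<in>Basis. \<Sum>j\<in>Basis. \<Sum>k\<in>Basis.
      scale (conv (?c i) (?c m) x * conv (?c j) (?c k) m) (F i * (G j * K k)))"
    (is "?lhs = ?rhs")
  proof -
    have "?lhs = (\<Sum>i\<in>Basis. \<Sum>k\<in>Basis. \<Sum>m\<in>Basis. \<Sum>j\<in>Basis.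
      scale (conv (?c i) (?c m) x * conv (?c j) (?c k) m) (F i * (G j * K k)))"
      by (subst sum.swap, rule sum.cong[OF refl], rule sum.cong[OF refl], rule sum.swap)
    also have "\<dots> = ?rhs"
      by (rule sum.cong[OF refl], subst sum.swap, rule sum.cong[OF refl], rule sum.swap)
    finally show ?thesis .
  qed
  also have "\<dots> = convolution F (convolution G K) x"
    unfolding convolution_expand[of F "convolution G K"]
    by (simp add: convolution_expand[of G K] scale_sum_right sum_distrib_left scale_mult_right[symmetric])
  finally show "convolution (convolution F G) K x = convolution F (convolution G K) x" .
qed

definition conv_unit :: "'a \<Rightarrow> 'a"
  where "conv_unit x = scale (\<epsilon> x) 1"

lemma conv_unit_endo: "endo conv_unit"
  using counit_linear by (auto simp: Vector_Spaces.linear_iff conv_unit_def[abs_def] algebra_simps)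

lemma convolution_unit:
  assumes "endo F"
  shows "convolution F conv_unit = F" "convolution conv_unit F = F"
proof -
  have "F (contract \<beta> t) = contract (\<lambda>a b. F (\<beta> a b)) t" for \<beta> t
    by (simp add: contract_def linearD[OF assms])
  note * = this[symmetric]
  have "convolution F conv_unit x = F (R \<epsilon> x)" "convolution conv_unit F x = F (L \<epsilon> x)" for x
    unfolding convolution_def conv_unit_def R_def L_def
    by (simp_all add: scale_mult_left[symmetric] scale_mult_right[symmetric] linearD(2)[OF assms, symmetric] *)
  then show "convolution F conv_unit = F" "convolution conv_unit F = F"
    by (simp_all add: R_counit L_counit fun_eq_iff)
qed

lemma convolution_antipode: "convolution (\<lambda>x. x) S = conv_unit" "convolution S (\<lambda>x. x) = conv_unit"
proof -
  have "bilinear (\<lambda>a b. a * S b)" "bilinear (\<lambda>a b. S a * b)"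
    using bilinear_mult[OF linear_ident antipode_linear] bilinear_mult[OF antipode_linear linear_ident] by simp_all
  then show "convolution (\<lambda>x. x) S = conv_unit" "convolution S (\<lambda>x. x) = conv_unit"
    using antipode_right antipode_left
    by (auto simp: convolution_def conv_unit_def fun_eq_iff tensor_contract_eq[OF comult_in] intro: pure_tensor_single_inject)
qed

lemma convolution_sum_scale:
  "convolution (\<lambda>x. \<Sum>i\<in>I. scale (c i) (F i x)) G x = (\<Sum>i\<in>I. scale (c i) (convolution (F i) G x))"
proof -
  have "convolution (\<lambda>x. \<Sum>i\<in>I. scale (c i) (F i x)) G x =
      (\<Sum>k\<in>Basis. \<Sum>j\<in>Basis. \<Sum>i\<in>I. scale (c i) (scale (conv (coord k) (coord j) x) (F i k * G j)))"
    by (simp add: convolution_expand sum_distrib_right scale_sum_right scale_mult_left[symmetric] mult.commute)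
  also have "\<dots> = (\<Sum>i\<in>I. scale (c i) (convolution (F i) G x))"
    unfolding convolution_expand scale_sum_right
    by (subst (2) sum.swap, subst sum.swap, rule refl)
  finally show ?thesis .
qed

fun conv_power :: "nat \<Rightarrow> 'a \<Rightarrow> 'a"
  where "conv_power 0 = conv_unit"
  | "conv_power (Suc n) = convolution (conv_power n) (\<lambda>x. x)"

lemma conv_power_endo: "endo (conv_power n)"
  by (cases n) (simp_all add: conv_unit_endo convolution_endo)

lemma conv_power_antipode: "convolution (conv_power (Suc n)) S = conv_power n"
  by (simp add: convolution_assoc convolution_antipode convolution_unit conv_power_endo)

text \<open>
  The convolution powers of the identity are linearly dependent, and a relation between them can be divided
  by the identity, whose inverse is \<open>S\<close>.
\<close>

lemma antipode_conv_power:
  obtains d :: "nat \<Rightarrow> 'k" and N where "\<And>x. S x = (\<Sum>n<N. scale (d n) (conv_power n x))"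
proof -
  interpret E: vector_space "\<lambda>c (F :: 'a \<Rightarrow> 'a) x. scale c (F x)"
    by unfold_locales (auto simp: fun_eq_iff algebra_simps plus_fun_apply)
  \<comment> \<open>The elementary endomorphisms, taking one basis vector to another; they span all
    linear endomorphisms.\<close>
  define T where "T = (\<lambda>(i, j) x. scale (coord i x) j) ` (Basis \<times> Basis)"
  have "F \<in> E.span T" if "endo F" for F
  proof -
    have "F = (\<Sum>i\<in>Basis. \<Sum>j\<in>Basis. (\<lambda>x. scale (coord j (F i)) (scale (coord i x) j)))"
    proof
      fix x
      have "F x = F (\<Sum>i\<in>Basis. scale (coord i x) i)" by (simp add: coord_sum)
      also have "\<dots> = (\<Sum>i\<in>Basis. scale (coord i x) (F i))"
        by (simp only: linearD[OF that])
      also have "\<dots> = (\<Sum>i\<in>Basis. scale (coord i x) (\<Sum>j\<in>Basis. scale (coord j (F i)) j))"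
        by (simp only: coord_sum)
      finally show "F x = (\<Sum>i\<in>Basis. \<Sum>j\<in>Basis. (\<lambda>x. scale (coord j (F i)) (scale (coord i x) j))) x"
        by (simp add: sum_fun_apply scale_sum_right mult.commute)
    qed
    also have "\<dots> \<in> E.span T"
      by (intro E.span_sum E.span_scale E.span_base) (auto simp: T_def)
    finally show ?thesis .
  qed
  then have mem: "conv_power n \<in> E.span T" for n
    using conv_power_endo by blast
  have fin: "finite T"
    using finite_Basis by (simp add: T_def)
  obtain c N i where rel: "i \<le> N" "c i \<noteq> 0" "(\<Sum>n\<le>N. (\<lambda>x. scale (c n) (conv_power n x))) = 0"
    by (rule E.ex_sequence_relation[OF fin mem]) (rule that)
  \<comment> \<open>Convolving with \<open>S\<close> on the right lowers each positive power by one
    and turns the power 0, which is the unit, into \<open>S\<close>.\<close>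
  have shift: "(\<Sum>n\<le>N. scale (c n) (convolution (conv_power n) S x)) = 0"
    if "\<And>x. (\<Sum>n\<le>N. scale (c n) (conv_power n x)) = 0" for c :: "nat \<Rightarrow> 'k" and N x
    using that unfolding convolution_sum_scale[symmetric] by (simp add: convolution_def contract_def)
  have base: "\<exists>d N. \<forall>x. S x = (\<Sum>n<N. scale (d n) (conv_power n x))"
    if "c 0 \<noteq> 0" "\<And>x. (\<Sum>n\<le>N. scale (c n) (conv_power n x)) = 0" for c :: "nat \<Rightarrow> 'k" and N
  proof -
    have "scale (c 0) (S x) + (\<Sum>n<N. scale (c (Suc n)) (conv_power n x)) = 0" for x
      using shift[OF that(2), of x]
      by (simp only: sum.atMost_shift conv_power_antipode conv_power.simps(1) convolution_unit[OF antipode_linear])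
    then have *: "scale (c 0) (S x) = - (\<Sum>n<N. scale (c (Suc n)) (conv_power n x))" for x
      by (simp add: eq_neg_iff_add_eq_0)
    have "S x = scale (inverse (c 0)) (scale (c 0) (S x))" for x
      using that(1) by simp
    then have "S x = (\<Sum>n<N. scale (- (inverse (c 0) * c (Suc n))) (conv_power n x))" for x
      unfolding * by (simp add: scale_sum_right sum_negf)
    then show ?thesis
      by (intro exI[of _ "\<lambda>n. - (inverse (c 0) * c (Suc n))"] exI[of _ N] allI)
  qed
  \<comment> \<open>Induction on the position of a nonzero coefficient: while the constant
    coefficient is zero the relation is divided by the identity; once it is nonzero, the shifted
    relation is solved for \<open>S\<close>.\<close>
  have "\<exists>d N. \<forall>x. S x = (\<Sum>n<N. scale (d n) (conv_power n x))"
    if "i \<le> N" "c i \<noteq> 0" "\<And>x. (\<Sum>n\<le>N. scale (c n) (conv_power n x)) = 0" for c :: "nat \<Rightarrow> 'k" and N i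
    using that
  proof (induction i arbitrary: c N)
    case (0 c N)
    then show ?case using base by blast
  next
    case (Suc i c N)
    show ?case
    proof (cases "c 0 = 0")
      case False
      then show ?thesis using base Suc.prems(3) by blast
    next
      case True
      obtain N' where N: "N = Suc N'" using Suc.prems(1) by (cases N) auto
      have "(\<Sum>n\<le>N'. scale (c (Suc n)) (conv_power n x)) = 0" for x
        using shift[OF Suc.prems(3), of x] True by (simp only: N sum.atMost_Suc_shift conv_power_antipode) (simp add: zero_fun_apply)
      then show ?thesis
        using Suc.IH[of N' "\<lambda>n. c (Suc n)"] Suc.prems N by simp
    qed
  qed
  from this[of i N c, OF rel(1,2)] show thesis
    using fun_cong[OF rel(3)] that by (auto simp: sum_fun_apply zero_fun_apply)
qed

text \<open>In finite dimension \<open>S\<close> is a combination of convolution powers of the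
  identity, and these map a subalgebra that is also a subcoalgebra into itself.\<close>

lemma antipode_closed:
  assumes M: "subalgebra M" "subcoalgebra M"
  shows "S ` M \<subseteq> M"
proof -
  have sM: "subspace M" using M by (simp add: subalgebra_def)
  have "conv_power n x \<in> M" if "x \<in> M" for n x
    using that
  proof (induction n arbitrary: x)
    case 0
    then show ?case
      using M by (auto simp: conv_unit_def subalgebra_def intro: subspace_scale)
  next
    case (Suc n)
    have "\<Delta> x \<in> tensor_power scale 2 M"
      using M(2) Suc.prems by (auto simp: subcoalgebra_def)
    then have "contract (\<lambda>a b. conv_power n a * (\<lambda>x. x) b) (\<Delta> x) \<in> M"
      by (rule contract_in[OF _ sM bilinear_mult[OF conv_power_endo linear_ident] sM])
        (use M Suc.IH in \<open>auto simp: subalgebra_def\<close>)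
    then show ?case by (simp add: convolution_def)
  qed
  moreover obtain d :: "nat \<Rightarrow> 'k" and N where "\<And>x. S x = (\<Sum>n<N. scale (d n) (conv_power n x))"
    using antipode_conv_power by blast
  ultimately show ?thesis
    using sM by (auto intro!: subspace_sum subspace_scale)
qed

end

section \<open>The algebra of tensors of degree two\<close>

locale comm_fd_hopf = fd_hopf scale \<Delta> \<epsilon> S Basis
  for scale :: "'k::field \<Rightarrow> 'a::comm_ring_1 \<Rightarrow> 'a"
    and \<Delta> :: "'a \<Rightarrow> ('k, 'a) tensor"
    and \<epsilon> :: "'a \<Rightarrow> 'k" and S :: "'a \<Rightarrow> 'a" and Basis
begin

abbreviation tensor2 :: "'a \<Rightarrow> 'a \<Rightarrow> ('k, 'a) tensor"  (infixr \<open>\<otimes>\<close> 75)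
  where "a \<otimes> b \<equiv> pure_tensor scale [a, b]"

abbreviation times2 :: "('k, 'a) tensor \<Rightarrow> ('k, 'a) tensor \<Rightarrow> ('k, 'a) tensor"  (infixl \<open>\<bullet>\<close> 70)
  where "times2 \<equiv> tensor_mult scale"

abbreviation T2 :: "('k, 'a) tensor set"
  where "T2 \<equiv> tensor_power scale 2 UNIV"

section \<open>The commutative algebra structure of the tensor square\<close>

lemma times2_pure: "(a \<otimes> b) \<bullet> (c \<otimes> d) = (a * c) \<otimes> (b * d)"
  by (subst tensor_mult_pure) (simp_all add: field_algebra_axioms)

lemma times2_add_left: "(s + t) \<bullet> r = s \<bullet> r + t \<bullet> r"
  and times2_scale_left: "tensor_scale k s \<bullet> r = tensor_scale k (s \<bullet> r)"
  and times2_zero_left: "0 \<bullet> r = 0"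
  by (simp_all add: tensor_mult_def tensor_lift_add tensor_lift_scale tensor_lift_zero)

text \<open>For a genuine tensor \<open>t\<close> the inner lift in \<open>tensor_mult\<close> is
  multilinear in the left factor. What remains is a single lift of \<open>t\<close>, from which
  additivity in the right factor can be read off.\<close>

lemma times2_pure_left:
  assumes "t \<in> T2"
  shows "(a \<otimes> b) \<bullet> t = tensor_lift (\<lambda>ys. if length ys = 2 then pure_tensor scale (map2 (*) [a, b] ys) else 0) t"
proof -
  have lin0: "Vector_Spaces.linear scale tensor_scale (\<lambda>_. 0)"
    by (auto simp: Vector_Spaces.linear_iff vector_space_axioms vector_space_tensor_scale)
  let ?F = "\<lambda>t xs. tensor_lift (\<lambda>ys. if length xs = length ys then pure_tensor scale (map2 (*) xs ys) else 0) t"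
  have pure: "?F (c \<otimes> d) xs = (if length xs = 2 then pure_tensor scale (map2 (*) xs [c, d]) else 0)" for xs c d
  proof -
    have "multilinear scale tensor_scale (\<lambda>ys. if length xs = length ys then pure_tensor scale (map2 (*) xs ys) else 0)"
      unfolding multilinear_def
    proof (intro allI)
      fix us vs
      show "Vector_Spaces.linear scale tensor_scale (\<lambda>a. if length xs = length (us @ a # vs) then pure_tensor scale (map2 (*) xs (us @ a # vs)) else 0)"
      proof (cases "length xs = length us + Suc (length vs)")
        case False then show ?thesis using lin0 by simp
      next
        case True
        then obtain xs1 b xs2 where "xs = xs1 @ b # xs2" "length xs1 = length us"
          by (metis id_take_nth_drop length_take less_add_Suc1 add_Suc_right min.absorb4)
        then show ?thesis using True
          using Vector_Spaces.linear_compose[OF _ pure_tensor_linear, of scale "\<lambda>a. b * a"]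
          by (auto simp: o_def Vector_Spaces.linear_iff vector_space_axioms distrib_left scale_mult_right)
      qed
    qed
    from tensor_lift_pure[OF this] show ?thesis by simp
  qed
  have "multilinear scale tensor_scale (?F t)"
    using assms subspace_UNIV
  proof (induction rule: tensor_power_2_induct)
    case zero
    show ?case
      unfolding tensor_lift_zero multilinear_def using lin0 by blast
  next
    case (add c d t)
    have "multilinear scale tensor_scale (?F (c \<otimes> d))"
      unfolding multilinear_def
    proof (intro allI)
      fix us vs :: "'a list"
      consider v where "us = []" "vs = [v]" | u where "us = [u]" "vs = []" | "length us + length vs \<noteq> 1"
        by (cases us; cases vs) auto
      then show "Vector_Spaces.linear scale tensor_scale (\<lambda>a. ?F (c \<otimes> d) (us @ a # vs))"
      proof cases
        case 3
        then show ?thesis unfolding pure using lin0 by simp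
      qed (unfold pure, auto simp: Vector_Spaces.linear_iff vector_space_axioms vector_space_tensor_scale distrib_right
          pure_tensor_pair scale_mult_left[symmetric])
    qed
    then show ?case
      using add.IH unfolding multilinear_def tensor_lift_add
      by (simp add: Vector_Spaces.linear_iff tensor.scale_right_distrib algebra_simps)
  qed
  then have "(a \<otimes> b) \<bullet> t = ?F t [a, b]"
    by (simp only: tensor_mult_def tensor_lift_pure)
  then show ?thesis by (simp add: numeral_2_eq_2 eq_commute[of "Suc (Suc 0)"])
qed

lemma times2_add_right:
  assumes "s \<in> T2" "t \<in> T2" "r \<in> T2"
  shows "s \<bullet> (t + r) = s \<bullet> t + s \<bullet> r"
  using assms(1) subspace_UNIV
proof (induction rule: tensor_power_2_induct)
  case zero
  show ?case by (simp only: times2_zero_left add_0_left)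
next
  case (add a b s)
  have "(a \<otimes> b) \<bullet> (t + r) = (a \<otimes> b) \<bullet> t + (a \<otimes> b) \<bullet> r"
    by (simp only: times2_pure_left[OF assms(2)] times2_pure_left[OF assms(3)]
        times2_pure_left[OF tensor_power_add[OF assms(2,3)]] tensor_lift_add)
  with add.IH show ?case by (simp only: times2_add_left ac_simps)
qed

lemma times2_zero_right: "s \<in> T2 \<Longrightarrow> s \<bullet> 0 = 0"
  using times2_add_right[of s 0 0] tensor_power_0[of 2 UNIV] by simp

lemma times2_closed:
  assumes A: "subalgebra A" and s: "s \<in> tensor_power scale 2 A" and t: "t \<in> tensor_power scale 2 A"
  shows "s \<bullet> t \<in> tensor_power scale 2 A"
proof -
  have sA: "subspace A" using A by (simp add: subalgebra_def)
  have *: "(a \<otimes> b) \<bullet> t \<in> tensor_power scale 2 A" if ab: "a \<in> A" "b \<in> A" for a b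
    using t sA
  proof (induction rule: tensor_power_2_induct)
    case zero
    have "(a \<otimes> b) \<bullet> 0 = 0" by (intro times2_zero_right tensor_power_pure) auto
    then show ?case by (simp only: tensor_power_0)
  next
    case (add c d t)
    have "(a \<otimes> b) \<bullet> (c \<otimes> d + t) = (a * c) \<otimes> (b * d) + (a \<otimes> b) \<bullet> t"
      using add.hyps by (subst times2_add_right) (auto intro: tensor_power_pure tensor_power_UNIV simp: times2_pure)
    moreover have "(a * c) \<otimes> (b * d) \<in> tensor_power scale 2 A"
      using A ab add.hyps by (intro tensor_power_pure) (auto simp: subalgebra_def)
    ultimately show ?case using add.IH by (simp only: tensor_power_add)
  qed
  show ?thesis
    using s sA
  proof (induction rule: tensor_power_2_induct)
    case zero
    show ?case by (simp only: times2_zero_left tensor_power_0)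
  next
    case (add a b s)
    then show ?case by (simp only: times2_add_left tensor_power_add *)
  qed
qed

lemma subalgebra_UNIV: "subalgebra UNIV"
  by (simp add: subalgebra_def)

lemmas times2_T2 = times2_closed[OF subalgebra_UNIV]

lemma pure_T2: "a \<otimes> b \<in> T2"
  by (simp add: tensor_power_pure)

lemma times2_commute:
  assumes s: "s \<in> T2" and t: "t \<in> T2"
  shows "s \<bullet> t = t \<bullet> s"
proof -
  have *: "(a \<otimes> b) \<bullet> t = t \<bullet> (a \<otimes> b)" for a b
    using t subspace_UNIV
  proof (induction rule: tensor_power_2_induct)
    case zero
    show ?case by (simp only: times2_zero_left times2_zero_right pure_T2)
  next
    case (add c d t)
    then show ?case
      by (simp only: times2_add_left times2_add_right pure_T2 times2_pure mult.commute)
  qed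
  show ?thesis
    using s subspace_UNIV
  proof (induction rule: tensor_power_2_induct)
    case zero
    show ?case by (simp only: times2_zero_left times2_zero_right t)
  next
    case (add a b s)
    then show ?case by (simp only: times2_add_left times2_add_right pure_T2 t *)
  qed
qed

lemma times2_assoc:
  assumes s: "s \<in> T2" and t: "t \<in> T2" and r: "r \<in> T2"
  shows "s \<bullet> t \<bullet> r = s \<bullet> (t \<bullet> r)"
proof -
  have 1: "(a \<otimes> b) \<bullet> (c \<otimes> d) \<bullet> r = (a \<otimes> b) \<bullet> ((c \<otimes> d) \<bullet> r)" for a b c d
    using r subspace_UNIV
  proof (induction rule: tensor_power_2_induct)
    case zero
    show ?case by (simp only: times2_zero_left times2_zero_right pure_T2 times2_T2)
  next
    case (add x y r)
    then show ?case
      by (simp only: times2_add_left times2_add_right pure_T2 times2_T2 times2_pure mult.assoc)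
  qed
  have 2: "(a \<otimes> b) \<bullet> t \<bullet> r = (a \<otimes> b) \<bullet> (t \<bullet> r)" for a b
    using t subspace_UNIV
  proof (induction rule: tensor_power_2_induct)
    case zero
    show ?case by (simp only: times2_zero_left times2_zero_right pure_T2)
  next
    case (add c d t)
    then show ?case
      by (simp only: times2_add_left times2_add_right pure_T2 times2_T2 r 1)
  qed
  show ?thesis
    using s subspace_UNIV
  proof (induction rule: tensor_power_2_induct)
    case zero
    show ?case by (simp only: times2_zero_left)
  next
    case (add a b s)
    then show ?case by (simp only: times2_add_left 2)
  qed
qed

lemma times2_scale_right:
  assumes "s \<in> T2" "t \<in> T2"
  shows "s \<bullet> tensor_scale k t = tensor_scale k (s \<bullet> t)"
  using times2_commute[OF assms(1) tensor_power_scale[OF assms(2)]] times2_commute[OF assms]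
  by (simp only: times2_scale_left)

lemma times2_one:
  assumes "t \<in> T2"
  shows "(1 \<otimes> 1) \<bullet> t = t"
  using assms subspace_UNIV
proof (induction rule: tensor_power_2_induct)
  case zero
  show ?case by (simp only: times2_zero_right pure_T2)
next
  case (add a b t)
  then show ?case by (simp only: times2_add_right pure_T2 times2_pure mult_1)
qed

lemma times2_sum_right:
  assumes "s \<in> T2" "\<And>i. i \<in> I \<Longrightarrow> x i \<in> T2"
  shows "s \<bullet> (\<Sum>i\<in>I. x i) = (\<Sum>i\<in>I. s \<bullet> x i)"
  using assms
proof (induction I rule: infinite_finite_induct)
  case (insert i I)
  have "sum x I \<in> T2" using insert.prems by (intro tensor_power_sum) auto
  then show ?case using insert by (simp add: times2_add_right)
qed (auto simp: times2_zero_right)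

section \<open>Powers and the Frobenius map on the tensor square\<close>

fun power2 :: "('k, 'a) tensor \<Rightarrow> nat \<Rightarrow> ('k, 'a) tensor"
  where "power2 t 0 = 1 \<otimes> 1"
  | "power2 t (Suc n) = t \<bullet> power2 t n"

lemma power2_T2: "t \<in> T2 \<Longrightarrow> power2 t n \<in> T2"
  by (induction n) (simp_all add: pure_T2 times2_T2)

lemma power2_pure: "power2 (a \<otimes> b) n = (a ^ n) \<otimes> (b ^ n)"
  by (induction n) (simp_all add: times2_pure)

lemma power2_scale: "t \<in> T2 \<Longrightarrow> power2 (tensor_scale c t) n = tensor_scale (c ^ n) (power2 t n)"
  by (induction n) (simp_all add: times2_scale_left times2_scale_right power2_T2 tensor_power_scale mult.commute)

lemma comult_power: "\<Delta> (x ^ n) = power2 (\<Delta> x) n"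
  by (induction n) (simp_all add: comult_one comult_mult)

text \<open>The tensor square is a subset of a function type and not a ring type, so the binomial
  theorem is derived directly from Pascal's rule.\<close>

lemma power2_binomial:
  assumes s: "s \<in> T2" and t: "t \<in> T2"
  shows "power2 (s + t) n = (\<Sum>k\<le>n. tensor_scale (of_nat (n choose k)) (power2 s k \<bullet> power2 t (n - k)))"
proof (induction n)
  case 0
  show ?case by (simp add: times2_pure)
next
  case (Suc n)
  define a where "a k = power2 s k \<bullet> power2 t (Suc n - k)" for k
  have a: "a k \<in> T2" for k
    by (simp add: a_def times2_T2 power2_T2 s t)
  have m: "tensor_scale (of_nat (n choose k)) (power2 s k \<bullet> power2 t (n - k)) \<in> T2" for k
    by (simp add: times2_T2 power2_T2 tensor_power_scale s t)
  have 1: "s \<bullet> tensor_scale c (power2 s k \<bullet> power2 t (n - k)) = tensor_scale c (a (Suc k))" for c k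
    by (simp add: a_def times2_scale_right times2_T2 power2_T2 s t times2_assoc)
  have 2: "t \<bullet> tensor_scale c (power2 s k \<bullet> power2 t (n - k)) = tensor_scale c (a k)" if "k \<le> n" for c k
  proof -
    have "t \<bullet> (power2 s k \<bullet> power2 t (n - k)) = power2 s k \<bullet> (t \<bullet> power2 t (n - k))"
      using times2_commute[OF t power2_T2[OF s, of k]]
      by (simp add: times2_assoc[symmetric] power2_T2 s t)
    with that show ?thesis
      by (simp add: a_def times2_scale_right times2_T2 power2_T2 s t Suc_diff_le)
  qed
  have "power2 (s + t) (Suc n) =
      (\<Sum>k\<le>n. tensor_scale (of_nat (n choose k)) (a (Suc k))) + (\<Sum>k\<le>n. tensor_scale (of_nat (n choose k)) (a k))"
    by (simp add: Suc.IH times2_add_left times2_sum_right s t m 1 2)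
  \<comment> \<open>The term of index \<open>Suc n\<close> has coefficient 0; including it allows
    the index shift.\<close>
  also have "(\<Sum>k\<le>n. tensor_scale (of_nat (n choose k)) (a k)) =
      a 0 + (\<Sum>k\<le>n. tensor_scale (of_nat (n choose Suc k)) (a (Suc k)))"
    using sum.atMost_Suc_shift[of "\<lambda>k. tensor_scale (of_nat (n choose k)) (a k)" n]
    by (simp add: binomial_eq_0)
  also have "(\<Sum>k\<le>n. tensor_scale (of_nat (n choose k)) (a (Suc k))) + (a 0 + (\<Sum>k\<le>n. tensor_scale (of_nat (n choose Suc k)) (a (Suc k))))
      = a 0 + (\<Sum>k\<le>n. tensor_scale (of_nat (Suc n choose Suc k)) (a (Suc k)))"
    by (simp add: sum.distrib[symmetric] tensor.scale_left_distrib algebra_simps)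
  also have "\<dots> = (\<Sum>k\<le>Suc n. tensor_scale (of_nat (Suc n choose k)) (a k))"
    by (subst sum.atMost_Suc_shift) simp
  finally show ?case by (simp only: a_def)
qed

context
  fixes p
  assumes p: "prime p" "CHAR('k) = p"
begin

text \<open>All binomial coefficients except the two outer ones vanish modulo
  \<open>p\<close>.\<close>

lemma power2_frobenius_add:
  assumes s: "s \<in> T2" and t: "t \<in> T2"
  shows "power2 (s + t) p = power2 s p + power2 t p"
proof -
  have p0: "p > 0" using p(1) prime_gt_0_nat by blast
  have "(of_nat (p choose k) :: 'k) = 0" if "k \<noteq> 0" "k \<noteq> p" for k
  proof -
    have "p dvd (p choose k)"
      using that dvd_choose_prime[of k p] p(1) by (cases "k < p") (auto simp: binomial_eq_0)
    then show ?thesis using p(2) by (simp add: of_nat_eq_0_iff_char_dvd)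
  qed
  then have "power2 (s + t) p = (\<Sum>k\<in>{0, p}. tensor_scale (of_nat (p choose k)) (power2 s k \<bullet> power2 t (p - k)))"
    unfolding power2_binomial[OF s t] using p0
    by (intro sum.mono_neutral_right) auto
  also have "\<dots> = power2 s p + power2 t p"
    using p0 times2_commute[OF power2_T2[OF s] pure_T2, of p 1 1]
    by (simp add: times2_one power2_T2 s t add.commute)
  finally show ?thesis .
qed

lemma power2_frobenius_zero: "power2 0 p = 0"
  using prime_gt_0_nat[OF p(1)] by (cases p) (simp_all add: times2_zero_left)

lemma power2_frobenius_sum:
  assumes "\<And>i. i \<in> I \<Longrightarrow> x i \<in> T2"
  shows "power2 (\<Sum>i\<in>I. x i) p = (\<Sum>i\<in>I. power2 (x i) p)"
  using assms
proof (induction I rule: infinite_finite_induct)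
  case (insert i I)
  have "sum x I \<in> T2" using insert.prems by (intro tensor_power_sum) auto
  then show ?case using insert by (simp add: power2_frobenius_add)
qed (auto simp: power2_frobenius_zero)

text \<open>On the tensor square the map to the power \<open>p\<close> is additive and fixes pure
  tensors of idempotents, so each application only raises the coefficients of the cocycle to the
  power \<open>p\<close>.\<close>

lemma comult_frobenius_power:
  assumes \<Delta>z: "\<Delta> z = z \<otimes> 1 + 1 \<otimes> z + (\<Sum>i\<in>I. tensor_scale (c i) (x i \<otimes> y i))"
    and idem: "\<And>i. x i * x i = x i" "\<And>i. y i * y i = y i"
  shows "\<Delta> (z ^ p ^ n) = (z ^ p ^ n) \<otimes> 1 + 1 \<otimes> (z ^ p ^ n) + (\<Sum>i\<in>I. tensor_scale (c i ^ p ^ n) (x i \<otimes> y i))"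
proof (induction n)
  case 0
  show ?case using \<Delta>z by simp
next
  case (Suc n)
  have pow: "e ^ p = e" if "e * e = e" for e :: 'a
  proof -
    have "e ^ Suc m = e" for m using that by (induction m) auto
    then show ?thesis using prime_gt_0_nat[OF p(1)] by (cases p) auto
  qed
  let ?y = "z ^ p ^ n" and ?u = "\<Sum>i\<in>I. tensor_scale (c i ^ p ^ n) (x i \<otimes> y i)"
  have u: "?u \<in> T2" by (intro tensor_power_sum tensor_power_scale pure_T2)
  have "\<Delta> (z ^ p ^ Suc n) = power2 (\<Delta> ?y) p"
    by (simp add: comult_power[symmetric] power_mult[symmetric] mult.commute)
  also have "\<dots> = power2 (?y \<otimes> 1) p + power2 (1 \<otimes> ?y) p + power2 ?u p"
    unfolding Suc.IH by (simp add: power2_frobenius_add tensor_power_add pure_T2 u)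
  also have "power2 ?u p = (\<Sum>i\<in>I. power2 (tensor_scale (c i ^ p ^ n) (x i \<otimes> y i)) p)"
    by (intro power2_frobenius_sum tensor_power_scale pure_T2)
  also have "\<dots> = (\<Sum>i\<in>I. tensor_scale (c i ^ p ^ Suc n) (x i \<otimes> y i))"
    by (simp add: power2_scale pure_T2 power2_pure pow idem power_mult[symmetric] mult.commute)
  also have "power2 (?y \<otimes> 1) p = (z ^ p ^ Suc n) \<otimes> 1"
    by (simp add: power2_pure power_mult[symmetric] mult.commute)
  also have "power2 (1 \<otimes> ?y) p = 1 \<otimes> (z ^ p ^ Suc n)"
    by (simp add: power2_pure power_mult[symmetric] mult.commute)
  finally show ?case .
qed

end

section \<open>Adjoining an almost primitive element to a Hopf subalgebra\<close>

lemma subalgebra_hull: "subalgebra (subalgebra hull X)"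
  by (rule hull_in) (auto simp: subalgebra_def subspace_def)

text \<open>The elements whose coproduct lies in the tensor square of the hull form a subalgebra
  containing \<open>z\<close> and \<open>U\<close>, so the hull is a subcoalgebra;
  \<open>antipode_closed\<close> then gives stability under \<open>S\<close>.\<close>

lemma hull_hopf_subalgebra:
  assumes U: "hopf_subalgebra U"
    and \<Delta>z: "\<Delta> z = z \<otimes> 1 + 1 \<otimes> z + u" "u \<in> tensor_power scale 2 U"
  shows "hopf_subalgebra (subalgebra hull (insert z U))"
proof -
  let ?M = "subalgebra hull (insert z U)"
  have sub: "insert z U \<subseteq> ?M" by (rule hull_subset)
  have M1: "1 \<in> ?M" and sM: "subspace ?M" using subalgebra_hull by (auto simp: subalgebra_def)
  have mono: "tensor_power scale 2 U \<subseteq> tensor_power scale 2 ?M"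
    using sub by (intro tensor_power_mono) auto
  have "subalgebra {x. \<Delta> x \<in> tensor_power scale 2 ?M}"
  proof -
    have "1 \<otimes> 1 \<in> tensor_power scale 2 ?M"
      using M1 by (intro tensor_power_pure) auto
    then show ?thesis
      unfolding subalgebra_def[of "{x. _ x}"] subspace_def mem_Collect_eq
      by (auto simp only: comult_hom comult_one comult_mult tensor_power_add tensor_power_scale tensor_power_0
          intro!: times2_closed[OF subalgebra_hull])
  qed
  moreover have "insert z U \<subseteq> {x. \<Delta> x \<in> tensor_power scale 2 ?M}"
  proof -
    have "z \<otimes> 1 \<in> tensor_power scale 2 ?M" "1 \<otimes> z \<in> tensor_power scale 2 ?M"
      using sub M1 by (auto intro!: tensor_power_pure)
    then have "\<Delta> z \<in> tensor_power scale 2 ?M"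
      unfolding \<Delta>z(1) using \<Delta>z(2) mono by (intro tensor_power_add) auto
    then show ?thesis
      using U mono by (auto simp: hopf_subalgebra_def subcoalgebra_def)
  qed
  ultimately have "?M \<subseteq> {x. \<Delta> x \<in> tensor_power scale 2 ?M}"
    by (intro hull_minimal)
  then have "subcoalgebra ?M"
    using sM by (auto simp: subcoalgebra_def)
  then show ?thesis
    unfolding hopf_subalgebra_def using antipode_closed[OF subalgebra_hull] subalgebra_hull by blast
qed

end

section \<open>Extensions of the dual of a group algebra\<close>

text \<open>The elements \<open>e g\<close> are the basis dual to the group elements.\<close>

locale dual_group_extension = comm_fd_hopf scale \<Delta> \<epsilon> S Basis
  for scale :: "'k::field \<Rightarrow> 'a::comm_ring_1 \<Rightarrow> 'a"
    and \<Delta> :: "'a \<Rightarrow> ('k, 'a) tensor"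
    and \<epsilon> :: "'a \<Rightarrow> 'k" and S :: "'a \<Rightarrow> 'a" and Basis +
  fixes e :: "'g::{group_add,finite} \<Rightarrow> 'a"
  assumes e_mult: "e g * e h = (if g = h then e g else 0)"
    and e_sum: "(\<Sum>g\<in>UNIV. e g) = 1"
    and e_nonzero: "e g \<noteq> 0"
    and comult_e: "\<Delta> (\<Sum>g\<in>UNIV. scale (c g) (e g)) =
      (\<Sum>g\<in>UNIV. \<Sum>h\<in>UNIV. tensor_scale (c (g + h)) (e g \<otimes> e h))"
begin

section \<open>Functions on the group and on its square, as elements and 2-tensors\<close>

definition elt :: "('g \<Rightarrow> 'k) \<Rightarrow> 'a"
  where "elt c = (\<Sum>g\<in>UNIV. scale (c g) (e g))"

definition elt2 :: "('g \<times> 'g \<Rightarrow> 'k) \<Rightarrow> ('k, 'a) tensor"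
  where "elt2 v = (\<Sum>i\<in>UNIV. tensor_scale (v i) (e (fst i) \<otimes> e (snd i)))"

lemma elt2_add: "elt2 v + elt2 w = elt2 (\<lambda>i. v i + w i)"
  by (simp add: elt2_def sum.distrib tensor.scale_left_distrib)

lemma elt2_diff: "elt2 v - elt2 w = elt2 (\<lambda>i. v i - w i)"
  by (simp add: elt2_def sum_subtractf tensor.scale_left_diff_distrib)

lemma elt_tensor_elt: "elt a \<otimes> elt b = elt2 (\<lambda>i. a (fst i) * b (snd i))"
proof -
  have "elt a \<otimes> elt b = (\<Sum>g\<in>UNIV. \<Sum>h\<in>UNIV. tensor_scale (a g * b h) (e g \<otimes> e h))"
    unfolding elt_def
    by (subst pure_tensor_pair_sum(1))
      (simp add: pure_tensor_pair_sum(2) pure_tensor_pair tensor.scale_sum_right mult.commute)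
  then show ?thesis
    by (simp add: elt2_def sum.cartesian_product case_prod_unfold)
qed

lemma elt_one: "elt (\<lambda>g. 1) = 1"
  by (simp add: elt_def e_sum)

lemma comult_elt: "\<Delta> (elt a) = elt2 (\<lambda>i. a (fst i + snd i))"
  by (simp add: elt_def comult_e elt2_def sum.cartesian_product case_prod_unfold)

text \<open>The right side is, up to sign, the coboundary of the function \<open>a\<close> on the
  group.\<close>

lemma comult_elt_diff: "\<Delta> (elt a) - elt a \<otimes> 1 - 1 \<otimes> elt a = elt2 (\<lambda>i. a (fst i + snd i) - a (fst i) - a (snd i))"
  using elt_tensor_elt[of a "\<lambda>g. 1"] elt_tensor_elt[of "\<lambda>g. 1" a]
  by (simp add: elt_one comult_elt elt2_diff)

text \<open>Coefficients are read off by functionals dual to the \<open>e g\<close>. The annihilator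
  of \<open>e g\<close> contains all other \<open>e h\<close> by orthogonality, but not the nonzero
  idempotent \<open>e g\<close>; a functional vanishing on it with value 1 at \<open>e g\<close> is
  dual.\<close>

lemma elt2_inject:
  assumes "elt2 v = elt2 w"
  shows "v = w"
proof
  fix i :: "'g \<times> 'g"
  have "\<exists>d. functional d \<and> (\<forall>h. d (e h) = (if h = g then 1 else 0))" for g
  proof -
    have sub: "subspace {x. x * e g = 0}"
      by (auto simp: subspace_def distrib_right scale_mult_left[symmetric])
    have nin: "e g \<notin> {x. x * e g = 0}"
      by (simp add: e_mult e_nonzero)
    obtain d where "functional d" "\<And>y. y \<in> {x. x * e g = 0} \<Longrightarrow> d y = 0" "d (e g) = 1"
      by (rule ex_functional[OF sub nin]) (rule that)
    then show ?thesis by (intro exI[of _ d]) (auto simp: e_mult)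
  qed
  then obtain d d' where d: "functional d" "\<And>h. d (e h) = (if h = fst i then 1 else 0)"
    "functional d'" "\<And>h. d' (e h) = (if h = snd i then 1 else 0)" by metis
  have eval: "tensor_eval d d' (elt2 u) = u i" for u
  proof -
    have "tensor_eval d d' (elt2 u) = (\<Sum>j\<in>UNIV. if j = i then u j else 0)"
      unfolding elt2_def tensor_eval_sum
      by (intro sum.cong refl) (auto simp: tensor_eval_scale tensor_eval_pure[OF d(1,3)] d(2,4) prod_eq_iff)
    then show ?thesis by simp
  qed
  show "v i = w i" using eval[of v] eval[of w] assms by simp
qed

lemma elt_subspace: "subspace (range elt)"
proof (rule subspaceI)
  have "elt (\<lambda>_. 0) = 0" by (simp add: elt_def)
  then show "0 \<in> range elt" by (metis rangeI)
  fix x y c assume "x \<in> range elt" "y \<in> range elt"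
  then obtain a b where ab: "x = elt a" "y = elt b" by blast
  have "x + y = elt (\<lambda>g. a g + b g)" "scale c x = elt (\<lambda>g. c * a g)"
    by (simp_all add: ab elt_def scale_left_distrib sum.distrib scale_sum_right)
  then show "x + y \<in> range elt" "scale c x \<in> range elt" by blast+
qed

lemma tensor_power_range_elt:
  assumes "u \<in> tensor_power scale 2 (range elt)"
  shows "u \<in> range elt2"
  using assms elt_subspace
proof (induction rule: tensor_power_2_induct)
  case zero
  have "elt2 (\<lambda>_. 0) = 0" by (simp add: elt2_def)
  then show ?case by (metis rangeI)
next
  case (add a b t)
  then show ?case by (auto simp: elt_tensor_elt elt2_add)
qed

section \<open>Linear relations between Frobenius powers, modulo the functions on the group\<close>

context
  fixes p z v
  assumes p: "prime p" "CHAR('k) = p"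
    and \<Delta>z: "\<Delta> z = z \<otimes> 1 + 1 \<otimes> z + elt2 v"
begin

lemma comult_frobenius_sum:
  fixes c :: "nat \<Rightarrow> 'k" and N :: nat
  defines "y \<equiv> (\<Sum>i\<le>N. scale (c i) (z ^ p ^ i))"
  shows "\<Delta> y - y \<otimes> 1 - 1 \<otimes> y = elt2 (\<lambda>j. \<Sum>i\<le>N. c i * v j ^ p ^ i)"
proof -
  have pw: "\<Delta> (z ^ p ^ i) = (z ^ p ^ i) \<otimes> 1 + 1 \<otimes> (z ^ p ^ i) + elt2 (\<lambda>j. v j ^ p ^ i)" for i
    using comult_frobenius_power[OF p \<Delta>z[unfolded elt2_def]] by (simp add: elt2_def e_mult)
  have sc: "tensor_scale k (elt2 w) = elt2 (\<lambda>j. k * w j)" for k w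
    by (simp add: elt2_def tensor.scale_sum_right)
  have "\<Delta> y = (\<Sum>i\<le>N. tensor_scale (c i) ((z ^ p ^ i) \<otimes> 1 + 1 \<otimes> (z ^ p ^ i) + elt2 (\<lambda>j. v j ^ p ^ i)))"
    unfolding y_def by (simp only: comult_sum comult_hom pw)
  also have "\<dots> = y \<otimes> 1 + 1 \<otimes> y + (\<Sum>i\<le>N. elt2 (\<lambda>j. c i * v j ^ p ^ i))"
    by (simp add: y_def pure_tensor_pair_sum pure_tensor_pair tensor.scale_right_distrib sum.distrib sc)
  also have "(\<Sum>i\<le>N. elt2 (\<lambda>j. c i * v j ^ p ^ i)) = elt2 (\<lambda>j. \<Sum>i\<le>N. c i * v j ^ p ^ i)"
    by (induction N) (simp_all add: elt2_add)
  finally show ?thesis by (simp add: algebra_simps)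
qed

text \<open>Comparing cocycles turns the relation into an identity of functions on pairs of group
  elements, with a coboundary on one side. Applying the additive map \<open>\<rho>\<close> to the
  values keeps the coboundary and lowers the exponents; the lowered combination then differs from an
  element of \<open>range elt\<close> by a primitive one.\<close>

lemma frobenius_relation:
  fixes c :: "nat \<Rightarrow> 'k"
  assumes prim: "\<And>x. primitive x \<Longrightarrow> x \<in> range elt"
    and r: "r \<le> N" "c r \<noteq> 0" "\<And>i. i < r \<Longrightarrow> c i = 0"
    and rel: "(\<Sum>i\<le>N. scale (c i) (z ^ p ^ i)) \<in> range elt"
  obtains \<mu> :: "nat \<Rightarrow> 'k" where "\<mu> 0 = 1" "(\<Sum>i\<le>N - r. scale (\<mu> i) (z ^ p ^ i)) \<in> range elt"
proof -
  obtain a where a: "(\<Sum>i\<le>N. scale (c i) (z ^ p ^ i)) = elt a" using rel by blast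
  obtain \<rho> :: "'k \<Rightarrow> 'k" where \<rho>: "\<And>x y. \<rho> (x + y) = \<rho> x + \<rho> y"
    "\<And>c x. \<rho> (c ^ (p ^ r) * x) = c * \<rho> x" "\<rho> (c r) = 1"
    using ex_frobenius_functional[OF p r(2), of r] by blast
  have \<rho>0: "\<rho> 0 = 0" using \<rho>(2)[of 0 0] \<rho>(2)[of 0 1] p(1) by (simp add: prime_gt_0_nat)
  have \<rho>sum: "\<rho> (sum f I) = (\<Sum>i\<in>I. \<rho> (f i))" for f :: "nat \<Rightarrow> 'k" and I
    by (induction I rule: infinite_finite_induct) (simp_all add: \<rho> \<rho>0)
  have \<rho>diff: "\<rho> (x - y) = \<rho> x - \<rho> y" for x y
    using \<rho>(1)[of "x - y" y] by simp
  \<comment> \<open>\<open>\<mu> 0\<close> is 1 because \<open>\<rho>\<close> is normalised at the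
    lowest nonzero coefficient \<open>c r\<close>.\<close>
  define \<mu> where "\<mu> i = \<rho> (c (i + r))" for i
  define y where "y = (\<Sum>i\<le>N - r. scale (\<mu> i) (z ^ p ^ i))"
  have "elt2 (\<lambda>j. \<Sum>i\<le>N. c i * v j ^ p ^ i) = elt2 (\<lambda>j. a (fst j + snd j) - a (fst j) - a (snd j))"
    using comult_frobenius_sum[of c N] unfolding a comult_elt_diff by simp
  then have eq: "(\<Sum>i\<le>N. c i * v j ^ p ^ i) = a (fst j + snd j) - a (fst j) - a (snd j)" for j
    by (rule fun_cong[OF elt2_inject])
  \<comment> \<open>No index below \<open>r\<close> contributes, so each exponent
    \<open>p ^ i\<close> splits off the factor \<open>p ^ r\<close> that \<open>\<rho>\<close>
    removes.\<close>
  have shift: "(\<Sum>i\<le>N. c i * v j ^ p ^ i) = (\<Sum>i\<le>N - r. (v j ^ p ^ i) ^ p ^ r * c (i + r))" for j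
  proof -
    have "(\<Sum>i\<le>N. c i * v j ^ p ^ i) = (\<Sum>i=r..N. c i * v j ^ p ^ i)"
      by (intro sum.mono_neutral_right) (auto simp: r)
    also have "\<dots> = (\<Sum>i=0 + r..N - r + r. c i * v j ^ p ^ i)" using r(1) by simp
    also have "\<dots> = (\<Sum>i\<le>N - r. c (i + r) * v j ^ p ^ (i + r))"
      by (simp only: sum.shift_bounds_cl_nat_ivl atLeast0AtMost)
    finally show ?thesis by (simp add: power_add power_mult mult.commute)
  qed
  have "(\<Sum>i\<le>N - r. v j ^ p ^ i * \<mu> i) = \<rho> (a (fst j + snd j)) - \<rho> (a (fst j)) - \<rho> (a (snd j))" for j
    using arg_cong[OF eq[of j, unfolded shift], of \<rho>]
    by (simp only: \<rho>sum \<rho>diff \<rho>(2) \<mu>_def)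
  then have "(\<Sum>i\<le>N - r. \<mu> i * v j ^ p ^ i) = \<rho> (a (fst j + snd j)) - \<rho> (a (fst j)) - \<rho> (a (snd j))" for j
    by (simp only: mult.commute[of "\<mu> _"])
  then have eq': "\<Delta> y - y \<otimes> 1 - 1 \<otimes> y = \<Delta> (elt (\<lambda>g. \<rho> (a g))) - elt (\<lambda>g. \<rho> (a g)) \<otimes> 1 - 1 \<otimes> elt (\<lambda>g. \<rho> (a g))"
    unfolding y_def comult_frobenius_sum comult_elt_diff by simp
  have diff: "(x - y) \<otimes> 1 = x \<otimes> 1 - y \<otimes> 1" "1 \<otimes> (x - y) = 1 \<otimes> x - 1 \<otimes> y" for x y
    using pure_tensor_pair(1)[of "x - y" y 1] pure_tensor_pair(2)[of 1 "x - y" y] by (simp_all add: algebra_simps)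
  have "primitive (y - elt (\<lambda>g. \<rho> (a g)))"
    using eq' unfolding primitive_def comult_hom diff by (simp add: algebra_simps)
  then have "(y - elt (\<lambda>g. \<rho> (a g))) + elt (\<lambda>g. \<rho> (a g)) \<in> range elt"
    by (intro subspace_add[OF elt_subspace] prim[of "y - _"]) auto
  then have "y \<in> range elt" by simp
  then show thesis
    using that[of \<mu>] by (simp add: y_def \<mu>_def \<rho>)
qed

end

end

text \<open>The \<open>e g\<close> are the images of the delta functions. Products, sum and
  coproducts are computed in the dual of the group algebra, where \<open>el c\<close> is the
  function \<open>c\<close>, and carried over by \<open>\<phi>\<close>.\<close>

lemma (in comm_fd_hopf) dual_group_extensionI:
  assumes "iso_group_algebra_dual TYPE('g::{group_add,finite}) U"
  obtains e :: "'g::{group_add,finite} \<Rightarrow> 'a" where "dual_group_extension scale \<Delta> \<epsilon> S Basis e"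
    "U = range (dual_group_extension.elt scale e)"
proof -
  obtain \<phi> :: "('g, 'k) ga_dual \<Rightarrow> 'a" where
    hom: "hopf_hom ga_dual_scale ga_dual_comult ga_dual_counit ga_dual_antipode scale \<Delta> \<epsilon> S \<phi>"
    and inj: "inj \<phi>" and U: "range \<phi> = U"
    using assms unfolding iso_group_algebra_dual_def by blast
  have lin: "Vector_Spaces.linear ga_dual_scale scale \<phi>"
    and mult: "\<phi> (x * y) = \<phi> x * \<phi> y" and one: "\<phi> 1 = 1"
    and com: "\<Delta> (\<phi> x) = tensor_map scale \<phi> (ga_dual_comult x)" for x y
    using hom by (auto simp: hopf_hom_def)
  define e where "e g = \<phi> (ga_delta g)" for g
  define el where "el c = (\<Sum>g\<in>UNIV. ga_dual_scale (c g) (ga_delta g))" for c :: "'g \<Rightarrow> 'k"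
  have delta: "ga_dual_apply (ga_delta g :: ('g, 'k) ga_dual) (Poly_Mapping.single h 1) = (if g = h then 1 else 0)" for g h
    by (simp add: ga_delta.rep_eq lookup_single when_def)
  have el: "ga_dual_apply (el c) (Poly_Mapping.single h 1) = c h" for c h
  proof -
    have "ga_dual_apply (el c) (Poly_Mapping.single h 1) = (\<Sum>g\<in>UNIV. if g = h then c g else 0)"
      unfolding el_def ga_dual_apply_sum by (intro sum.cong refl) (simp add: ga_dual_scale.rep_eq delta)
    then show ?thesis by simp
  qed
  have \<phi>el: "\<phi> (el c) = (\<Sum>g\<in>UNIV. scale (c g) (e g))" for c
    by (simp add: el_def e_def linearD[OF lin])
  have "dual_group_extension scale \<Delta> \<epsilon> S Basis e"
  proof (intro dual_group_extension.intro dual_group_extension_axioms.intro)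
    show "comm_fd_hopf scale \<Delta> \<epsilon> S Basis" ..
    show "e g * e h = (if g = h then e g else 0)" for g h
    proof -
      have "ga_delta g * ga_delta h = (if g = h then ga_delta g else (0 :: ('g, 'k) ga_dual))"
        by (rule ga_dual_eqI) (simp add: ga_dual_times_single delta zero_ga_dual.rep_eq)
      then show ?thesis
        unfolding e_def mult[symmetric] by (simp add: linearD(3)[OF lin])
    qed
    have "el (\<lambda>_. 1) = 1"
      by (rule ga_dual_eqI) (simp only: el ga_dual_one_single)
    then show "(\<Sum>g\<in>UNIV. e g) = 1"
      using \<phi>el[of "\<lambda>_. 1"] one by simp
    show "e g \<noteq> 0" for g
    proof
      assume "e g = 0"
      then have "\<phi> (ga_delta g) = \<phi> 0" by (simp add: e_def linearD(3)[OF lin])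
      then have "ga_delta g = (0 :: ('g, 'k) ga_dual)" using inj by (simp add: inj_eq)
      then show False using delta[of g g] by (simp add: zero_ga_dual.rep_eq)
    qed
    show "\<Delta> (\<Sum>g\<in>UNIV. scale (c g) (e g)) = (\<Sum>g\<in>UNIV. \<Sum>h\<in>UNIV. tensor_scale (c (g + h)) (e g \<otimes> e h))" for c
    proof -
      have add: "tensor_map scale \<phi> (s + t) = tensor_map scale \<phi> s + tensor_map scale \<phi> t"
        and sc: "tensor_map scale \<phi> (tensor_scale k s) = tensor_scale k (tensor_map scale \<phi> s)"
        and zero: "tensor_map scale \<phi> 0 = 0" for s t k
        by (simp_all add: tensor_map_def tensor_lift_add tensor_lift_scale tensor_lift_zero)
      have sum: "tensor_map scale \<phi> (\<Sum>i\<in>I. t i) = (\<Sum>i\<in>I. tensor_map scale \<phi> (t i))" for t :: "'g \<Rightarrow> _" and I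
        by (induction I rule: infinite_finite_induct) (simp_all add: add zero)
      show ?thesis
        unfolding \<phi>el[symmetric] com ga_dual_comult_eq
        by (simp add: sum sc tensor_map_pure[OF lin] el e_def)
    qed
  qed
  moreover from this have "U = range (dual_group_extension.elt scale e)"
  proof -
    interpret dual_group_extension scale \<Delta> \<epsilon> S Basis e by fact
    have "f = el (\<lambda>g. ga_dual_apply f (Poly_Mapping.single g 1))" for f
      by (rule ga_dual_eqI) (simp only: el)
    then have "range \<phi> = range (\<lambda>c. \<phi> (el c))" by (metis (no_types, lifting) image_cong image_image surj_def)
    then show ?thesis by (simp add: U[symmetric] \<phi>el elt_def[abs_def])
  qed
  ultimately show thesis using that by blast
qed

section \<open>Semisimple commutative algebras\<close>

locale comm_fd_algebra = field_algebra scale + finite_dimensional_vector_space scale Basis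
  for scale :: "'k::field \<Rightarrow> 'a::comm_ring_1 \<Rightarrow> 'a" and Basis
begin

lemma char_eq: "CHAR('a) = CHAR('k)"
proof -
  have "of_nat n = scale (of_nat n) 1" for n
    by (induction n) (simp_all add: scale_left_distrib)
  then have "(of_nat n = (0 :: 'a)) = (of_nat n = (0 :: 'k))" for n
    by simp
  then show ?thesis
    by (intro CHAR_eqI) (auto simp: of_nat_eq_0_iff_char_dvd[where 'a = 'k])
qed

lemma power_scale: "scale c x ^ n = scale (c ^ n) (x ^ n)"
  by (induction n) (simp_all add: scale_mult_left[symmetric] scale_mult_right[symmetric] mult.commute)

text \<open>
  If the \<open>p\<close>-th powers span, those of a basis form a basis, so the Frobenius map is injective.
\<close>

lemma frobenius_injective:
  fixes x :: 'a
  assumes p: "prime p" "CHAR('k) = p" and span: "span (range (\<lambda>x :: 'a. x ^ p)) = UNIV"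
    and x: "x ^ p = 0"
  shows "x = 0"
proof -
  have expand: "x ^ p = (\<Sum>b\<in>Basis. scale (representation Basis x b ^ p) (b ^ p))" for x
  proof -
    have "x = (\<Sum>b\<in>Basis. scale (representation Basis x b) b)"
      using independent_Basis by (intro sum_representation_eq[symmetric]) (auto simp: span_Basis finite_Basis)
    then have "x ^ p = (\<Sum>b\<in>Basis. scale (representation Basis x b) b) ^ p" by simp
    also have "\<dots> = (\<Sum>b\<in>Basis. scale (representation Basis x b) b ^ p)"
      using p by (intro freshmans_dream_sum) (simp_all add: char_eq)
    finally show ?thesis by (simp add: power_scale)
  qed
  let ?P = "(\<lambda>b. b ^ p) ` Basis"
  have "x ^ p \<in> span ?P" for x
    by (subst expand) (intro span_sum span_scale span_base imageI)
  then have "span (range (\<lambda>x. x ^ p)) \<subseteq> span ?P"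
    by (intro span_minimal) auto
  then have sp: "UNIV \<subseteq> span ?P"
    by (simp only: span)
  have "card Basis = dim UNIV"
    by (simp add: dim_UNIV dimension_def)
  moreover have "dim UNIV \<le> card ?P"
    using sp finite_Basis by (intro span_card_ge_dim) auto
  ultimately have card: "card ?P = card Basis"
    using card_image_le[OF finite_Basis, of "\<lambda>b. b ^ p"] by simp
  have inj: "inj_on (\<lambda>b. b ^ p) Basis"
    by (rule eq_card_imp_inj_on[OF finite_Basis card])
  have ind: "independent ?P"
  proof (rule card_le_dim_spanning[OF subset_UNIV sp])
    show "finite ?P" using finite_Basis by (rule finite_imageI)
    show "card ?P \<le> dim UNIV" unfolding card \<open>card Basis = dim UNIV\<close> ..
  qed
  define u where "u y = representation Basis x (inv_into Basis (\<lambda>b. b ^ p) y) ^ p" for y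
  have "(\<Sum>y\<in>?P. scale (u y) y) = 0"
    using expand[of x] x by (simp add: sum.reindex[OF inj] u_def inv_into_f_f[OF inj])
  then have "u (b ^ p) = 0" if "b \<in> Basis" for b
    using independentD[OF ind _ subset_refl] finite_Basis that by blast
  then have "representation Basis x b = 0" if "b \<in> Basis" for b
    using that by (simp add: u_def inv_into_f_f[OF inj])
  then show ?thesis
    using sum_representation_eq[OF independent_Basis, of x Basis] by (simp add: span_Basis finite_Basis)
qed

text \<open>Finite dimension gives a polynomial relation for \<open>x\<close>; solved for its lowest
  term it reads \<open>x ^ n = x ^ Suc n * y\<close>. Then \<open>x * (1 - x * y)\<close> is
  nilpotent, hence zero.\<close>

lemma ex_von_neumann_inverse:
  fixes x :: 'a
  assumes reduced: "\<And>(x :: 'a) n. x ^ n = 0 \<Longrightarrow> x = 0"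
  shows "\<exists>y. x = x * x * y"
proof -
  have "\<exists>y n. x ^ n = x ^ Suc n * y"
  proof -
    obtain c :: "nat \<Rightarrow> 'k" and N i where rel: "i \<le> N" "c i \<noteq> 0" "(\<Sum>n\<le>N. scale (c n) (x ^ n)) = 0"
      by (rule ex_sequence_relation[of Basis "\<lambda>n. x ^ n"]) (auto simp: finite_Basis span_Basis)
    define r where "r = (LEAST i. c i \<noteq> 0)"
    have r: "c r \<noteq> 0" "r \<le> N" "\<And>j. j < r \<Longrightarrow> c j = 0"
      using rel LeastI[of "\<lambda>i. c i \<noteq> 0" i] Least_le[of "\<lambda>i. c i \<noteq> 0" i] not_less_Least
      unfolding r_def by (force+)
    define w where "w = (\<Sum>n\<in>{Suc r..N}. scale (c n) (x ^ (n - Suc r)))"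
    have "(\<Sum>n\<le>N. scale (c n) (x ^ n)) = (\<Sum>n\<in>{r..N}. scale (c n) (x ^ n))"
      using r by (intro sum.mono_neutral_right) auto
    also have "\<dots> = scale (c r) (x ^ r) + (\<Sum>n\<in>{Suc r..N}. scale (c n) (x ^ n))"
      using r by (simp add: sum.atLeast_Suc_atMost)
    also have "(\<Sum>n\<in>{Suc r..N}. scale (c n) (x ^ n)) = x ^ Suc r * w"
      unfolding w_def sum_distrib_left
      by (intro sum.cong refl) (simp add: scale_mult_right[symmetric] power_add[symmetric] del: power_Suc)
    finally have "scale (c r) (x ^ r) = - (x ^ Suc r * w)"
      using rel(3) by (simp add: eq_neg_iff_add_eq_0)
    then have "scale (inverse (c r)) (scale (c r) (x ^ r)) = x ^ Suc r * scale (- inverse (c r)) w"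
      by (simp add: scale_mult_right[symmetric])
    then have "x ^ r = x ^ Suc r * scale (- inverse (c r)) w"
      using r(1) by simp
    then show ?thesis by blast
  qed
  then obtain y n where "x ^ n = x ^ Suc n * y" by blast
  then have "x ^ n * (1 - x * y) = 0" by (simp add: algebra_simps)
  moreover have "(x * (1 - x * y)) ^ Suc n = x ^ n * (1 - x * y) * (x * (1 - x * y) ^ n)"
    by (simp add: power_mult_distrib ac_simps)
  ultimately have "(x * (1 - x * y)) ^ Suc n = 0" by simp
  then have "x * (1 - x * y) = 0" by (rule reduced)
  then show ?thesis by (auto simp: algebra_simps)
qed

lemma ex_minimal_left_ideal:
  assumes "left_ideal I" "I \<noteq> {0}"
  obtains J where "minimal_left_ideal J" "J \<subseteq> I"
proof -
  define good where "good J \<longleftrightarrow> left_ideal J \<and> J \<noteq> {0} \<and> J \<subseteq> I" for J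
  have "good I" using assms by (simp add: good_def)
  then obtain J where J: "good J" "\<And>K. good K \<Longrightarrow> dim J \<le> dim K"
    using ex_has_least_nat[of good I dim] by blast
  have "K = {0} \<or> K = J" if K: "left_ideal K" "K \<subseteq> J" for K
  proof (cases "K = {0}")
    case False
    then have "good K" using K J(1) by (auto simp: good_def)
    then show ?thesis
      using subspace_dim_equal[of K J] J K by (auto simp: good_def left_ideal_def)
  qed simp
  then show thesis
    using J(1) that[of J] by (auto simp: good_def minimal_left_ideal_def)
qed

text \<open>The socle \<open>N\<close> is an ideal. An idempotent \<open>f\<close> of
  \<open>N\<close> generating an ideal of largest dimension acts as the identity on
  \<open>N\<close>; were it not 1, the ideal generated by \<open>1 - f\<close> would contain a
  minimal ideal, which lies in \<open>N\<close> and is killed by \<open>f\<close>.\<close>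

lemma semisimple_if_reduced:
  assumes reduced: "\<And>(x :: 'a) n. x ^ n = 0 \<Longrightarrow> x = 0"
  shows semisimple
proof -
  define N where "N = span (\<Union>{I. minimal_left_ideal I})"
  have sN: "subspace N" by (simp add: N_def)
  have N_ideal: "a * x \<in> N" if "x \<in> N" for a x
    using that unfolding N_def
  proof (induction rule: span_induct_alt)
    case base
    show ?case by (simp add: span_zero)
  next
    case (step c x y)
    then obtain I where "minimal_left_ideal I" "x \<in> I" by blast
    then have "a * x \<in> span (\<Union>{I. minimal_left_ideal I})"
      by (intro span_base) (auto simp: minimal_left_ideal_def left_ideal_def)
    then show ?case
      using step by (simp add: distrib_left scale_mult_right[symmetric] span_add span_scale)
  qed
  have ideal: "left_ideal (range ((*) f))" for f :: 'a
  proof -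
    have "subspace (range ((*) f))"
    proof (rule subspaceI)
      show "0 \<in> range ((*) f)" by (metis mult_zero_right rangeI)
      fix x y c assume "x \<in> range ((*) f)" "y \<in> range ((*) f)"
      then obtain a b where "x = f * a" "y = f * b" by blast
      then have "x + y = f * (a + b)" "scale c x = f * scale c a"
        by (simp_all add: distrib_left scale_mult_right)
      then show "x + y \<in> range ((*) f)" "scale c x \<in> range ((*) f)" by blast+
    qed
    moreover have "a * x \<in> range ((*) f)" if "x \<in> range ((*) f)" for a x
    proof -
      from that obtain b where "x = f * b" by blast
      then have "a * x = f * (a * b)" by (simp add: mult.left_commute)
      then show ?thesis by blast
    qed
    ultimately show ?thesis by (simp add: left_ideal_def)
  qed
  define good where "good f \<longleftrightarrow> f \<in> N \<and> f * f = f" for f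
  have "good 0" by (simp add: good_def subspace_0[OF sN])
  \<comment> \<open>The idempotent 0 is admissible and all dimensions are strictly below
    \<open>Suc dimension\<close>, so a maximum exists.\<close>
  then obtain f where f: "good f" and max: "\<And>h. good h \<Longrightarrow> dim (range ((*) h)) \<le> dim (range ((*) f))"
    using ex_has_greatest_nat[of good 0 "\<lambda>h. dim (range ((*) h))" "Suc dimension"] dim_subset_UNIV
    by (auto simp: less_Suc_eq_le)
  have ff: "f * f = f" "f \<in> N" using f by (auto simp: good_def)
  have fN: "f * x = x" if "x \<in> N" for x
  proof -
    define w where "w = x - f * x"
    have w: "w \<in> N" "f * w = 0"
      using that ff N_ideal sN by (auto simp: w_def right_diff_distrib mult.assoc[symmetric] intro: subspace_diff)
    obtain y where y: "w = w * w * y" using ex_von_neumann_inverse[of w] reduced by blast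
    \<comment> \<open>An idempotent generating the same ideal as \<open>w\<close> and orthogonal to
      \<open>f\<close>; the ideal of the idempotent \<open>f + h\<close> would exceed that of
      \<open>f\<close> unless \<open>h = 0\<close>.\<close>
    define h where "h = w * y"
    have h: "h \<in> N" "h * h = h" "f * h = 0"
      using N_ideal[OF w(1), of y] w(2) y unfolding h_def by (simp_all add: ac_simps) (metis mult.commute mult.left_commute, metis mult.assoc mult_zero_left)
    have "good (f + h)"
      using ff h sN by (auto simp: good_def distrib_left distrib_right mult.commute[of h f] intro: subspace_add)
    moreover have "range ((*) f) \<subseteq> range ((*) (f + h))"
    proof
      fix a assume "a \<in> range ((*) f)"
      then obtain b where "a = f * b" by blast
      then have "a = (f + h) * (f * b)"
        using ff h by (simp add: distrib_right mult.assoc[symmetric] mult.commute[of h f])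
      then show "a \<in> range ((*) (f + h))" by blast
    qed
    ultimately have "range ((*) f) = range ((*) (f + h))"
      using max ideal by (intro subspace_dim_equal) (auto simp: left_ideal_def)
    moreover have "h \<in> range ((*) (f + h))"
    proof -
      have "h = (f + h) * h" using h by (simp add: distrib_right)
      then show ?thesis by blast
    qed
    ultimately obtain b where "h = f * b" by blast
    then have "h = f * h" using ff by (simp add: mult.assoc[symmetric])
    then have "h = 0" using h by simp
    then have "w = 0" using y by (simp add: h_def ac_simps)
    then show ?thesis by (simp add: w_def)
  qed
  have "f = 1"
  proof (rule ccontr)
    assume "f \<noteq> 1"
    then have "range ((*) (1 - f)) \<noteq> {0}"
      by (metis mult.right_neutral rangeI right_minus_eq singletonD)
    then obtain J where J: "minimal_left_ideal J" "J \<subseteq> range ((*) (1 - f))"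
      using ex_minimal_left_ideal[OF ideal] by blast
    have "x = 0" if "x \<in> J" for x
    proof -
      have "x \<in> N" using that J(1) by (auto simp: N_def intro: span_base)
      then have "x = f * x" using fN by simp
      moreover have "f * x = 0"
        using that J(2) ff(1) by (auto simp: algebra_simps mult.assoc[symmetric])
      ultimately show ?thesis by simp
    qed
    moreover have "0 \<in> J"
      using J(1) subspace_0 by (auto simp: minimal_left_ideal_def left_ideal_def)
    ultimately have "J = {0}" by blast
    then show False using J(1) by (simp add: minimal_left_ideal_def)
  qed
  then have "a \<in> N" for a using N_ideal[OF ff(2), of a] by simp
  then show ?thesis by (auto simp: semisimple_def N_def)
qed

lemma semisimple_if_frobenius_spans:
  assumes p: "prime p" "CHAR('k) = p" and span: "span (range (\<lambda>x :: 'a. x ^ p)) = UNIV"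
  shows semisimple
proof (rule semisimple_if_reduced)
  fix x :: 'a and n
  assume "x ^ n = 0"
  \<comment> \<open>The exponent is enlarged to a power of \<open>p\<close>, so that injectivity of
    the Frobenius map can be iterated.\<close>
  moreover have "n \<le> p ^ n"
    using p(1) by (meson less_imp_le less_exp power_mono le_trans prime_ge_2_nat zero_le)
  ultimately have "x ^ p ^ n = 0"
    by (metis le_add_diff_inverse mult_zero_left power_add)
  then show "x = 0"
  proof (induction n)
    case (Suc n)
    have "(x ^ p ^ n) ^ p = 0" using Suc.prems by (simp add: power_mult[symmetric] mult.commute)
    then show ?case using frobenius_injective[OF p span] Suc.IH by blast
  qed simp
qed

end

theorem lemma3p7:
  fixes scale :: "'k::field \<Rightarrow> 'h::comm_ring_1 \<Rightarrow> 'h"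
    and \<Delta> :: "'h \<Rightarrow> ('k, 'h) tensor"
    and \<epsilon> :: "'h \<Rightarrow> 'k"
    and S :: "'h \<Rightarrow> 'h"
    and L :: "'h set"
    and p m :: nat
  assumes "prime p"
    and "CHAR('k) = p"
    and "hopf_algebra scale \<Delta> \<epsilon> S"
    and "field_algebra.finite_dimensional scale"
    and "coalgebra.connected scale \<Delta>"
    and "hopf_algebra.essential_extension scale \<Delta> S L"
    and "card (UNIV :: 'g::{group_add,finite} set) = p ^ m"
    and "hopf_algebra.iso_group_algebra_dual scale \<Delta> \<epsilon> S TYPE('g) L"
  shows "(\<exists>z.
      field_algebra.subalgebra scale hull (insert z L) = UNIV \<and>
      (\<exists>u. hopf_algebra.cocycle scale \<Delta> L 2 u \<and>
        \<Delta> z = pure_tensor scale [z, 1] + pure_tensor scale [1, z] + u) \<and>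
      (\<forall>n. z ^ (p ^ n) \<notin> L) \<and>
      (\<exists>l\<ge>1. \<exists>c. \<exists>a\<in>L. c 0 \<noteq> 0 \<and>
        z ^ (p ^ l) + (\<Sum>i<l. scale (c i) (z ^ (p ^ i))) + a = 0)) \<and>
    field_algebra.semisimple scale"
proof -
  interpret hopf_algebra scale \<Delta> \<epsilon> S by fact
  obtain B0 where B0: "finite B0" "span B0 = UNIV"
    using assms(4) by (auto simp: finite_dimensional_def)
  obtain B where B: "B \<subseteq> B0" "independent B" "B0 \<subseteq> span B"
    using maximal_independent_subset by blast
  have "span B = UNIV"
    using B0(2) B(3) span_minimal[of B0 "span B"] by auto
  then interpret H: comm_fd_hopf scale \<Delta> \<epsilon> S B
    by unfold_locales (use B B0 in \<open>auto intro: finite_subset\<close>)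
  interpret A: comm_fd_algebra scale B ..
  obtain e :: "'g \<Rightarrow> 'h" where e: "dual_group_extension scale \<Delta> \<epsilon> S B e"
    and L: "L = range (dual_group_extension.elt scale e)"
    using H.dual_group_extensionI[OF assms(8)] .
  interpret dual_group_extension scale \<Delta> \<epsilon> S B e by (fact e)
  have hopf: "hopf_subalgebra L" and "L \<noteq> UNIV" and prims: "primitively_generated \<subseteq> L"
    and ess: "\<And>M. hopf_subalgebra M \<Longrightarrow> L \<subset> M \<Longrightarrow> M = UNIV"
    using assms(6) by (auto simp: essential_extension_def)
  have prim: "x \<in> range elt" if "primitive x" for x
    using prims that hull_subset[of "{x. primitive x}" hopf_subalgebra]
    by (auto simp: primitively_generated_def L)
  obtain z where z: "z \<notin> L" "\<Delta> z - z \<otimes> 1 - 1 \<otimes> z \<in> tensor_power scale 2 L"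
    using H.ex_almost_primitive[of L] assms(5) hopf \<open>L \<noteq> UNIV\<close>
    by (auto simp: hopf_subalgebra_def subalgebra_def)
  define u where "u = \<Delta> z - z \<otimes> 1 - 1 \<otimes> z"
  have u: "u \<in> tensor_power scale 2 L" and \<Delta>z: "\<Delta> z = z \<otimes> 1 + 1 \<otimes> z + u"
    using z by (simp_all add: u_def)
  obtain v where v: "u = elt2 v"
    using tensor_power_range_elt u unfolding L by blast
  have rel: "\<exists>\<mu> :: nat \<Rightarrow> 'k. \<mu> 0 = 1 \<and> (\<Sum>i\<le>N - r. scale (\<mu> i) (z ^ p ^ i)) \<in> L"
    if c: "r \<le> N" "c r \<noteq> 0" "\<And>i. i < r \<Longrightarrow> c i = 0" "(\<Sum>i\<le>N. scale (c i) (z ^ p ^ i)) \<in> L"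
    for c :: "nat \<Rightarrow> 'k" and N r
  proof (rule frobenius_relation[OF assms(1,2) \<Delta>z[unfolded v], of r N c])
    show "(\<Sum>i\<le>N. scale (c i) (z ^ p ^ i)) \<in> range elt" using c(4) by (simp only: L)
  qed (use prim c(1-3) in \<open>auto simp: L\<close>)
  have gen: "subalgebra hull (insert z L) = UNIV"
  proof (rule ess)
    show "hopf_subalgebra (subalgebra hull (insert z L))"
      by (rule H.hull_hopf_subalgebra[OF hopf \<Delta>z u])
    show "L \<subset> subalgebra hull (insert z L)"
      using hull_subset[of "insert z L" subalgebra] z(1) by auto
  qed
  have powers: "z ^ p ^ n \<notin> L" for n
  proof
    assume n: "z ^ p ^ n \<in> L"
    \<comment> \<open>The relation with the single term \<open>z ^ p ^ n\<close>; lowered by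
      \<open>n\<close> it leaves \<open>z\<close> alone, with coefficient 1.\<close>
    define c :: "nat \<Rightarrow> 'k" where "c i = (if i = n then 1 else 0)" for i
    have "(\<Sum>i\<le>n. scale (c i) (z ^ p ^ i)) = (\<Sum>i\<le>n. if i = n then z ^ p ^ i else 0)"
      by (intro sum.cong) (auto simp: c_def)
    then have "(\<Sum>i\<le>n. scale (c i) (z ^ p ^ i)) \<in> L" using n by simp
    then obtain \<mu> :: "nat \<Rightarrow> 'k" where "\<mu> 0 = 1" "(\<Sum>i\<le>n - n. scale (\<mu> i) (z ^ p ^ i)) \<in> L"
      using rel[of n n c] by (auto simp: c_def)
    then show False using z(1) by simp
  qed
  have sL: "subspace L" using hopf by (simp add: hopf_subalgebra_def subalgebra_def)
  obtain l c a where l: "l \<ge> 1" "c 0 \<noteq> 0" "a \<in> L" "z ^ (p ^ l) + (\<Sum>i<l. scale (c i) (z ^ (p ^ i))) + a = 0"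
  proof -
    obtain c :: "nat \<Rightarrow> 'k" and N i where c: "i \<le> N" "c i \<noteq> 0" "(\<Sum>i\<le>N. scale (c i) (z ^ p ^ i)) = 0"
      by (rule ex_sequence_relation[of B "\<lambda>i. z ^ p ^ i"]) (auto simp: H.finite_Basis H.span_Basis)
    define r where "r = (LEAST i. c i \<noteq> 0)"
    have r: "c r \<noteq> 0" "r \<le> N" "\<And>j. j < r \<Longrightarrow> c j = 0"
      using c LeastI[of "\<lambda>i. c i \<noteq> 0" i] Least_le[of "\<lambda>i. c i \<noteq> 0" i] not_less_Least
      unfolding r_def by (force+)
    \<comment> \<open>The relation sums to 0, an element of \<open>L\<close>, so \<open>rel\<close>
      lowers it by its first nonzero index and makes the coefficient of \<open>z\<close> itself
      equal to 1, now modulo \<open>L\<close>.\<close>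
    obtain \<mu> :: "nat \<Rightarrow> 'k" where \<mu>: "\<mu> 0 = 1" "(\<Sum>i\<le>N - r. scale (\<mu> i) (z ^ p ^ i)) \<in> L"
      using rel[of r N c] r c(3) subspace_0[OF sL] by auto
    \<comment> \<open>The top nonzero coefficient, by which the relation is divided to become monic;
      index 0 qualifies, so the maximum exists.\<close>
    define l where "l = (GREATEST i. i \<le> N - r \<and> \<mu> i \<noteq> 0)"
    have l: "l \<le> N - r" "\<mu> l \<noteq> 0"
      using GreatestI_nat[of "\<lambda>i. i \<le> N - r \<and> \<mu> i \<noteq> 0" 0 "N - r"] \<mu>(1) by (auto simp: l_def)
    have gt: "\<mu> i = 0" if "l < i" "i \<le> N - r" for i
      using Greatest_le_nat[of "\<lambda>i. i \<le> N - r \<and> \<mu> i \<noteq> 0" i "N - r"] that by (force simp: l_def)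
    define y where "y = (\<Sum>i\<le>l. scale (\<mu> i) (z ^ p ^ i))"
    have "y = (\<Sum>i\<le>N - r. scale (\<mu> i) (z ^ p ^ i))"
      unfolding y_def using l(1) gt by (intro sum.mono_neutral_left) auto
    then have y: "y \<in> L" using \<mu>(2) by simp
    have "l \<noteq> 0"
    proof
      assume "l = 0"
      then show False using y \<mu>(1) z(1) by (simp add: y_def)
    qed
    moreover have "scale (inverse (\<mu> l)) y = z ^ p ^ l + (\<Sum>i<l. scale (inverse (\<mu> l) * \<mu> i) (z ^ p ^ i))"
      unfolding y_def using l(2)
      by (simp add: lessThan_Suc_atMost[symmetric] scale_right_distrib scale_sum_right add.commute)
    moreover have "- scale (inverse (\<mu> l)) y \<in> L"
      using y sL by (intro subspace_neg subspace_scale)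
    ultimately show thesis
      using that[of l "\<lambda>i. inverse (\<mu> l) * \<mu> i" "- scale (inverse (\<mu> l)) y"] \<mu>(1) l(2) by simp
  qed
  have semisimple
  proof (rule A.semisimple_if_frobenius_spans[OF assms(1,2)])
    \<comment> \<open>The span of the \<open>p\<close>-th powers is a subalgebra, so it is
      everything once it contains \<open>L\<close> and \<open>z\<close>.\<close>
    let ?P = "span (range (\<lambda>x :: 'h. x ^ p))"
    have pow: "x ^ p \<in> ?P" for x by (simp add: span_base)
    have mult: "x * y \<in> ?P" if "x \<in> ?P" "y \<in> ?P" for x y
    proof -
      have 1: "a ^ p * y \<in> ?P" for a
        using that(2)
      proof (induction rule: span_induct_alt)
        case base show ?case by (simp add: span_zero)
      next
        case (step c w y)
        then obtain b where "w = b ^ p" by blast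
        then have "a ^ p * w \<in> ?P" using pow[of "a * b"] by (simp add: power_mult_distrib)
        then show ?case using step by (simp add: distrib_left scale_mult_right[symmetric] span_add span_scale)
      qed
      show ?thesis
        using that(1)
      proof (induction rule: span_induct_alt)
        case base show ?case by (simp add: span_zero)
      next
        case (step c w x)
        then obtain b where "w = b ^ p" by blast
        then show ?case using step 1 by (simp add: distrib_right scale_mult_left[symmetric] span_add span_scale)
      qed
    qed
    have P: "subalgebra ?P"
      using mult pow[of 1] by (simp add: subalgebra_def)
    \<comment> \<open>An idempotent is its own \<open>p\<close>-th power.\<close>
    have "e g \<in> ?P" for g
    proof -
      have "e g ^ Suc n = e g" for n by (induction n) (auto simp: e_mult)
      then have "e g ^ p = e g" using prime_gt_0_nat[OF assms(1)] by (cases p) auto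
      then show ?thesis using pow[of "e g"] by simp
    qed
    then have LP: "L \<subseteq> ?P"
      by (auto simp: L elt_def intro!: span_sum span_scale)
    have zi: "z ^ p ^ Suc i \<in> ?P" for i
      using pow[of "z ^ p ^ i"] by (simp add: power_mult[symmetric] mult.commute)
    obtain k where k: "l = Suc k" using l(1) by (cases l) auto
    have "z ^ p ^ l + (scale (c 0) z + (\<Sum>i<k. scale (c (Suc i)) (z ^ p ^ Suc i))) + a = 0"
      using l(4) by (simp only: k sum.lessThan_Suc_shift power_0 power_one_right)
    \<comment> \<open>As \<open>c 0\<close> is nonzero, \<open>z\<close> is expressed by
      \<open>a\<close> and by its own higher Frobenius powers, all of them in
      \<open>?P\<close>.\<close>
    then have "scale (c 0) z = - (z ^ p ^ l + (\<Sum>i<k. scale (c (Suc i)) (z ^ p ^ Suc i)) + a)"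
      by (simp add: eq_neg_iff_add_eq_0 algebra_simps)
    also have "\<dots> \<in> ?P"
      using zi[of k] l(3) LP unfolding k by (intro span_neg span_add span_sum span_scale zi) auto
    finally have "scale (inverse (c 0)) (scale (c 0) z) \<in> ?P" by (rule span_scale)
    then have "z \<in> ?P" using l(2) by simp
    then have "subalgebra hull (insert z L) \<subseteq> ?P"
      using P LP by (intro hull_minimal) auto
    then show "?P = UNIV" unfolding gen by (intro equalityI subset_UNIV)
  qed
  moreover have "cocycle L 2 u"
    by (rule H.almost_primitive_cocycle[OF \<Delta>z u])
  ultimately show ?thesis
    using gen \<Delta>z powers l by (intro conjI exI[of _ z] exI[of _ u] allI) blast+
qed

end
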